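(* There exists a finite matrix $\widetilde M\in\{-1,+1\}^{m\times N}$ with weak-learning margin $\gamma(\widetilde M)=\frac15>0$ such that exhaustive AdaBoost on $\widetilde M$ with smallest-index tie-breaking, started from the exact uniform distribution $D_1(i)=1/m$ for all $i$, does not converge to any finite cycle.
   Context: Exhaustive AdaBoost on a matrix $M\in\{-1,+1\}^{m\times N}$: given a state $D_t\in\Delta^{m-1}$ (the probability simplex in $\mathbb R^m$), the edges are $\mu_t(j)=(D_t^\top M)_j$, the selected column is $j_t=\min\operatorname{argmax}_{1\le j\le N}\mu_t(j)$ (smallest-index tie-breaking), $r_t=\mu_t(j_t)$, and the update is $D_{t+1}(i)=D_t(i)/(1+r_tM_{ij_t})$. The weak-learning margin is $\gamma(M)=\min_{D\in\Delta^{m-1}}\max_{1\le j\le N}(D^\top M)_j$. The sequence $(D_t)_{t\ge1}$ converges to a cycle of length $\ell\ge1$ if there exist $\widetilde D_0,\dots,\widetilde D_{\ell-1}$ with $D_{k\ell+b}\to\widetilde D_b$ as $k\to\infty$ for every $b\in\{0,\dots,\ell-1\}$; it converges to a finite cycle if it converges to a cycle of some finite length $\ell$. *)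

theory Defs
  imports "HOL-Analysis.Analysis"
begin

text \<open>Matrices M in {-1,+1}^(m x N) are represented as functions nat => nat => real,
  with row index i < m and column index j < N. Distributions D in the prob_simplex are
  functions nat => real, only the values at i < m being relevant.\<close>

definition pm1_matrix :: "nat \<Rightarrow> nat \<Rightarrow> (nat \<Rightarrow> nat \<Rightarrow> real) \<Rightarrow> bool" where
  "pm1_matrix m N M \<longleftrightarrow> (\<forall>i<m. \<forall>j<N. M i j = 1 \<or> M i j = -1)"

definition prob_simplex :: "nat \<Rightarrow> (nat \<Rightarrow> real) set" where
  "prob_simplex m = {D. (\<forall>i<m. 0 \<le> D i) \<and> (\<Sum>i<m. D i) = 1}"

definition edge :: "nat \<Rightarrow> (nat \<Rightarrow> nat \<Rightarrow> real) \<Rightarrow> (nat \<Rightarrow> real) \<Rightarrow> nat \<Rightarrow> real" where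
  "edge m M D j = (\<Sum>i<m. D i * M i j)"

definition margin :: "nat \<Rightarrow> nat \<Rightarrow> (nat \<Rightarrow> nat \<Rightarrow> real) \<Rightarrow> real" where
  "margin m N M = (INF D\<in>prob_simplex m. Max ((\<lambda>j. edge m M D j) ` {..<N}))"

definition sel_col :: "nat \<Rightarrow> nat \<Rightarrow> (nat \<Rightarrow> nat \<Rightarrow> real) \<Rightarrow> (nat \<Rightarrow> real) \<Rightarrow> nat" where
  "sel_col m N M D = (LEAST j. j < N \<and> (\<forall>k<N. edge m M D k \<le> edge m M D j))"

definition ada_step :: "nat \<Rightarrow> nat \<Rightarrow> (nat \<Rightarrow> nat \<Rightarrow> real) \<Rightarrow> (nat \<Rightarrow> real) \<Rightarrow> (nat \<Rightarrow> real)" where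
  "ada_step m N M D = (let j = sel_col m N M D; r = edge m M D j
     in (\<lambda>i. D i / (1 + r * M i j)))"

primrec ada_iter :: "nat \<Rightarrow> nat \<Rightarrow> (nat \<Rightarrow> nat \<Rightarrow> real) \<Rightarrow> nat \<Rightarrow> (nat \<Rightarrow> real)" where
  "ada_iter m N M 0 = (\<lambda>i. 1 / real m)"
| "ada_iter m N M (Suc k) = ada_step m N M (ada_iter m N M k)"

text \<open>The paper's D_t for t >= 1 (D_1 uniform).\<close>
definition adaD :: "nat \<Rightarrow> nat \<Rightarrow> (nat \<Rightarrow> nat \<Rightarrow> real) \<Rightarrow> nat \<Rightarrow> (nat \<Rightarrow> real)" where
  "adaD m N M t = ada_iter m N M (t - 1)"

definition conv_cycle :: "nat \<Rightarrow> (nat \<Rightarrow> (nat \<Rightarrow> real)) \<Rightarrow> nat \<Rightarrow> bool" where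
  "conv_cycle m D l \<longleftrightarrow> l \<ge> 1 \<and>
     (\<exists>Dt :: nat \<Rightarrow> nat \<Rightarrow> real. \<forall>b<l. \<forall>i<m. (\<lambda>k. D (k * l + b) i) \<longlonglongrightarrow> Dt b i)"

definition conv_finite_cycle :: "nat \<Rightarrow> (nat \<Rightarrow> (nat \<Rightarrow> real)) \<Rightarrow> bool" where
  "conv_finite_cycle m D \<longleftrightarrow> (\<exists>l. conv_cycle m D l)"

end

(*
  If rows are pairs (r1, r2) and every column depends on one component only, a product distribution
  stays a product, and AdaBoost runs the two factors independently: at each round the factor with the
  larger maximal edge moves. Each factor used here converges to a cycle of length 10 with the same
  minimal edge 5/16, attained once per cycle, which is approached from above with an error of exact
  order kappa^(-c) after c cycles. A factor whose next edge is the minimal one waits until its excess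
  over 5/16 is the larger of the two, so cycles of the two factors are interleaved by sorting the
  excesses. Convergence to a finite cycle would make this interleaving eventually periodic, hence
  kappa1^p = kappa2^q for some p, q > 0; but kappa1 = 5 and kappa2 = 56/11.

  Each factor has five columns and rows with at most two entries -1. Rescaling column j by v_j, the
  row with entries -1 in columns a, b has weight proportional to c_ab v_a v_b, and a boosting step at
  column j replaces v_j by the solution of a linear equation. The weights c_ab are chosen so that ten
  steps multiply v = (1,...,1) by kappa. One additional row with a single entry -1 contributes a
  linear term, which becomes relatively smaller by the factor kappa in every cycle and is responsible
  for the excess. Arbitrary rational initial weights are obtained by repeating rows.
*)

theory Submission
  imports Defs "HOL-Library.Landau_Symbols"
begin

section \<open>Boosting on product matrices\<close>

text \<open>The two minimal edges must coincide: a factor that came close to a smaller minimum would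
  never be chosen again, and the other one would run alone into its cycle. They must also be
  approached and not attained, because two exact cycles would be interleaved periodically. The
  quadratic weights provide the exact cycle: they are homogeneous, so the scale of \<open>v\<close>
  is invisible in the distribution and may grow while the distribution repeats. The linear term
  breaks the homogeneity and shows the scale as an excess of order 1/scale. Logarithms of the
  excesses are known only up to a bounded error, which suffices, since only their linear rates
  enter.

  The margin 1/5 has nothing to do with the dynamics. A row has at most two entries -1 in the five
  columns of its factor, so its sum there is at least 1 and the average edge is at least 1/5 under
  every distribution. The five pairs forming a pentagon, equally weighted, give every column the
  edge 1/5. The growth factors are incommensurable because 5 does not divide 56.\<close>

definition top_edge :: "nat \<Rightarrow> nat \<Rightarrow> (nat \<Rightarrow> nat \<Rightarrow> real) \<Rightarrow> (nat \<Rightarrow> real) \<Rightarrow> real" where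
  "top_edge m N M D = edge m M D (sel_col m N M D)"

lemma sel_col_less: "sel_col m N M D < N"
  and edge_le_top_edge: "k < N \<Longrightarrow> edge m M D k \<le> top_edge m N M D"
  if "0 < N"
proof -
  let ?P = "\<lambda>j. j < N \<and> (\<forall>k<N. edge m M D k \<le> edge m M D j)"
  have "Max (edge m M D ` {..<N}) \<in> edge m M D ` {..<N}"
    using that by (intro Max_in) auto
  then obtain j where j: "j < N" "edge m M D j = Max (edge m M D ` {..<N})"
    by auto
  then have "?P j" by (auto intro!: Max_ge)
  then have "?P (sel_col m N M D)"
    unfolding sel_col_def by (rule LeastI)
  then show "sel_col m N M D < N" "k < N \<Longrightarrow> edge m M D k \<le> top_edge m N M D"
    by (auto simp: top_edge_def)
qed

lemma edge_less_top_edge: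
  assumes "k < sel_col m N M D" "0 < N"
  shows "edge m M D k < top_edge m N M D"
proof (rule ccontr)
  assume "\<not> ?thesis"
  then have "\<forall>i<N. edge m M D i \<le> edge m M D k"
    using edge_le_top_edge[OF assms(2), of _ m M D] by fastforce
  then have "sel_col m N M D \<le> k"
    unfolding sel_col_def using sel_col_less[OF assms(2), of m M D] assms(1)
    by (intro Least_le) auto
  then show False using assms(1) by simp
qed

lemma sel_col_eqI:
  assumes "j < N" "\<And>k. k < N \<Longrightarrow> edge m M D k \<le> edge m M D j"
    "\<And>k. k < j \<Longrightarrow> edge m M D k < edge m M D j"
  shows "sel_col m N M D = j"
  unfolding sel_col_def
proof (rule Least_equality)
  fix i assume "i < N \<and> (\<forall>k<N. edge m M D k \<le> edge m M D i)"
  then show "j \<le> i" using assms by (meson leD leI)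
qed (use assms in auto)

lemma ada_step_apply:
  "ada_step m N M D i = D i / (1 + top_edge m N M D * M i (sel_col m N M D))"
  by (simp add: ada_step_def top_edge_def Let_def)

text \<open>As \<open>x * x = 1\<close>, the AdaBoost factor becomes linear in the sign, so sums
  over an updated distribution reduce to the old total weight and the old edge.\<close>

lemma inverse_pm1:
  fixes r :: real
  assumes "x = 1 \<or> x = -1" "\<bar>r\<bar> < 1"
  shows "1 / (1 + r * x) = (1 - r * x) / (1 - r\<^sup>2)"
proof -
  have pos: "1 + r > 0" "1 - r > 0" using assms(2) by auto
  have "1 - r\<^sup>2 = (1 - r) * (1 + r)" by (simp add: power2_eq_square algebra_simps)
  then show ?thesis using assms(1) pos by auto
qed

text \<open>With total weight 1 and edge \<open>r\<close>, the linearised update has total (1 - r *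
  r) / (1 - r^2) and edge (r - r) / (1 - r^2). The vanishing edge of the column just used is what
  later makes a move visible.\<close>

lemma ada_step_sum:
  assumes "pm1_matrix m N M" "0 < N" "(\<Sum>i<m. D i) = 1" "\<bar>top_edge m N M D\<bar> < 1"
  shows "(\<Sum>i<m. ada_step m N M D i) = 1"
    and "edge m M (ada_step m N M D) (sel_col m N M D) = 0"
proof -
  define r j where "r = top_edge m N M D" and "j = sel_col m N M D"
  have j: "j < N" unfolding j_def by (rule sel_col_less) fact
  have pm: "M i j = 1 \<or> M i j = -1" if "i < m" for i
    using assms(1) that j by (auto simp: pm1_matrix_def)
  have edge: "(\<Sum>i<m. D i * M i j) = r"
    by (simp add: r_def j_def top_edge_def edge_def)
  have r: "1 - r\<^sup>2 \<noteq> 0"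
    using assms(4) abs_square_less_1[of r] by (simp add: r_def)
  have st: "ada_step m N M D i = (D i - r * (D i * M i j)) / (1 - r\<^sup>2)" if "i < m" for i
  proof -
    have "ada_step m N M D i = D i * (1 / (1 + r * M i j))"
      by (simp add: ada_step_apply r_def j_def)
    also have "\<dots> = D i * ((1 - r * M i j) / (1 - r\<^sup>2))"
      using inverse_pm1[OF pm[OF that]] assms(4) by (simp add: r_def)
    finally show ?thesis by (simp add: algebra_simps)
  qed
  have "(\<Sum>i<m. ada_step m N M D i) = ((\<Sum>i<m. D i) - r * (\<Sum>i<m. D i * M i j)) / (1 - r\<^sup>2)"
    by (simp add: st sum_subtractf sum_distrib_left sum_divide_distrib[symmetric])
  then show "(\<Sum>i<m. ada_step m N M D i) = 1"
    using r by (simp add: assms(3) edge power2_eq_square)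
  have "ada_step m N M D i * M i j = (D i * M i j - r * D i) / (1 - r\<^sup>2)" if "i < m" for i
    using pm[OF that] by (auto simp: st[OF that] algebra_simps)
  then have "edge m M (ada_step m N M D) j
      = ((\<Sum>i<m. D i * M i j) - r * (\<Sum>i<m. D i)) / (1 - r\<^sup>2)"
    by (simp add: edge_def sum_subtractf sum_distrib_left sum_divide_distrib[symmetric])
  then show "edge m M (ada_step m N M D) (sel_col m N M D) = 0"
    by (simp add: edge assms(3) j_def[symmetric])
qed

text \<open>The bound on the top edges keeps \<open>1 - r\<^sup>2\<close> nonzero in every round, so
  that normalisation propagates along the whole run.\<close>

definition regular_run :: "nat \<Rightarrow> nat \<Rightarrow> (nat \<Rightarrow> nat \<Rightarrow> real) \<Rightarrow> bool" where
  "regular_run m N M \<longleftrightarrow> 0 < m \<and> 0 < N \<and> pm1_matrix m N M \<and>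
     (\<forall>k. \<bar>top_edge m N M (ada_iter m N M k)\<bar> < 1)"

lemma ada_iter_sum:
  assumes "regular_run m N M"
  shows "(\<Sum>i<m. ada_iter m N M k i) = 1"
proof (induction k)
  case 0
  then show ?case using assms by (simp add: regular_run_def)
next
  case (Suc k)
  then show ?case using assms by (auto simp: regular_run_def intro!: ada_step_sum(1))
qed


section \<open>Product distributions and the choice between two factors\<close>

definition prod_mat ::
  "nat \<Rightarrow> nat \<Rightarrow> (nat \<Rightarrow> nat \<Rightarrow> real) \<Rightarrow> (nat \<Rightarrow> nat \<Rightarrow> real) \<Rightarrow> nat \<Rightarrow> nat \<Rightarrow> real" where
  "prod_mat m1 N1 M1 M2 i j = (if j < N1 then M1 (i mod m1) j else M2 (i div m1) (j - N1))"

text \<open>The index \<open>i\<close> encodes the pair \<open>(i mod m1, i div m1)\<close>;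
  induction on \<open>m2\<close> appends one block of length \<open>m1\<close>.\<close>

lemma sum_mod_div:
  fixes f g :: "nat \<Rightarrow> real"
  shows "(\<Sum>i<m1 * m2. f (i mod m1) * g (i div m1)) = (\<Sum>i<m1. f i) * (\<Sum>i<m2. g i)"
proof (induction m2)
  case (Suc m2)
  have "(\<Sum>i<m1 * Suc m2. f (i mod m1) * g (i div m1))
      = (\<Sum>i<m1 * m2. f (i mod m1) * g (i div m1))
        + (\<Sum>i=m1 * m2..<m1 * m2 + m1. f (i mod m1) * g (i div m1))"
    by (subst sum.atLeastLessThan_concat[symmetric, of 0 "m1 * m2", simplified atLeast0LessThan])
       (auto simp: algebra_simps atLeast0LessThan)
  also have "(\<Sum>i=m1 * m2..<m1 * m2 + m1. f (i mod m1) * g (i div m1))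
      = (\<Sum>i<m1. f ((i + m1 * m2) mod m1) * g ((i + m1 * m2) div m1))"
    using sum.shift_bounds_nat_ivl[of "\<lambda>i. f (i mod m1) * g (i div m1)" 0 "m1 * m2" m1]
    by (simp add: add.commute atLeast0LessThan)
  also have "\<dots> = (\<Sum>i<m1. f i * g m2)"
    by (intro sum.cong) auto
  finally show ?case
    by (simp add: Suc.IH sum_distrib_right[symmetric] algebra_simps)
qed simp

lemma edge_prod_mat:
  assumes "\<And>i. i < m1 * m2 \<Longrightarrow> D i = p (i mod m1) * q (i div m1)"
  shows "j < N1 \<Longrightarrow> edge (m1 * m2) (prod_mat m1 N1 M1 M2) D j = edge m1 M1 p j * (\<Sum>i<m2. q i)"
    and "edge (m1 * m2) (prod_mat m1 N1 M1 M2) D (N1 + j) = (\<Sum>i<m1. p i) * edge m2 M2 q j"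
proof -
  have "edge (m1 * m2) (prod_mat m1 N1 M1 M2) D j
      = (\<Sum>i<m1 * m2. (p (i mod m1) * M1 (i mod m1) j) * q (i div m1))" if "j < N1"
    unfolding edge_def using assms that
    by (intro sum.cong) (auto simp: prod_mat_def)
  then show "j < N1 \<Longrightarrow> edge (m1 * m2) (prod_mat m1 N1 M1 M2) D j = edge m1 M1 p j * (\<Sum>i<m2. q i)"
    by (simp add: sum_mod_div[where f = "\<lambda>i. p i * M1 i j" and g = q] edge_def)
  have "edge (m1 * m2) (prod_mat m1 N1 M1 M2) D (N1 + j)
      = (\<Sum>i<m1 * m2. p (i mod m1) * (q (i div m1) * M2 (i div m1) j))"
    unfolding edge_def using assms
    by (intro sum.cong) (auto simp: prod_mat_def)
  then show "edge (m1 * m2) (prod_mat m1 N1 M1 M2) D (N1 + j) = (\<Sum>i<m1. p i) * edge m2 M2 q j"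
    by (simp add: sum_mod_div[where f = p and g = "\<lambda>i. q i * M2 i j"] edge_def)
qed

text \<open>The state counts the rounds already spent in each factor. A tie goes to the first factor
  because its columns come first in the product matrix.\<close>

primrec merge :: "(nat \<Rightarrow> real) \<Rightarrow> (nat \<Rightarrow> real) \<Rightarrow> nat \<Rightarrow> nat \<times> nat" where
  "merge a b 0 = (0, 0)"
| "merge a b (Suc t) = (let (k, l) = merge a b t in if b l \<le> a k then (Suc k, l) else (k, Suc l))"

lemma merge_add: "fst (merge a b t) + snd (merge a b t) = t"
  by (induction t) (auto simp: Let_def split: prod.splits)

text \<open>Both factors have total weight 1, so the edges of the product are exactly those of the
  factors. The selected column depends on one component of the row, hence its update changes one
  factor and leaves the other frozen.\<close>

lemma ada_iter_prod_mat:
  fixes m1 N1 M1 m2 N2 M2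
  defines "a \<equiv> \<lambda>k. top_edge m1 N1 M1 (ada_iter m1 N1 M1 k)"
    and "b \<equiv> \<lambda>k. top_edge m2 N2 M2 (ada_iter m2 N2 M2 k)"
  assumes reg: "regular_run m1 N1 M1" "regular_run m2 N2 M2"
  assumes "i < m1 * m2"
  shows "ada_iter (m1 * m2) (N1 + N2) (prod_mat m1 N1 M1 M2) t i
    = ada_iter m1 N1 M1 (fst (merge a b t)) (i mod m1) * ada_iter m2 N2 M2 (snd (merge a b t)) (i div m1)"
  using \<open>i < m1 * m2\<close>
proof (induction t arbitrary: i)
  case 0
  then show ?case by simp
next
  case (Suc t)
  obtain k l where kl: "merge a b t = (k, l)" by force
  define p q where "p = ada_iter m1 N1 M1 k" and "q = ada_iter m2 N2 M2 l"
  define M D where "M = prod_mat m1 N1 M1 M2" and "D = ada_iter (m1 * m2) (N1 + N2) M t"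
  have N: "0 < N1" "0 < N2" using reg by (auto simp: regular_run_def)
  have D: "D i = p (i mod m1) * q (i div m1)" if "i < m1 * m2" for i
    using Suc.IH[OF that] by (simp add: kl p_def q_def D_def M_def)
  have sums: "(\<Sum>i<m1. p i) = 1" "(\<Sum>i<m2. q i) = 1"
    unfolding p_def q_def by (rule ada_iter_sum, fact)+
  have left: "edge (m1 * m2) M D j = edge m1 M1 p j" if "j < N1" for j
    using edge_prod_mat(1)[of m1 m2 D p q j N1 M1 M2] D that by (simp add: sums M_def)
  have right: "edge (m1 * m2) M D (N1 + j) = edge m2 M2 q j" for j
    using edge_prod_mat(2)[of m1 m2 D p q N1 M1 M2 j] D by (simp add: sums M_def)
  have all: "edge (m1 * m2) M D j = (if j < N1 then edge m1 M1 p j else edge m2 M2 q (j - N1))" for j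
    using left[of j] right[of "j - N1"] by auto
  define j1 j2 where "j1 = sel_col m1 N1 M1 p" and "j2 = sel_col m2 N2 M2 q"
  have j: "j1 < N1" "j2 < N2" using N by (auto simp: j1_def j2_def sel_col_less)
  have e1: "edge m1 M1 p i \<le> a k" if "i < N1" for i
    using edge_le_top_edge[OF N(1) that] by (simp add: a_def p_def)
  have e2: "edge m2 M2 q i \<le> b l" if "i < N2" for i
    using edge_le_top_edge[OF N(2) that] by (simp add: b_def q_def)
  have f: "edge m1 M1 p j1 = a k" "edge m2 M2 q j2 = b l"
    by (auto simp: a_def b_def j1_def j2_def p_def q_def top_edge_def)
  have i: "i mod m1 < m1" "i div m1 < m2"
    using Suc.prems reg(1) by (auto simp: regular_run_def less_mult_imp_div_less mult.commute)
  show ?case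
  proof (cases "b l \<le> a k")
    case True
    have "sel_col (m1 * m2) (N1 + N2) M D = j1"
    proof (rule sel_col_eqI)
      fix k' assume "k' < N1 + N2"
      then show "edge (m1 * m2) M D k' \<le> edge (m1 * m2) M D j1"
        using j e1[of k'] e2[of "k' - N1"] True f by (cases "k' < N1") (force simp: all)+
    next
      fix k' assume "k' < j1"
      then show "edge (m1 * m2) M D k' < edge (m1 * m2) M D j1"
        using j edge_less_top_edge[of k' m1 N1 M1 p] N(1) by (simp add: all j1_def top_edge_def)
    qed (use j in auto)
    then have "ada_step (m1 * m2) (N1 + N2) M D i = D i / (1 + edge m1 M1 p j1 * M i j1)"
      using j by (simp add: ada_step_apply top_edge_def left)
    also have "\<dots> = ada_step m1 N1 M1 p (i mod m1) * q (i div m1)"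
      using j Suc.prems by (simp add: D M_def prod_mat_def ada_step_apply top_edge_def j1_def)
    finally show ?thesis
      using True by (simp add: kl D_def M_def p_def q_def)
  next
    case False
    \<comment> \<open>All \<open>N1\<close> columns of the first factor precede this one, so they
      must have strictly smaller edges; this is the strict case of the comparison in
      \<open>merge\<close>.\<close>
    have "sel_col (m1 * m2) (N1 + N2) M D = N1 + j2"
    proof (rule sel_col_eqI)
      fix k' assume "k' < N1 + N2"
      then show "edge (m1 * m2) M D k' \<le> edge (m1 * m2) M D (N1 + j2)"
        using j e1[of k'] e2[of "k' - N1"] False f by (cases "k' < N1") (force simp: all)+
    next
      fix k' assume "k' < N1 + j2"
      then show "edge (m1 * m2) M D k' < edge (m1 * m2) M D (N1 + j2)"
        using j e1[of k'] False f edge_less_top_edge[of "k' - N1" m2 N2 M2 q] N(2)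
        by (cases "k' < N1") (auto simp: all j2_def top_edge_def)
    qed (use j in auto)
    then have "ada_step (m1 * m2) (N1 + N2) M D i = D i / (1 + edge m2 M2 q j2 * M i (N1 + j2))"
      using j by (simp add: ada_step_apply top_edge_def right)
    also have "\<dots> = p (i mod m1) * ada_step m2 N2 M2 q (i div m1)"
      using j Suc.prems by (simp add: D M_def prod_mat_def ada_step_apply top_edge_def j2_def)
    finally show ?thesis
      using False by (simp add: kl D_def M_def p_def q_def)
  qed
qed

section \<open>Merging two burst sequences\<close>

text \<open>The maximal edges along a run that approaches a cycle of length 10 with minimal edge \<open>\<alpha>\<close>.\<close>

definition bursts :: "real \<Rightarrow> real \<Rightarrow> real \<Rightarrow> (nat \<Rightarrow> real) \<Rightarrow> bool" where
  "bursts \<alpha> \<eta> \<kappa> e \<longleftrightarrow>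
     (\<forall>k. \<not> 10 dvd k \<longrightarrow> \<alpha> + \<eta> \<le> e k) \<and>
     (\<forall>c. \<alpha> < e (10 * c) \<and> e (10 * c) < \<alpha> + \<eta>) \<and>
     (\<lambda>c. - ln (e (10 * c) - \<alpha>) / real c) \<longlonglongrightarrow> ln \<kappa>"

lemma bursts_gt:
  assumes "bursts \<alpha> \<eta> \<kappa> e" "0 < \<eta>"
  shows "\<alpha> < e k"
proof (cases "10 dvd k")
  case True
  then show ?thesis using assms by (auto simp: bursts_def elim!: dvdE)
next
  case False
  then have "\<alpha> + \<eta> \<le> e k" using assms by (auto simp: bursts_def)
  then show ?thesis using assms by simp
qed

text \<open>The negative logarithm of the excess grows linearly with slope
  \<open>ln \<kappa> > 0\<close>, so the excess tends to 0. The lower bound \<open>c0\<close> allows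
  choosing a late cycle.\<close>

lemma bursts_small:
  assumes "bursts \<alpha> \<eta> \<kappa> e" "1 < \<kappa>" "\<alpha> < z"
  shows "\<exists>c\<ge>c0. e (10 * c) < z"
proof -
  define X where "X c = - ln (e (10 * c) - \<alpha>)" for c
  have "(\<lambda>c. X c / real c) \<longlonglongrightarrow> ln \<kappa>"
    using assms by (simp add: bursts_def X_def)
  moreover have "filterlim real at_top sequentially" by (rule filterlim_real_sequentially)
  ultimately have "filterlim (\<lambda>c. X c / real c * real c) at_top sequentially"
    using assms(2) by (intro filterlim_tendsto_pos_mult_at_top) auto
  then have "eventually (\<lambda>c. X c / real c * real c > - ln (z - \<alpha>)) sequentially"
    by (simp add: filterlim_at_top_dense)
  then have "eventually (\<lambda>c. c \<ge> c0 \<and> c > 0 \<and> X c > - ln (z - \<alpha>)) sequentially"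
    using eventually_ge_at_top[of c0] eventually_gt_at_top[of 0] by eventually_elim auto
  then obtain c where c: "c \<ge> c0" "X c > - ln (z - \<alpha>)"
    by (metis (no_types, lifting) eventually_sequentially order_refl)
  have "e (10 * c) - \<alpha> > 0" using assms(1) by (auto simp: bursts_def)
  then have "e (10 * c) - \<alpha> < z - \<alpha>"
    using c(2) assms(3) by (simp add: X_def)
  then show ?thesis using c(1) by auto
qed

text \<open>The bounded discrepancy gives \<open>f c / c\<close> the limit \<open>q / p\<close>, so
  \<open>Y (f c) / c\<close> tends to \<open>q * b / p\<close>, and the comparison of
  \<open>X c\<close> with \<open>Y (f c)\<close> passes to the limit.\<close>

lemma rate_le:
  fixes X Y :: "nat \<Rightarrow> real"
  assumes "(\<lambda>c. X c / real c) \<longlonglongrightarrow> a" "(\<lambda>d. Y d / real d) \<longlonglongrightarrow> b"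
    and "\<And>c. X c \<le> Y (f c)" "\<And>c. \<bar>q * real c - p * real (f c)\<bar> \<le> C" "0 < p" "0 < q"
  shows "p * a \<le> q * b"
proof -
  have Cc: "(\<lambda>c. C / real c) \<longlonglongrightarrow> 0"
    by (rule tendsto_divide_0[OF tendsto_const filterlim_at_top_imp_at_infinity])
       (rule filterlim_real_sequentially)
  have "(\<lambda>c. q - p * (real (f c) / real c)) \<longlonglongrightarrow> 0"
  proof (rule tendsto_rabs_zero_cancel, rule tendsto_sandwich[OF _ _ tendsto_const Cc])
    show "\<forall>\<^sub>F c in sequentially. \<bar>q - p * (real (f c) / real c)\<bar> \<le> C / real c"
      using eventually_gt_at_top[of 0]
    proof eventually_elim
      case (elim c)
      have "q - p * (real (f c) / real c) = (q * real c - p * real (f c)) / real c"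
        using elim by (simp add: field_simps)
      then show ?case
        using assms(4)[of c] elim by (simp add: divide_right_mono)
    qed
  qed auto
  from tendsto_diff[OF tendsto_const[of q] this]
  have lim: "(\<lambda>c. p * (real (f c) / real c)) \<longlonglongrightarrow> q" by simp
  have "filterlim (\<lambda>c. p * (real (f c) / real c) * real c) at_top sequentially"
    by (intro filterlim_tendsto_pos_mult_at_top[OF lim assms(6)] filterlim_real_sequentially)
  then have "filterlim (\<lambda>c. (1 / p) * (p * (real (f c) / real c) * real c)) at_top sequentially"
    using assms(5) by (intro filterlim_tendsto_pos_mult_at_top[OF tendsto_const]) auto
  \<comment> \<open>Divergence of \<open>f\<close> is needed to substitute \<open>f c\<close> into
    the limit of \<open>Y d / d\<close>.\<close>
  then have "filterlim (\<lambda>c. real (f c)) at_top sequentially"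
  proof (rule filterlim_mono_eventually[OF _ order_refl order_refl])
    show "eventually (\<lambda>c. 1 / p * (p * (real (f c) / real c) * real c) = real (f c)) sequentially"
      using eventually_gt_at_top[of 0] by eventually_elim (use assms(5) in auto)
  qed
  then have f: "filterlim f at_top sequentially"
    using filterlim_compose[OF filterlim_nat_sequentially] 
    by (simp add: filterlim_sequentially_iff_filterlim_real)
  have "(\<lambda>c. p * (real (f c) / real c) * (Y (f c) / real (f c))) \<longlonglongrightarrow> q * b"
    using lim filterlim_compose[OF assms(2) f] by (rule tendsto_mult)
  moreover have "(\<lambda>c. p * (X c / real c)) \<longlonglongrightarrow> p * a"
    by (intro tendsto_intros assms)
  moreover have "eventually (\<lambda>c. f c > 0) sequentially"
    using f eventually_gt_at_top[of 0] by (auto simp: filterlim_iff)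
  then have "eventually (\<lambda>c. p * (X c / real c) \<le> p * (real (f c) / real c) * (Y (f c) / real (f c))) sequentially"
    using eventually_gt_at_top[of 0]
    by eventually_elim (use assms(3,5) in \<open>auto simp: divide_right_mono mult_left_mono\<close>)
  ultimately show ?thesis
    by (rule tendsto_le[OF trivial_limit_sequentially])
qed

text \<open>Discrete intermediate values: the least time with a value above \<open>k\<close> is
  preceded by the value \<open>k\<close>, since increments are at most 1.\<close>

lemma steps_reach:
  fixes x :: "nat \<Rightarrow> nat"
  assumes "x 0 = 0" "\<And>s. x (Suc s) \<le> Suc (x s)" "x t > k"
  shows "\<exists>s. x s = k \<and> x (Suc s) = Suc k"
proof -
  define u where "u = (LEAST s. x s > k)"
  have u: "x u > k" unfolding u_def using assms(3) by (rule LeastI)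
  have before: "x s \<le> k" if "s < u" for s
    using not_less_Least[OF that[unfolded u_def]] by simp
  obtain s where s: "u = Suc s" using u assms(1) by (cases u) auto
  then have "x s \<le> k" using before by simp
  then show ?thesis using u assms(2)[of s] s by (intro exI[of _ s]) auto
qed

text \<open>From \<open>s0\<close> on the values repeat with period \<open>l\<close>, so a finite
  initial segment contains them all.\<close>

lemma bounded_shift_invariant:
  fixes g :: "nat \<Rightarrow> real"
  assumes "\<And>s. s \<ge> s0 \<Longrightarrow> g (s + l) = g s" "0 < l"
  shows "\<exists>C. \<forall>s. \<bar>g s\<bar> \<le> C"
proof -
  define C where "C = Max ((\<lambda>s. \<bar>g s\<bar>) ` {..s0 + l})"
  have C: "\<bar>g s\<bar> \<le> C" if "s \<le> s0 + l" for s
    unfolding C_def using that by (intro Max_ge) auto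
  have "\<bar>g s\<bar> \<le> C" for s
  proof (induction s rule: less_induct)
    case (less s)
    show ?case
    proof (cases "s \<le> s0 + l")
      case False
      then have "g s = g (s - l)" using assms(1)[of "s - l"] by simp
      then show ?thesis using less.IH[of "s - l"] False assms(2) by simp
    qed (rule C)
  qed
  then show ?thesis by blast
qed

section \<open>Interleaving of two burst sequences\<close>

locale burst_merge =
  fixes \<alpha> \<eta> \<kappa>1 \<kappa>2 :: real and a b :: "nat \<Rightarrow> real"
  assumes a: "bursts \<alpha> \<eta> \<kappa>1 a" and b: "bursts \<alpha> \<eta> \<kappa>2 b"
    and pos: "0 < \<eta>" "1 < \<kappa>1" "1 < \<kappa>2"
begin

abbreviation "x s \<equiv> fst (merge a b s)"
abbreviation "y s \<equiv> snd (merge a b s)"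

lemma step: "x (Suc s) = (if b (y s) \<le> a (x s) then Suc (x s) else x s)"
  "y (Suc s) = (if b (y s) \<le> a (x s) then y s else Suc (y s))"
  by (auto simp: Let_def split: prod.splits)

lemma step_le: "x (Suc s) \<le> Suc (x s)" "y (Suc s) \<le> Suc (y s)"
  by (simp_all add: step del: merge.simps)

text \<open>If the first factor rested forever at index \<open>k0\<close>, the second would run
  through all its cycles and reach one whose minimal edge is below \<open>a k0\<close>, which
  exceeds \<alpha>. At that moment the first factor would have to move.\<close>

lemma x_unbounded: "\<exists>s. x s > k"
proof (rule ccontr)
  assume "\<not> ?thesis"
  then have le: "x s \<le> k" for s by (simp add: not_less)
  define k0 where "k0 = Max (range x)"
  have fin: "finite (range x)" by (rule finite_subset[of _ "{..k}"]) (use le in auto)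
  then have "k0 \<in> range x" unfolding k0_def by (intro Max_in) auto
  then obtain s1 where s1: "x s1 = k0" by auto
  have mono: "x s \<le> x (s + n)" for s n by (induction n) (auto simp: step simp del: merge.simps)
  have const: "x s = k0" if "s \<ge> s1" for s
  proof (rule antisym)
    show "x s \<le> k0" unfolding k0_def using fin by (intro Max_ge) auto
    show "k0 \<le> x s" using mono[of s1 "s - s1"] that s1 by simp
  qed
  \<comment> \<open>The condition \<open>c \<ge> s1\<close> places the time
    \<open>10 * c + k0\<close>, at which the counters are \<open>k0\<close> and
    \<open>10 * c\<close>, inside the phase of rest.\<close>
  obtain c where c: "c \<ge> s1" "b (10 * c) < a k0"
    using bursts_small[OF b pos(3) bursts_gt[OF a pos(1), of k0]] by blast
  define s where "s = 10 * c + k0"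
  have "s \<ge> s1" using c by (simp add: s_def)
  then have "x s = k0" "x (Suc s) = k0" by (simp_all add: const del: merge.simps)
  moreover have "y s = 10 * c" using merge_add[of a b s] \<open>x s = k0\<close> by (simp add: s_def)
  ultimately show False using c step(1)[of s] by simp
qed

lemma y_unbounded: "\<exists>s. y s > k"
proof (rule ccontr)
  assume "\<not> ?thesis"
  then have le: "y s \<le> k" for s by (simp add: not_less)
  define k0 where "k0 = Max (range y)"
  have fin: "finite (range y)" by (rule finite_subset[of _ "{..k}"]) (use le in auto)
  then have "k0 \<in> range y" unfolding k0_def by (intro Max_in) auto
  then obtain s1 where s1: "y s1 = k0" by auto
  have mono: "y s \<le> y (s + n)" for s n by (induction n) (auto simp: step simp del: merge.simps)
  have const: "y s = k0" if "s \<ge> s1" for s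
  proof (rule antisym)
    show "y s \<le> k0" unfolding k0_def using fin by (intro Max_ge) auto
    show "k0 \<le> y s" using mono[of s1 "s - s1"] that s1 by simp
  qed
  obtain c where c: "c \<ge> s1" "a (10 * c) < b k0"
    using bursts_small[OF a pos(2) bursts_gt[OF b pos(1), of k0]] by blast
  define s where "s = 10 * c + k0"
  have "s \<ge> s1" using c by (simp add: s_def)
  then have "y s = k0" "y (Suc s) = k0" by (simp_all add: const del: merge.simps)
  moreover have "x s = 10 * c" using merge_add[of a b s] \<open>y s = k0\<close> by (simp add: s_def)
  ultimately show False using c step(2)[of s] by simp
qed

text \<open>When the first factor leaves a minimal edge, the other edge is no larger and thus below
  \<open>\<alpha> + \<eta>\<close>, which happens only at the start of a cycle of the second
  factor.\<close>

lemma x_burst: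
  obtains s d where "x s = 10 * c" "y s = 10 * d" "b (10 * d) \<le> a (10 * c)"
proof -
  obtain t where "x t > 10 * c" using x_unbounded by blast
  then obtain s where s: "x s = 10 * c" "x (Suc s) = Suc (10 * c)"
    using steps_reach[of x "10 * c" t] step_le by auto
  then have le: "b (y s) \<le> a (10 * c)" by (auto simp: step simp del: merge.simps split: if_splits)
  have "10 dvd y s"
  proof (rule ccontr)
    assume "\<not> ?thesis"
    then have "\<alpha> + \<eta> \<le> b (y s)" using b by (auto simp: bursts_def)
    moreover have "a (10 * c) < \<alpha> + \<eta>" using a by (auto simp: bursts_def)
    ultimately show False using le by simp
  qed
  then obtain d where "y s = 10 * d" by auto
  then show ?thesis using that s le by simp
qed

lemma y_burst:
  obtains s c where "x s = 10 * c" "y s = 10 * d" "a (10 * c) \<le> b (10 * d)"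
proof -
  obtain t where "y t > 10 * d" using y_unbounded by blast
  then obtain s where s: "y s = 10 * d" "y (Suc s) = Suc (10 * d)"
    using steps_reach[of y "10 * d" t] step_le by auto
  then have le: "a (x s) < b (10 * d)" by (auto simp: step simp del: merge.simps split: if_splits)
  have "10 dvd x s"
  proof (rule ccontr)
    assume "\<not> ?thesis"
    then have "\<alpha> + \<eta> \<le> a (x s)" using a by (auto simp: bursts_def)
    moreover have "b (10 * d) < \<alpha> + \<eta>" using b by (auto simp: bursts_def)
    ultimately show False using le by simp
  qed
  then obtain c where "x s = 10 * c" by auto
  then show ?thesis using that s le by simp
qed

text \<open>Per period the factors make \<open>p\<close> and \<open>q\<close> moves, so their cycle
  counts stay in the ratio \<open>p : q\<close> up to a bounded error. The two burst lemmas compare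
  excesses at such matched cycles in both directions, which forces
  \<open>p * ln \<kappa>1 = q * ln \<kappa>2\<close>.\<close>

lemma periodic_imp_commensurable:
  assumes per: "\<And>s. s \<ge> s0 \<Longrightarrow> x (Suc (s + l)) = Suc (x (s + l)) \<longleftrightarrow> x (Suc s) = Suc (x s)"
    and l: "0 < l"
  shows "\<exists>p>0. \<exists>q>0. \<kappa>1 ^ p = \<kappa>2 ^ q"
proof -
  define p where "p = x (s0 + l) - x s0"
  have mono: "x s \<le> x (s + n)" for s n by (induction n) (auto simp: step simp del: merge.simps)
  have p: "x (s + l) = x s + p" if "s \<ge> s0" for s
    using that
  proof (induction s rule: dec_induct)
    case base
    then show ?case using mono[of s0 l] by (simp add: p_def)
  next
    case (step s)
    then show ?case using per[of s] burst_merge.step(1)[OF burst_merge_axioms, of s]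
        burst_merge.step(1)[OF burst_merge_axioms, of "s + l"] by (auto split: if_splits simp del: merge.simps)
  qed
  have "p \<le> l"
  proof -
    have "y s \<le> y (s + n)" for s n by (induction n) (auto simp: step simp del: merge.simps)
    from this[of s0 l] show ?thesis using p[of s0] merge_add[of a b s0] merge_add[of a b "s0 + l"] by linarith
  qed
  define q where "q = l - p"
  have q: "y (s + l) = y s + q" if "s \<ge> s0" for s
    using p[OF that] merge_add[of a b s] merge_add[of a b "s + l"] \<open>p \<le> l\<close> unfolding q_def by linarith
  \<comment> \<open>One period adds \<open>p\<close> to \<open>x\<close> and \<open>q\<close> to
    \<open>y\<close>, so this combination is unchanged by the shift.\<close>
  have "\<exists>C. \<forall>s. \<bar>real q * real (x s) - real p * real (y s)\<bar> \<le> C"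
    by (rule bounded_shift_invariant[of s0 _ l]) (auto simp: p q l algebra_simps)
  then obtain C where C: "\<And>s. \<bar>real q * real (x s) - real p * real (y s)\<bar> \<le> C" by blast
  have pp: "p > 0"
  proof (rule ccontr)
    assume "\<not> ?thesis"
    then have "\<exists>C. \<forall>s. \<bar>real (x s)\<bar> \<le> C"
      by (intro bounded_shift_invariant[of s0 _ l]) (auto simp: p l)
    then obtain C where C: "\<And>s. real (x s) \<le> C" by auto
    obtain s where "x s > nat \<lceil>C\<rceil>" using x_unbounded by blast
    then show False using C[of s] by linarith
  qed
  have qp: "q > 0"
  proof (rule ccontr)
    assume "\<not> ?thesis"
    then have "\<exists>C. \<forall>s. \<bar>real (y s)\<bar> \<le> C"
      by (intro bounded_shift_invariant[of s0 _ l]) (auto simp: q l)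
    then obtain C where C: "\<And>s. real (y s) \<le> C" by auto
    obtain s where "y s > nat \<lceil>C\<rceil>" using y_unbounded by blast
    then show False using C[of s] by linarith
  qed
  define X Y where "X c = - ln (a (10 * c) - \<alpha>)" and "Y d = - ln (b (10 * d) - \<alpha>)" for c d
  have gt: "a (10 * c) - \<alpha> > 0" "b (10 * c) - \<alpha> > 0" for c
    using a b by (auto simp: bursts_def)
  have lim: "(\<lambda>c. X c / real c) \<longlonglongrightarrow> ln \<kappa>1" "(\<lambda>c. Y c / real c) \<longlonglongrightarrow> ln \<kappa>2"
    using a b by (auto simp: bursts_def X_def Y_def)
  have "\<exists>d. X c \<le> Y d \<and> \<bar>real q * real c - real p * real d\<bar> \<le> C / 10" for c
  proof -
    obtain s d where s: "x s = 10 * c" "y s = 10 * d" "b (10 * d) \<le> a (10 * c)" by (rule x_burst)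
    have "X c \<le> Y d" using s(3) gt(1)[of c] gt(2)[of d] by (simp add: X_def Y_def)
    moreover have "\<bar>10 * (real q * real c - real p * real d)\<bar> \<le> C"
      using C[of s] unfolding s(1,2) by (simp add: right_diff_distrib mult.left_commute)
    ultimately show ?thesis unfolding abs_mult by (intro exI[of _ d]) simp
  qed
  then obtain f where f: "\<And>c. X c \<le> Y (f c)" "\<And>c. \<bar>real q * real c - real p * real (f c)\<bar> \<le> C / 10"
    by metis
  have "\<exists>c. Y d \<le> X c \<and> \<bar>real p * real d - real q * real c\<bar> \<le> C / 10" for d
  proof -
    obtain s c where s: "x s = 10 * c" "y s = 10 * d" "a (10 * c) \<le> b (10 * d)" by (rule y_burst)
    have "Y d \<le> X c" using s(3) gt(1)[of c] gt(2)[of d] by (simp add: X_def Y_def)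
    moreover have "\<bar>10 * (real q * real c - real p * real d)\<bar> \<le> C"
      using C[of s] unfolding s(1,2) by (simp add: right_diff_distrib mult.left_commute)
    ultimately show ?thesis unfolding abs_mult abs_minus_commute[of "real p * real d"]
      by (intro exI[of _ c]) simp
  qed
  then obtain g where g: "\<And>d. Y d \<le> X (g d)" "\<And>d. \<bar>real p * real d - real q * real (g d)\<bar> \<le> C / 10"
    by metis
  have "real p * ln \<kappa>1 \<le> real q * ln \<kappa>2"
    using rate_le[OF lim(1,2) f] pp qp by simp
  moreover have "real q * ln \<kappa>2 \<le> real p * ln \<kappa>1"
    using rate_le[OF lim(2,1) g] pp qp by simp
  ultimately have "ln (\<kappa>1 ^ p) = ln (\<kappa>2 ^ q)"
    using pos by (simp add: ln_realpow)
  then have "\<kappa>1 ^ p = \<kappa>2 ^ q"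
    using pos by (subst (asm) ln_inj_iff) auto
  then show ?thesis using pp qp by blast
qed

end

section \<open>From a limit cycle of the product to an eventually periodic interleaving\<close>

lemma conv_cycle_shift:
  assumes "conv_cycle m D l" "i < m"
  shows "convergent (\<lambda>k. D (k * l + b) i)"
proof -
  have l: "l > 0" using assms by (auto simp: conv_cycle_def)
  then have "convergent (\<lambda>k. D (k * l + b mod l) i)"
    using assms mod_less_divisor[OF l, of b] by (auto simp: conv_cycle_def convergent_def)
  then have "convergent (\<lambda>k. D ((k + b div l) * l + b mod l) i)"
    by (subst convergent_ignore_initial_segment)
  moreover have "(k + b div l) * l + b mod l = k * l + b" for k
    by (metis add_mult_distrib add.assoc div_mult_mod_eq)
  ultimately show ?thesis by simp
qed

theorem prod_mat_not_conv_finite_cycle: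
  fixes m1 N1 M1 m2 N2 M2
  defines "a \<equiv> \<lambda>k. top_edge m1 N1 M1 (ada_iter m1 N1 M1 k)"
    and "b \<equiv> \<lambda>k. top_edge m2 N2 M2 (ada_iter m2 N2 M2 k)"
  assumes reg: "regular_run m1 N1 M1" "regular_run m2 N2 M2"
    and bursts: "bursts \<alpha> \<eta> \<kappa>1 a" "bursts \<alpha> \<eta> \<kappa>2 b"
    and params: "0 < \<alpha>" "0 < \<eta>" "1 < \<kappa>1" "1 < \<kappa>2"
    and indep: "\<And>p q. 0 < p \<Longrightarrow> 0 < q \<Longrightarrow> \<kappa>1 ^ p \<noteq> \<kappa>2 ^ q"
  shows "\<not> conv_finite_cycle (m1 * m2) (adaD (m1 * m2) (N1 + N2) (prod_mat m1 N1 M1 M2))"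
proof
  interpret burst_merge \<alpha> \<eta> \<kappa>1 \<kappa>2 a b
    by unfold_locales (use bursts params in auto)
  define M where "M = prod_mat m1 N1 M1 M2"
  define D where "D = ada_iter (m1 * m2) (N1 + N2) M"
  assume "conv_finite_cycle (m1 * m2) (adaD (m1 * m2) (N1 + N2) (prod_mat m1 N1 M1 M2))"
  then obtain l where l: "conv_cycle (m1 * m2) (adaD (m1 * m2) (N1 + N2) M) l"
    by (auto simp: conv_finite_cycle_def M_def)
  then have l0: "l > 0" by (auto simp: conv_cycle_def)
  define g where "g j s = edge m1 M1 (ada_iter m1 N1 M1 (x s)) j" for j s
  have N: "0 < N1" "pm1_matrix m1 N1 M1" using reg by (auto simp: regular_run_def)
  have g: "edge (m1 * m2) M (D s) j = g j s" if "j < N1" for j s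
    using edge_prod_mat(1)[of m1 m2 "D s" "ada_iter m1 N1 M1 (x s)" "ada_iter m2 N2 M2 (y s)" j N1 M1 M2]
      ada_iter_prod_mat[OF reg, of _ s] ada_iter_sum[OF reg(2)] that
    by (simp add: g_def D_def M_def a_def b_def)
  have conv: "convergent (\<lambda>k. g j (k * l + c))" if "j < N1" for j c
  proof -
    have "convergent (\<lambda>k. D (k * l + c) i)" if "i < m1 * m2" for i
      \<comment> \<open>\<open>adaD\<close> counts rounds from 1 and \<open>ada_iter\<close> from 0,
        hence the offset \<open>Suc c\<close>.\<close>
      using conv_cycle_shift[OF l that, of "Suc c"] by (simp add: adaD_def D_def)
    then have "convergent (\<lambda>k. \<Sum>i<m1 * m2. D (k * l + c) i * M i j)"
      by (intro convergent_sum convergent_mult convergent_const) auto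
    then show ?thesis using g[OF that] by (simp add: edge_def)
  qed
  \<comment> \<open>A move of the first factor at column \<open>j\<close> resets the edge of \<open>j\<close> from above \<open>\<alpha>\<close> to 0, so the moves can be
    read off the limits of the edges along residue classes.\<close>
  have drop: "\<exists>j<N1. g j (Suc s) - g j s < - \<alpha>" if "x (Suc s) = Suc (x s)" for s
  proof -
    define p j where "p = ada_iter m1 N1 M1 (x s)" and "j = sel_col m1 N1 M1 p"
    have "g j (Suc s) = 0"
      using ada_step_sum(2)[OF N(2,1) ada_iter_sum[OF reg(1), of "x s"]] reg(1)
      unfolding g_def that by (simp add: regular_run_def p_def j_def)
    moreover have "g j s = a (x s)" by (simp add: g_def a_def top_edge_def p_def j_def)
    moreover have "a (x s) > \<alpha>" using bursts_gt[OF bursts(1) params(2)] .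
    moreover have "j < N1" unfolding j_def by (rule sel_col_less[OF N(1)])
    ultimately show ?thesis by (intro exI[of _ j]) auto
  qed
  have stay: "g j (Suc s) - g j s = 0" if "x (Suc s) \<noteq> Suc (x s)" for j s
    using that by (auto simp: g_def step simp del: merge.simps split: if_splits)
  define \<Delta> where "\<Delta> j c k = g j (Suc (k * l + c)) - g j (k * l + c)" for j c k
  have "convergent (\<Delta> j c)" if "j < N1" for j c
    using convergent_diff[OF conv[OF that, of "Suc c"] conv[OF that, of c]] by (simp add: \<Delta>_def[abs_def])
  \<comment> \<open>Precision \<alpha> decides whether the first factor moves: all differences are 0
    when it rests, and some difference is below -\<alpha> when it moves.\<close>
  then have "\<exists>K. \<forall>k\<ge>K. \<forall>k'\<ge>K. \<bar>\<Delta> j c k - \<Delta> j c k'\<bar> < \<alpha>" if "j < N1" for j c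
    using that params(1) unfolding Cauchy_convergent_iff[symmetric] Cauchy_def
    by (auto simp: dist_real_def)
  then obtain K where K: "\<And>j c k k'. j < N1 \<Longrightarrow> K j c \<le> k \<Longrightarrow> K j c \<le> k' \<Longrightarrow> \<bar>\<Delta> j c k - \<Delta> j c k'\<bar> < \<alpha>"
    by metis
  \<comment> \<open>One threshold serves the finitely many columns and residues modulo
    \<open>l\<close>.\<close>
  define K0 where "K0 = Max ((\<lambda>(j, c). K j c) ` ({..<N1} \<times> {..<l}))"
  have K0: "K j c \<le> K0" if "j < N1" "c < l" for j c
    unfolding K0_def using that by (intro Max_ge) auto
  have "x (Suc (s + l)) = Suc (x (s + l)) \<longleftrightarrow> x (Suc s) = Suc (x s)" if "s \<ge> K0 * l" for s
  proof -
    define c k where "c = s mod l" and "k = s div l"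
    have s: "s = k * l + c" "s + l = Suc k * l + c" by (auto simp: c_def k_def)
    have "k \<ge> K0" using div_le_mono[OF that, of l] l0 by (simp add: k_def)
    moreover have "c < l" using l0 by (simp add: c_def)
    ultimately have close: "\<bar>\<Delta> j c k - \<Delta> j c (Suc k)\<bar> < \<alpha>" if "j < N1" for j
      using K[OF that, of c k "Suc k"] K0[OF that, of c] by simp
    show ?thesis
    proof (rule ccontr)
      assume "\<not> ?thesis"
      then consider "x (Suc (s + l)) = Suc (x (s + l))" "x (Suc s) \<noteq> Suc (x s)"
        | "x (Suc (s + l)) \<noteq> Suc (x (s + l))" "x (Suc s) = Suc (x s)" by blast
      then show False
      proof cases
        case 1
        obtain j where j: "j < N1" "g j (Suc (s + l)) - g j (s + l) < - \<alpha>" using drop[OF 1(1)] by blast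
        then show False using close[OF j(1)] stay[OF 1(2), of j] unfolding \<Delta>_def s[symmetric] by auto
      next
        case 2
        obtain j where j: "j < N1" "g j (Suc s) - g j s < - \<alpha>" using drop[OF 2(2)] by blast
        then show False using close[OF j(1)] stay[OF 2(1), of j] unfolding \<Delta>_def s[symmetric] by auto
      qed
    qed
  qed
  then have "\<exists>p>0. \<exists>q>0. \<kappa>1 ^ p = \<kappa>2 ^ q"
    using l0 by (rule periodic_imp_commensurable)
  then show False using indep by blast
qed

section \<open>Perturbed cycles of the quadratic system\<close>

text \<open>A row with entries \<open>-1\<close> in the columns \<open>a, b < 5\<close> has weight \<open>c a b * v a * v b\<close>. Coordinate 5 is a
  dummy that no column updates and that stays equal to 1: the pair \<open>{a, 5}\<close> encodes a row whose only
  entry \<open>-1\<close> is in column \<open>a\<close>. Since \<open>qf\<close> sums over ordered pairs, it is twice the quadratic form.\<close>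

definition lf :: "(nat \<Rightarrow> nat \<Rightarrow> real) \<Rightarrow> (nat \<Rightarrow> real) \<Rightarrow> nat \<Rightarrow> real" where
  "lf c v j = (\<Sum>k<6. c j k * v k)"

definition qf :: "(nat \<Rightarrow> nat \<Rightarrow> real) \<Rightarrow> (nat \<Rightarrow> real) \<Rightarrow> real" where
  "qf c v = (\<Sum>j<6. v j * lf c v j)"

text \<open>The new entry is the one that makes the edge of column \<open>j\<close> vanish: if
  \<open>c j j = 0\<close>, then \<open>lf c v j\<close> does not change and \<open>qf\<close> is
  affine in \<open>v j\<close>, so \<open>4 * v' j * lf c v j = qf c v'\<close> is a linear equation
  for \<open>v' j\<close>.\<close>

definition upd :: "(nat \<Rightarrow> nat \<Rightarrow> real) \<Rightarrow> nat \<Rightarrow> (nat \<Rightarrow> real) \<Rightarrow> nat \<Rightarrow> real" where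
  "upd c j v = v(j := qf c v / (2 * lf c v j) - v j)"

text \<open>Among the total weight \<open>qf c v\<close> over ordered pairs, the rows with entry -1
  in column \<open>j\<close> have weight \<open>2 * v j * lf c v j\<close>; the edge is 1 minus
  twice their share.\<close>

definition qedge :: "(nat \<Rightarrow> nat \<Rightarrow> real) \<Rightarrow> (nat \<Rightarrow> real) \<Rightarrow> nat \<Rightarrow> real" where
  "qedge c v j = 1 - 4 * (v j * lf c v j) / qf c v"

text \<open>The largest edge belongs to the smallest product \<open>v k * lf c v k\<close>.
  Strictness makes tie-breaking irrelevant inside a factor.\<close>

definition selects :: "(nat \<Rightarrow> nat \<Rightarrow> real) \<Rightarrow> (nat \<Rightarrow> real) \<Rightarrow> nat \<Rightarrow> bool" where
  "selects c v j \<longleftrightarrow> (\<forall>k<5. 0 < v k) \<and> 0 < qf c v \<and> 0 < lf c v j \<and>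
     (\<forall>k<5. k \<noteq> j \<longrightarrow> v j * lf c v j < v k * lf c v k)"

definition dot6 :: "(nat \<Rightarrow> real) \<Rightarrow> (nat \<Rightarrow> real) \<Rightarrow> real" where
  "dot6 u v = (\<Sum>k<6. u k * v k)"

text \<open>At \<open>v = V / h + y\<close> the updated entry is a quotient with denominator
  proportional to \<open>lf c V j + h * lf c y j\<close>. Dividing with remainder splits off
  \<open>W / h\<close>, and this is the bounded rest. At \<open>h = 0\<close> it is linear in
  \<open>y\<close>, and \<open>y j\<close> drops out if \<open>c j j = 0\<close>.\<close>

definition ystep ::
  "(nat \<Rightarrow> nat \<Rightarrow> real) \<Rightarrow> (nat \<Rightarrow> real) \<Rightarrow> real \<Rightarrow> nat \<Rightarrow> real \<Rightarrow> (nat \<Rightarrow> real) \<Rightarrow> real" where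
  "ystep c V W j h y =
     (dot6 (lf c V) y - y j * lf c V j - (V j + W) * lf c y j + h * (qf c y / 2 - y j * lf c y j))
       / (lf c V j + h * lf c y j)"

lemma lf_add: "lf c (\<lambda>k. u k + v k) j = lf c u j + lf c v j"
  by (simp add: lf_def sum.distrib algebra_simps)

lemma lf_scale: "lf c (\<lambda>k. a * u k) j = a * lf c u j"
  by (simp add: lf_def sum_distrib_left algebra_simps)

lemma qf_scale: "qf c (\<lambda>k. a * u k) = a\<^sup>2 * qf c u"
  by (simp add: qf_def lf_scale sum_distrib_left power2_eq_square algebra_simps)

lemma qedge_scale: "a \<noteq> 0 \<Longrightarrow> qedge c (\<lambda>k. a * u k) j = qedge c u j"
  by (simp add: qedge_def qf_scale lf_scale power2_eq_square)

lemma qf_add: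
  assumes "\<And>j k. j < 6 \<Longrightarrow> k < 6 \<Longrightarrow> c j k = c k j"
  shows "qf c (\<lambda>k. u k + v k) = qf c u + 2 * dot6 (lf c u) v + qf c v"
proof -
  have "(\<Sum>j<6. u j * lf c v j) = (\<Sum>j<6. \<Sum>k<6. u j * c j k * v k)"
    by (simp add: lf_def sum_distrib_left algebra_simps)
  also have "\<dots> = (\<Sum>k<6. \<Sum>j<6. u j * c j k * v k)" by (rule sum.swap)
  also have "\<dots> = (\<Sum>k<6. \<Sum>j<6. c k j * u j * v k)"
    using assms by (intro sum.cong) (auto simp: mult.commute)
  also have "\<dots> = dot6 (lf c u) v"
    by (simp add: dot6_def lf_def sum_distrib_right)
  finally have "(\<Sum>j<6. u j * lf c v j) = dot6 (lf c u) v" .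
  moreover have "(\<Sum>j<6. v j * lf c u j) = dot6 (lf c u) v"
    by (simp add: dot6_def mult.commute)
  ultimately show ?thesis
    by (simp add: qf_def lf_add algebra_simps sum.distrib)
qed

lemma dot6_scale: "dot6 u (\<lambda>k. a * v k) = a * dot6 u v"
  by (simp add: dot6_def sum_distrib_left algebra_simps)

text \<open>Writing \<open>v = V / h + y\<close>, the update acts on the bounded part \<open>y\<close> by a map that is regular at
  \<open>h = 0\<close>.\<close>

lemma upd_expansion:
  assumes sym: "\<And>j k. j < 6 \<Longrightarrow> k < 6 \<Longrightarrow> c j k = c k j"
    and bal: "qf c V = 2 * (V j + W) * lf c V j"
    and h: "h > 0" "lf c V j + h * lf c y j \<noteq> 0"
  shows "upd c j (\<lambda>k. V k / h + y k) = (\<lambda>k. (V(j := W)) k / h + (y(j := ystep c V W j h y)) k)"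
proof -
  define B b s where "B = lf c V j" and "b = lf c y j" and "s = dot6 (lf c V) y"
  have v: "(\<lambda>k. V k / h + y k) = (\<lambda>k. (1 / h) * (V k + h * y k))"
    using h(1) by (auto simp: field_simps)
  have lf: "lf c (\<lambda>k. V k / h + y k) j = (B + h * b) / h"
    unfolding v lf_scale by (simp add: lf_add lf_scale B_def b_def)
  have qf: "qf c (\<lambda>k. V k / h + y k) = (2 * (V j + W) * B + 2 * h * s + h\<^sup>2 * qf c y) / h\<^sup>2"
    unfolding v qf_scale using qf_add[OF sym, where u = V and v = "\<lambda>k. h * y k"]
    by (simp add: bal dot6_scale qf_scale B_def s_def power_one_over)
  define d where "d = B + h * b"
  have d: "d \<noteq> 0" using h(2) by (simp add: d_def B_def b_def)
  have "qf c (\<lambda>k. V k / h + y k) / (2 * lf c (\<lambda>k. V k / h + y k) j)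
      = ((V j + W) * B + h * s + h\<^sup>2 * qf c y / 2) / (h * d)"
    unfolding lf qf using h(1) d by (simp add: d_def[symmetric] power2_eq_square divide_simps)
  also have "\<dots> - (V j / h + y j) = W / h + (s - y j * B - (V j + W) * b + h * (qf c y / 2 - y j * b)) / d"
  proof -
    have "(V j + W) * B + h * s + h\<^sup>2 * qf c y / 2
       = (V j + h * y j) * d + W * d + h * (s - y j * B - (V j + W) * b + h * (qf c y / 2 - y j * b))"
      by (simp add: d_def algebra_simps power2_eq_square)
    then show ?thesis using h(1) d by (simp add: divide_simps) (simp add: algebra_simps)
  qed
  finally show ?thesis
    by (auto simp: upd_def fun_eq_iff ystep_def B_def b_def s_def d_def)
qed

section \<open>The limit of small \<open>h\<close>, uniformly in the bounded part\<close>

lemma lf_bigo: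
  assumes "\<And>k. k < 6 \<Longrightarrow> (\<lambda>p. y p k) \<in> O[F](\<lambda>_. 1 :: real)"
  shows "(\<lambda>p. lf c (y p) j) \<in> O[F](\<lambda>_. 1)"
  unfolding lf_def using assms by (intro big_sum_in_bigo) (auto simp: landau_o.big.cmult_in_iff')

lemma dot6_bigo:
  assumes "\<And>k. k < 6 \<Longrightarrow> (\<lambda>p. y p k) \<in> O[F](\<lambda>_. 1 :: real)"
  shows "(\<lambda>p. dot6 u (y p)) \<in> O[F](\<lambda>_. 1)"
  unfolding dot6_def using assms by (intro big_sum_in_bigo) auto

lemma qf_bigo:
  assumes "\<And>k. k < 6 \<Longrightarrow> (\<lambda>p. y p k) \<in> O[F](\<lambda>_. 1 :: real)"
  shows "(\<lambda>p. qf c (y p)) \<in> O[F](\<lambda>_. 1)"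
  unfolding qf_def using assms lf_bigo[OF assms]
  by (intro big_sum_in_bigo landau_o.big.mult_in_1) auto

text \<open>The numerator is linear up to a term with factor \<open>h\<close>, and the denominator
  tends to a positive constant. So a step with small \<open>h\<close> at \<open>y\<close> agrees
  asymptotically with the limiting step at any \<open>z\<close> close to \<open>y\<close>, which is
  the form needed for iteration.\<close>

lemma ystep_limit:
  fixes h :: "'a \<Rightarrow> real"
  assumes h: "(h \<longlongrightarrow> 0) F" and j: "j < 6"
    and y: "\<And>k. k < 6 \<Longrightarrow> (\<lambda>p. y p k) \<in> O[F](\<lambda>_. 1)"
    and z: "\<And>k. k < 6 \<Longrightarrow> (\<lambda>p. z p k) \<in> O[F](\<lambda>_. 1)"
    and yz: "\<And>k. k < 6 \<Longrightarrow> (\<lambda>p. y p k - z p k) \<in> o[F](\<lambda>_. 1)"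
    and B: "lf c V j > 0"
  shows "(\<lambda>p. ystep c V W j (h p) (y p) - ystep c V W j 0 (z p)) \<in> o[F](\<lambda>_. 1)"
    and "(\<lambda>p. ystep c V W j 0 (z p)) \<in> O[F](\<lambda>_. 1)"
proof -
  define n where "n w = dot6 (lf c V) w - w j * lf c V j - (V j + W) * lf c w j" for w
  define d where "d p = lf c V j + h p * lf c (y p) j" for p
  have ho: "h \<in> o[F](\<lambda>_. 1)" using h by (intro smalloI_tendsto) auto
  have hb: "(\<lambda>p. h p * g p) \<in> o[F](\<lambda>_. 1)" if "g \<in> O[F](\<lambda>_. 1)" for g
    using landau_o.small_big_mult[OF ho that] by simp
  have zb: "(\<lambda>p. g p * e p) \<in> o[F](\<lambda>_. 1)" if "g \<in> O[F](\<lambda>_. 1)" "e \<in> o[F](\<lambda>_. 1)" for g e :: "'a \<Rightarrow> real"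
    using landau_o.big_small_mult[OF that] by simp
  have nb: "(\<lambda>p. n (z p)) \<in> O[F](\<lambda>_. 1)"
    unfolding n_def using dot6_bigo[OF z] lf_bigo[OF z] z[OF j]
    by (intro sum_in_bigo landau_o.big.mult_in_1) auto
  have lin: "n (\<lambda>k. u k - w k) = n u - n w" for u w
  proof -
    have "(\<lambda>k. u k - w k) = (\<lambda>k. u k + (-1) * w k)" by auto
    then have "lf c (\<lambda>k. u k - w k) j = lf c u j - lf c w j"
      by (simp only: lf_add lf_scale)
    moreover have "dot6 (lf c V) (\<lambda>k. u k - w k) = dot6 (lf c V) u - dot6 (lf c V) w"
      by (simp add: dot6_def sum_subtractf algebra_simps)
    ultimately show ?thesis unfolding n_def by (simp add: right_diff_distrib left_diff_distrib)
  qed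
  have "(\<lambda>p. n (w p)) \<in> o[F](\<lambda>_. 1)" if w: "\<And>k. k < 6 \<Longrightarrow> (\<lambda>p. w p k) \<in> o[F](\<lambda>_. 1)" for w
  proof -
    have cw: "(\<lambda>p. a * g p) \<in> o[F](\<lambda>_. 1)" if "g \<in> o[F](\<lambda>_. 1)" for a and g :: "'a \<Rightarrow> real"
      using zb[of "\<lambda>_. a", OF _ that] by simp
    have s: "(\<lambda>p. \<Sum>k<6. a k * w p k) \<in> o[F](\<lambda>_. 1)" for a
      using w by (intro big_sum_in_smallo cw) auto
    have "(\<lambda>p. (\<Sum>k<6. lf c V k * w p k) - lf c V j * w p j - (V j + W) * (\<Sum>k<6. c j k * w p k)) \<in> o[F](\<lambda>_. 1)"
      using w j by (intro sum_in_smallo s cw) auto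
    then show ?thesis by (simp add: n_def dot6_def lf_def mult.commute)
  qed
  from this[OF yz] have "(\<lambda>p. n (\<lambda>k. y p k - z p k)) \<in> o[F](\<lambda>_. 1)" by simp
  then have nyz: "(\<lambda>p. n (y p) - n (z p)) \<in> o[F](\<lambda>_. 1)" by (simp add: lin)
  have d0: "(\<lambda>p. d p - lf c V j) \<in> o[F](\<lambda>_. 1)"
    unfolding d_def using hb[OF lf_bigo[OF y]] by simp
  then have d: "(d \<longlongrightarrow> lf c V j) F"
    by (intro LIM_zero_cancel[OF tendsto_cong[THEN iffD1, OF _ smalloD_tendsto[OF d0]]]) auto
  have db: "(\<lambda>p. 1 / d p) \<in> O[F](\<lambda>_. 1)"
    by (rule bigoI_tendsto[of _ _ "1 / lf c V j"]) (use d B in \<open>auto intro!: tendsto_eq_intros\<close>)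
  \<comment> \<open>The difference of the quotients \<open>N / d\<close> and \<open>n / B\<close> is
    written as \<open>(N - n - (n / B) * (d - B)) / d\<close>, where every summand of the numerator
    is visibly small.\<close>
  have "(\<lambda>p. 1 / d p * ((n (y p) - n (z p)) + h p * (qf c (y p) / 2 - y p j * lf c (y p) j)
        - (1 / lf c V j * n (z p)) * (d p - lf c V j))) \<in> o[F](\<lambda>_. 1)"
  proof (intro zb[OF db] sum_in_smallo(2)[OF sum_in_smallo(1)[OF nyz]] hb zb[OF _ d0])
    have "(\<lambda>p. 1 / 2 * qf c (y p)) \<in> O[F](\<lambda>_. 1)"
      by (rule landau_o.big.mult_in_1[OF _ qf_bigo[OF y]]) auto
    then show "(\<lambda>p. qf c (y p) / 2 - y p j * lf c (y p) j) \<in> O[F](\<lambda>_. 1)"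
      by (intro sum_in_bigo landau_o.big.mult_in_1[OF y[OF j] lf_bigo[OF y]]) auto
    show "(\<lambda>p. 1 / lf c V j * n (z p)) \<in> O[F](\<lambda>_. 1)"
      by (rule landau_o.big.mult_in_1[OF _ nb]) auto
  qed
  note small = this
  have "eventually (\<lambda>p. d p > 0) F"
    using order_tendstoD(1)[OF d B] .
  then have ev: "eventually (\<lambda>p. 1 / d p * ((n (y p) - n (z p)) + h p * (qf c (y p) / 2 - y p j * lf c (y p) j)
        - (1 / lf c V j * n (z p)) * (d p - lf c V j)) = ystep c V W j (h p) (y p) - ystep c V W j 0 (z p)) F"
  proof eventually_elim
    case (elim p)
    have e1: "ystep c V W j (h p) (y p) = (n (y p) + h p * (qf c (y p) / 2 - y p j * lf c (y p) j)) / d p"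
      by (simp add: ystep_def n_def d_def)
    have e2: "ystep c V W j 0 (z p) = n (z p) / lf c V j"
      by (simp add: ystep_def n_def)
    show ?case unfolding e1 e2 using elim B by (simp add: field_simps)
  qed
  show "(\<lambda>p. ystep c V W j (h p) (y p) - ystep c V W j 0 (z p)) \<in> o[F](\<lambda>_. 1)"
    using landau_o.small.in_cong[OF ev] small by (rule iffD1)
  have "(\<lambda>p. 1 / lf c V j * n (z p)) \<in> O[F](\<lambda>_. 1)"
    using nb by (intro landau_o.big.mult_in_1) auto
  then show "(\<lambda>p. ystep c V W j 0 (z p)) \<in> O[F](\<lambda>_. 1)"
    by (simp add: ystep_def n_def)
qed

text \<open>The bounded part along the cycle. At \<open>h = 0\<close> every step is linear, and
  affine once the dummy coordinate is fixed at 1.\<close>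

primrec yt :: "(nat \<Rightarrow> nat \<Rightarrow> real) \<Rightarrow> (nat \<Rightarrow> nat) \<Rightarrow> (nat \<Rightarrow> nat \<Rightarrow> real) \<Rightarrow> nat \<Rightarrow> real \<Rightarrow> (nat \<Rightarrow> real) \<Rightarrow> nat \<Rightarrow> real" where
  "yt c js V 0 h y = y"
| "yt c js V (Suc t) h y = (yt c js V t h y)
     (js t := ystep c (V t) (V (Suc t) (js t)) (js t) h (yt c js V t h y))"

text \<open>The product with a principal filter expresses that one threshold for \<open>h\<close>
  works for all points of \<open>K\<close>, so uniform estimates can be handled by Landau
  symbols.\<close>

lemma eventually_at_right_prod_principal:
  "eventually P (at_right (0::real) \<times>\<^sub>F principal K) \<longleftrightarrow> (\<exists>h0>0. \<forall>h y. 0 < h \<longrightarrow> h < h0 \<longrightarrow> y \<in> K \<longrightarrow> P (h, y))"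
  (is "?L \<longleftrightarrow> ?R")
proof
  assume ?L
  then show ?R
    unfolding eventually_prod_filter eventually_principal eventually_at_right_field by fastforce
next
  assume ?R
  then obtain h0 where h0: "h0 > 0" "\<And>h y. 0 < h \<Longrightarrow> h < h0 \<Longrightarrow> y \<in> K \<Longrightarrow> P (h, y)" by blast
  then show ?L
    unfolding eventually_prod_filter eventually_principal eventually_at_right_field
    by (intro exI[of _ "\<lambda>h. 0 < h \<and> h < h0"] exI[of _ "\<lambda>y. y \<in> K"]) auto
qed

text \<open>\<open>V\<close> is the exact cycle of the system without the dummy coordinate. Perturbed orbits have the form
  \<open>s * V t k + y k\<close> with \<open>s\<close> growing by the factor \<open>\<kappa>\<close> per cycle and \<open>y\<close> confined to the bounded set \<open>K\<close>,
  which the limiting affine return map sends into its interior. \<open>K_drift\<close> says that the first-order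
  excess of the minimal edge is positive on \<open>K\<close>.\<close>

locale quad_cycle =
  fixes c :: "nat \<Rightarrow> nat \<Rightarrow> real" and js :: "nat \<Rightarrow> nat" and V :: "nat \<Rightarrow> nat \<Rightarrow> real"
    and \<kappa> \<alpha> :: real and K :: "(nat \<Rightarrow> real) set"
  assumes sym: "\<And>j k. j < 6 \<Longrightarrow> k < 6 \<Longrightarrow> c j k = c k j"
    and js: "\<And>t. t < 10 \<Longrightarrow> js t < 5"
    and V_0: "\<And>k. V 0 k = (if k < 5 then 1 else 0)"
    and V_10: "\<And>k. V 10 k = \<kappa> * V 0 k"
    and V_Suc: "\<And>t. t < 10 \<Longrightarrow> V (Suc t) = (V t)(js t := V (Suc t) (js t))"
    and V_pos: "\<And>t k. t \<le> 10 \<Longrightarrow> k < 5 \<Longrightarrow> 0 < V t k"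
    and balance: "\<And>t. t < 10 \<Longrightarrow> qf c (V t) = 2 * (V t (js t) + V (Suc t) (js t)) * lf c (V t) (js t)"
    and lf_pos: "\<And>t. t < 10 \<Longrightarrow> 0 < lf c (V t) (js t)"
    and strict: "\<And>t k. t < 10 \<Longrightarrow> k < 5 \<Longrightarrow> k \<noteq> js t \<Longrightarrow>
      V t (js t) * lf c (V t) (js t) < V t k * lf c (V t) k"
    and first: "V (Suc 0) (js 0) - V 0 (js 0) = \<alpha> * (V (Suc 0) (js 0) + V 0 (js 0))"
    and later: "\<And>t. 0 < t \<Longrightarrow> t < 10 \<Longrightarrow>
      V (Suc t) (js t) - V t (js t) > \<alpha> * (V (Suc t) (js t) + V t (js t))"
    and \<kappa>: "1 < \<kappa>"
    and K_norm: "\<And>y. y \<in> K \<Longrightarrow> y 0 = 0" "\<And>y. y \<in> K \<Longrightarrow> y 5 = 1"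
    and K_bdd: "\<exists>b. \<forall>y\<in>K. \<forall>k<6. \<bar>y k\<bar> \<le> b"
    and K_contract: "\<exists>\<delta>>0. \<forall>y\<in>K. \<forall>w. w 0 = 0 \<longrightarrow> w 5 = 1 \<longrightarrow>
      (\<forall>k<6. \<bar>w k - (yt c js V 10 0 y k - V 0 k * yt c js V 10 0 y 0)\<bar> < \<delta>) \<longrightarrow> w \<in> K"
    and K_drift: "\<exists>d>0. \<forall>y\<in>K. d \<le> 2 * (1 - \<alpha>) * dot6 (lf c (V 0)) y
      - 4 * (y (js 0) * lf c (V 0) (js 0) + V 0 (js 0) * lf c y (js 0))"
begin

section \<open>One perturbed cycle\<close>

abbreviation "F \<equiv> at_right (0::real) \<times>\<^sub>F principal K"

abbreviation "Y \<equiv> yt c js V"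

lemma fst_F: "(fst \<longlongrightarrow> 0) F" "eventually (\<lambda>p. fst p > 0) F" "eventually (\<lambda>p. snd p \<in> K) F"
proof -
  show "(fst \<longlongrightarrow> 0) F"
    by (rule filterlim_mono[OF filterlim_fst _ order_refl]) (simp add: at_within_def)
  show "eventually (\<lambda>p. fst p > 0) F" "eventually (\<lambda>p. snd p \<in> K) F"
    unfolding eventually_at_right_prod_principal by (auto intro: exI[of _ 1])
qed

text \<open>Closeness to the limiting orbit and its boundedness are proved together, because each
  step of the induction consumes both.\<close>

lemma Y_limits:
  assumes "t \<le> 10" "k < 6"
  shows "(\<lambda>p. Y t (fst p) (snd p) k - Y t 0 (snd p) k) \<in> o[F](\<lambda>_. 1)" (is "?A t k")
    and "(\<lambda>p. Y t 0 (snd p) k) \<in> O[F](\<lambda>_. 1)" (is "?B t k")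
    and "(\<lambda>p. Y t (fst p) (snd p) k) \<in> O[F](\<lambda>_. 1)" (is "?C t k")
proof -
  have AB: "?C t k" if "?A t k" "?B t k" for t k
  proof -
    have "(\<lambda>p. (Y t (fst p) (snd p) k - Y t 0 (snd p) k) + Y t 0 (snd p) k) \<in> O[F](\<lambda>_. 1)"
      by (rule sum_in_bigo(1)[OF landau_o.small_imp_big[OF that(1)] that(2)])
    then show ?thesis by simp
  qed
  have "\<forall>k<6. ?A t k \<and> ?B t k" using assms(1)
  proof (induction t)
    case 0
    obtain b where b: "\<And>y k. y \<in> K \<Longrightarrow> k < 6 \<Longrightarrow> \<bar>y k\<bar> \<le> b" using K_bdd by blast
    have "(\<lambda>p. snd p k) \<in> O[F](\<lambda>_. 1)" if "k < 6" for k
      using fst_F(3) by (intro bigoI[of _ b]) (auto elim!: eventually_mono intro: b[OF _ that])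
    then show ?case by simp
  next
    case (Suc t)
    then have t: "t < 10" and IH: "\<And>k. k < 6 \<Longrightarrow> ?A t k" "\<And>k. k < 6 \<Longrightarrow> ?B t k" by auto
    have j: "js t < 6" using js[OF t] by simp
    note lim = ystep_limit[OF fst_F(1) j AB[OF IH] IH(2) IH(1) lf_pos[OF t], where W = "V (Suc t) (js t)"]
    show ?case
    proof (intro allI impI)
      fix k :: nat assume "k < 6"
      then show "?A (Suc t) k \<and> ?B (Suc t) k" using IH lim by (cases "k = js t") auto
    qed
  qed
  then show "?A t k" "?B t k" using assms(2) by auto
  then show "?C t k" by (rule AB)
qed

text \<open>This is \<open>h * v\<close>, which converges to the exact cycle. Edges and the order of
  the products are invariant under scaling, so strict inequalities valid on the exact cycle pass to
  \<open>v\<close> for small \<open>h\<close>.\<close>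

definition X :: "nat \<Rightarrow> real \<times> (nat \<Rightarrow> real) \<Rightarrow> nat \<Rightarrow> real" where
  "X t p k = V t k + fst p * Y t (fst p) (snd p) k"

definition v :: "nat \<Rightarrow> real \<Rightarrow> (nat \<Rightarrow> real) \<Rightarrow> nat \<Rightarrow> real" where
  "v t h y = (\<lambda>k. V t k / h + Y t h y k)"

lemma v_eq_X: "h \<noteq> 0 \<Longrightarrow> v t h y = (\<lambda>k. (1 / h) * X t (h, y) k)"
  by (auto simp: v_def X_def field_simps)

lemma X_tendsto:
  assumes "t \<le> 10" "k < 6"
  shows "((\<lambda>p. X t p k) \<longlongrightarrow> V t k) F"
proof -
  have "(\<lambda>p. fst p * Y t (fst p) (snd p) k) \<in> o[F](\<lambda>_. 1 * 1)"
    by (intro landau_o.small_big_mult Y_limits assms smalloI_tendsto) (auto simp: fst_F)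
  then have "((\<lambda>p. fst p * Y t (fst p) (snd p) k) \<longlongrightarrow> 0) F"
    using smalloD_tendsto by fastforce
  from tendsto_add[OF tendsto_const this] show ?thesis by (simp add: X_def)
qed

lemma lf_X: "t \<le> 10 \<Longrightarrow> ((\<lambda>p. lf c (X t p) j) \<longlongrightarrow> lf c (V t) j) F"
  unfolding lf_def by (intro tendsto_intros X_tendsto) auto

lemma qf_X: "t \<le> 10 \<Longrightarrow> ((\<lambda>p. qf c (X t p)) \<longlongrightarrow> qf c (V t)) F"
  unfolding qf_def by (intro tendsto_intros X_tendsto lf_X) auto

lemma qf_V_pos:
  assumes "t < 10"
  shows "qf c (V t) > 0"
proof -
  have "V t (js t) > 0" "V (Suc t) (js t) > 0"
    using assms js V_pos by auto
  then show ?thesis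
    using balance[OF assms] lf_pos[OF assms] by simp
qed

text \<open>By the balance equation the edge depends only on the ratio R of the new entry to the old
  one: it equals (R - 1) / (R + 1).\<close>

lemma qedge_V:
  assumes "t < 10"
  shows "qedge c (V t) (js t) = (V (Suc t) (js t) - V t (js t)) / (V (Suc t) (js t) + V t (js t))"
proof -
  have "V t (js t) > 0" "V (Suc t) (js t) > 0"
    using assms js V_pos by auto
  then have pos: "V (Suc t) (js t) + V t (js t) > 0" by simp
  have "4 * (V t (js t) * lf c (V t) (js t)) / (2 * (V t (js t) + V (Suc t) (js t)) * lf c (V t) (js t))
      = 2 * V t (js t) / (V (Suc t) (js t) + V t (js t))"
    using pos lf_pos[OF assms] by (simp add: divide_simps add.commute)
  then show ?thesis
    using pos unfolding qedge_def balance[OF assms] by (simp add: field_simps)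
qed

lemma qedge_X: "t < 10 \<Longrightarrow> ((\<lambda>p. qedge c (X t p) (js t)) \<longlongrightarrow> qedge c (V t) (js t)) F"
  unfolding qedge_def using qf_V_pos[of t] js[of t]
  by (intro tendsto_intros X_tendsto lf_X qf_X) auto

lemma qedge_V_0: "qedge c (V 0) (js 0) = \<alpha>"
  and qedge_V_later: "0 < t \<Longrightarrow> t < 10 \<Longrightarrow> \<alpha> < qedge c (V t) (js t)"
proof -
  have pos: "V (Suc t) (js t) + V t (js t) > 0" if "t < 10" for t
    using that js V_pos[of t "js t"] V_pos[of "Suc t" "js t"] by simp
  show "qedge c (V 0) (js 0) = \<alpha>"
    using first pos[of 0] by (simp add: qedge_V field_simps)
  show "\<alpha> < qedge c (V t) (js t)" if "0 < t" "t < 10"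
    using later[OF that] pos[OF that(2)] that(2) by (simp add: qedge_V field_simps)
qed

text \<open>The term without \<open>h\<close> vanishes because the edge of the exact cycle at time 0
  is \<alpha>; the coefficient of \<open>h\<close> is the form that \<open>K_drift\<close> bounds
  from below.\<close>

lemma excess_expansion:
  "(1 - \<alpha>) * qf c (X 0 p) - 4 * (X 0 p (js 0) * lf c (X 0 p) (js 0))
    = fst p * ((2 * (1 - \<alpha>) * dot6 (lf c (V 0)) (snd p)
      - 4 * (snd p (js 0) * lf c (V 0) (js 0) + V 0 (js 0) * lf c (snd p) (js 0)))
      + fst p * ((1 - \<alpha>) * qf c (snd p) - 4 * (snd p (js 0) * lf c (snd p) (js 0))))"
proof -
  have X0: "X 0 p = (\<lambda>k. V 0 k + fst p * snd p k)" by (auto simp: X_def)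
  have q: "qf c (X 0 p) = qf c (V 0) + 2 * fst p * dot6 (lf c (V 0)) (snd p) + (fst p)\<^sup>2 * qf c (snd p)"
    using qf_add[OF sym, where u = "V 0" and v = "\<lambda>k. fst p * snd p k"]
    unfolding X0 by (simp add: dot6_scale qf_scale)
  have l: "lf c (X 0 p) (js 0) = lf c (V 0) (js 0) + fst p * lf c (snd p) (js 0)"
    unfolding X0 by (simp add: lf_add lf_scale)
  have "(1 - \<alpha>) * qf c (V 0) = 4 * (V 0 (js 0) * lf c (V 0) (js 0))"
    using qedge_V_0 qf_V_pos[of 0] by (simp add: qedge_def field_simps)
  then show ?thesis
    unfolding q l by (simp add: X0 algebra_simps power2_eq_square)
qed

text \<open>All that one cycle must deliver: \<open>d1\<close> and \<open>d2\<close> pin the first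
  excess to order \<open>h\<close>, \<open>C\<close> bounds the change of the scale apart from the
  factor \<kappa>, and the bounded part, renormalised to have coordinate 0 equal to 0, returns to
  \<open>K\<close>.\<close>

definition good :: "real \<Rightarrow> real \<Rightarrow> real \<Rightarrow> real \<Rightarrow> real \<Rightarrow> (nat \<Rightarrow> real) \<Rightarrow> bool" where
  "good \<eta> C d1 d2 h y \<longleftrightarrow>
     (\<forall>t<10. upd c (js t) (v t h y) = v (Suc t) h y \<and> selects c (v t h y) (js t) \<and>
        (0 < t \<longrightarrow> \<alpha> + \<eta> \<le> qedge c (v t h y) (js t))) \<and>
     d1 * h \<le> qedge c (v 0 h y) (js 0) - \<alpha> \<and> qedge c (v 0 h y) (js 0) - \<alpha> \<le> d2 * h \<and>
     qedge c (v 0 h y) (js 0) < \<alpha> + \<eta> \<and>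
     \<bar>Y 10 h y 0\<bar> \<le> C \<and> (\<lambda>k. v 10 h y k - V 0 k * v 10 h y 0) \<in> K"

lemma Y_5: "t \<le> 10 \<Longrightarrow> Y t h y 5 = y 5"
proof (induction t)
  case (Suc t)
  then show ?case using js[of t] by simp
qed simp

lemma eventually_good:
  obtains \<eta>0 C d1 d2 where "\<eta>0 > 0" "d1 > 0" "d2 > 0" "C \<ge> 0"
    "\<forall>\<eta>. 0 < \<eta> \<longrightarrow> \<eta> \<le> \<eta>0 \<longrightarrow> eventually (\<lambda>p. good \<eta> C d1 d2 (fst p) (snd p)) F"
proof -
  \<comment> \<open>Half of the smallest gap above \<alpha>, so that the other half absorbs the
    perturbation.\<close>
  define \<eta>0 where "\<eta>0 = Min ((\<lambda>t. (qedge c (V t) (js t) - \<alpha>) / 2) ` {1..<10})"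
  have \<eta>0: "\<eta>0 > 0" unfolding \<eta>0_def using qedge_V_later by (subst Min_gr_iff) auto
  have \<eta>0_le: "\<alpha> + \<eta>0 < qedge c (V t) (js t)" if "0 < t" "t < 10" for t
  proof -
    have "\<eta>0 \<le> (qedge c (V t) (js t) - \<alpha>) / 2"
      unfolding \<eta>0_def using that by (intro Min_le) auto
    then show ?thesis using qedge_V_later[OF that] by (simp add: field_simps)
  qed
  have "(\<lambda>p. Y 10 (fst p) (snd p) 0) \<in> O[F](\<lambda>_. 1)" by (rule Y_limits) auto
  then obtain C where C: "C > 0" "eventually (\<lambda>p. \<bar>Y 10 (fst p) (snd p) 0\<bar> \<le> C) F"
    by (auto elim!: landau_o.bigE)
  obtain d where d: "d > 0" "\<And>y. y \<in> K \<Longrightarrow> d \<le> 2 * (1 - \<alpha>) * dot6 (lf c (V 0)) y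
      - 4 * (y (js 0) * lf c (V 0) (js 0) + V 0 (js 0) * lf c y (js 0))" using K_drift by blast
  define lin where "lin p = 2 * (1 - \<alpha>) * dot6 (lf c (V 0)) (snd p)
      - 4 * (snd p (js 0) * lf c (V 0) (js 0) + V 0 (js 0) * lf c (snd p) (js 0))" for p :: "real \<times> (nat \<Rightarrow> real)"
  define quad where "quad p = (1 - \<alpha>) * qf c (snd p) - 4 * (snd p (js 0) * lf c (snd p) (js 0))" for p :: "real \<times> (nat \<Rightarrow> real)"
  define Q where "Q = qf c (V 0)"
  have Q: "Q > 0" unfolding Q_def by (rule qf_V_pos) simp
  have y: "(\<lambda>p. snd p k) \<in> O[F](\<lambda>_. 1)" if "k < 6" for k
    using Y_limits(2)[of 0 k] that by simp
  have js0: "js 0 < 6" using js[of 0] by simp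
  have "lin \<in> O[F](\<lambda>_. 1)"
    unfolding lin_def using dot6_bigo[OF y] lf_bigo[OF y] y[OF js0]
    by (intro sum_in_bigo landau_o.big.mult_in_1) auto
  then obtain L where L: "L > 0" "eventually (\<lambda>p. \<bar>lin p\<bar> \<le> L) F"
    by (auto elim!: landau_o.bigE)
  have "quad \<in> O[F](\<lambda>_. 1)"
    unfolding quad_def using qf_bigo[OF y] lf_bigo[OF y] y[OF js0]
    by (intro sum_in_bigo landau_o.big.mult_in_1) auto
  then have "(\<lambda>p. fst p * quad p) \<in> o[F](\<lambda>_. 1 * 1)"
    by (intro landau_o.small_big_mult smalloI_tendsto) (auto simp: fst_F)
  then have hq: "((\<lambda>p. fst p * quad p) \<longlongrightarrow> 0) F"
    using smalloD_tendsto by fastforce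
  have upd: "eventually (\<lambda>p. upd c (js t) (v t (fst p) (snd p)) = v (Suc t) (fst p) (snd p)) F" if t: "t < 10" for t
  proof -
    have j: "js t < 6" using js[OF t] by simp
    have "(\<lambda>p. fst p * lf c (Y t (fst p) (snd p)) (js t)) \<in> o[F](\<lambda>_. 1 * 1)"
      using t by (intro landau_o.small_big_mult smalloI_tendsto lf_bigo Y_limits) (auto simp: fst_F)
    then have "((\<lambda>p. fst p * lf c (Y t (fst p) (snd p)) (js t)) \<longlongrightarrow> 0) F"
      using smalloD_tendsto by fastforce
    from tendsto_add[OF tendsto_const[of "lf c (V t) (js t)"] this]
    have "((\<lambda>p. lf c (V t) (js t) + fst p * lf c (Y t (fst p) (snd p)) (js t)) \<longlongrightarrow> lf c (V t) (js t)) F" by simp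
    from order_tendstoD(1)[OF this lf_pos[OF t]] fst_F(2) show ?thesis
    proof eventually_elim
      case (elim p)
      have "upd c (js t) (\<lambda>k. V t k / fst p + Y t (fst p) (snd p) k)
          = (\<lambda>k. (V (Suc t)) k / fst p + Y (Suc t) (fst p) (snd p) k)"
        using upd_expansion[where W = "V (Suc t) (js t)", OF sym balance[OF t]] elim
        by (simp add: V_Suc[OF t, symmetric])
      then show ?case by (simp only: v_def)
    qed
  qed
  have pos: "eventually (\<lambda>p. 0 < v t (fst p) (snd p) k) F" if "t < 10" "k < 5" for t k
  proof -
    have "eventually (\<lambda>p. 0 < X t p k) F"
      using that V_pos[of t k] by (intro order_tendstoD(1)[OF X_tendsto]) auto
    then show ?thesis using fst_F(2)
    proof eventually_elim
      case (elim p)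
      have "fst p \<noteq> 0" using elim by simp
      then show ?case unfolding v_eq_X[OF \<open>fst p \<noteq> 0\<close>] using elim by simp
    qed
  qed
  have qpos: "eventually (\<lambda>p. 0 < qf c (v t (fst p) (snd p))) F" if "t < 10" for t
  proof -
    have "eventually (\<lambda>p. 0 < qf c (X t p)) F"
      using that qf_V_pos[of t] by (intro order_tendstoD(1)[OF qf_X]) auto
    then show ?thesis using fst_F(2)
    proof eventually_elim
      case (elim p)
      have "fst p \<noteq> 0" using elim by simp
      then show ?case unfolding v_eq_X[OF \<open>fst p \<noteq> 0\<close>] qf_scale using elim by simp
    qed
  qed
  have lpos: "eventually (\<lambda>p. 0 < lf c (v t (fst p) (snd p)) (js t)) F" if "t < 10" for t
  proof -
    have "eventually (\<lambda>p. 0 < lf c (X t p) (js t)) F"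
      using that lf_pos[of t] by (intro order_tendstoD(1)[OF lf_X]) auto
    then show ?thesis using fst_F(2)
    proof eventually_elim
      case (elim p)
      have "fst p \<noteq> 0" using elim by simp
      then show ?case unfolding v_eq_X[OF \<open>fst p \<noteq> 0\<close>] lf_scale using elim by simp
    qed
  qed
  have sel: "eventually (\<lambda>p. v t (fst p) (snd p) (js t) * lf c (v t (fst p) (snd p)) (js t)
      < v t (fst p) (snd p) k * lf c (v t (fst p) (snd p)) k) F" if "t < 10" "k < 5" "k \<noteq> js t" for t k
  proof -
    have "((\<lambda>p. X t p k * lf c (X t p) k - X t p (js t) * lf c (X t p) (js t)) \<longlongrightarrow>
        V t k * lf c (V t) k - V t (js t) * lf c (V t) (js t)) F"
      using that js[of t] by (intro tendsto_intros X_tendsto lf_X) auto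
    then have "eventually (\<lambda>p. 0 < X t p k * lf c (X t p) k - X t p (js t) * lf c (X t p) (js t)) F"
      using strict[OF that] by (intro order_tendstoD(1)) auto
    then show ?thesis using fst_F(2)
    proof eventually_elim
      case (elim p)
      have "fst p \<noteq> 0" using elim by simp
      have "(1 / fst p)\<^sup>2 * (X t p (js t) * lf c (X t p) (js t)) < (1 / fst p)\<^sup>2 * (X t p k * lf c (X t p) k)"
        using elim by (intro mult_strict_left_mono) auto
      then show ?case unfolding v_eq_X[OF \<open>fst p \<noteq> 0\<close>] lf_scale
        by (simp add: power2_eq_square mult_ac)
    qed
  qed
  have late: "eventually (\<lambda>p. \<alpha> + \<eta>0 \<le> qedge c (v t (fst p) (snd p)) (js t)) F" if "0 < t" "t < 10" for t
  proof -
    have "eventually (\<lambda>p. \<alpha> + \<eta>0 < qedge c (X t p) (js t)) F"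
      using that \<eta>0_le by (intro order_tendstoD(1)[OF qedge_X]) auto
    then show ?thesis using fst_F(2)
    proof eventually_elim
      case (elim p)
      have "fst p \<noteq> 0" "1 / fst p \<noteq> 0" using elim by auto
      then show ?case
        unfolding v_eq_X[OF \<open>fst p \<noteq> 0\<close>] qedge_scale[OF \<open>1 / fst p \<noteq> 0\<close>] using elim by simp
    qed
  qed
  have small: "eventually (\<lambda>p. qedge c (v 0 (fst p) (snd p)) (js 0) < \<alpha> + \<eta>) F" if "0 < \<eta>" for \<eta>
  proof -
    have "eventually (\<lambda>p. qedge c (X 0 p) (js 0) < \<alpha> + \<eta>) F"
      using that by (intro order_tendstoD(2)[OF qedge_X]) (auto simp: qedge_V_0)
    then show ?thesis using fst_F(2)
    proof eventually_elim
      case (elim p)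
      have "fst p \<noteq> 0" "1 / fst p \<noteq> 0" using elim by auto
      then show ?case
        unfolding v_eq_X[OF \<open>fst p \<noteq> 0\<close>] qedge_scale[OF \<open>1 / fst p \<noteq> 0\<close>] using elim by simp
    qed
  qed
  \<comment> \<open>The excess is \<open>h\<close> times a quotient whose numerator lies between
    \<open>d / 2\<close> and \<open>L + 1\<close> and whose denominator lies between
    \<open>Q / 2\<close> and \<open>2 * Q\<close>.\<close>
  define d1 d2 where "d1 = (d / 2) / (2 * Q)" and "d2 = (L + 1) / (Q / 2)"
  have qX: "((\<lambda>p. qf c (X 0 p)) \<longlongrightarrow> Q) F" using qf_X[of 0] by (simp add: Q_def)
  have "eventually (\<lambda>p. - min 1 (d / 2) < fst p * quad p) F" "eventually (\<lambda>p. fst p * quad p < 1) F"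
    "eventually (\<lambda>p. Q / 2 < qf c (X 0 p)) F" "eventually (\<lambda>p. qf c (X 0 p) < 2 * Q) F"
    using d(1) Q by (auto intro!: order_tendstoD(1)[OF hq] order_tendstoD(2)[OF hq]
        order_tendstoD(1)[OF qX, of "Q / 2", simplified] order_tendstoD(2)[OF qX])
  note near = this
  have excess: "eventually (\<lambda>p. d1 * fst p \<le> qedge c (v 0 (fst p) (snd p)) (js 0) - \<alpha> \<and>
      qedge c (v 0 (fst p) (snd p)) (js 0) - \<alpha> \<le> d2 * fst p) F"
    using fst_F(2,3) L(2) near
  proof eventually_elim
    case (elim p)
    define h q where "h = fst p" and "q = qf c (X 0 p)"
    have h: "h > 0" and q: "Q / 2 < q" "q < 2 * Q" "q > 0"
      using elim Q d(1) by (auto simp: h_def q_def Q_def)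
    have "qedge c (v 0 (fst p) (snd p)) (js 0) = qedge c (X 0 p) (js 0)"
      using h v_eq_X[of "fst p" 0 "snd p"] qedge_scale[of "1 / fst p" c "X 0 p" "js 0"] by (simp add: h_def)
    also have "\<dots> - \<alpha> = h * ((lin p + h * quad p) / q)"
      using excess_expansion[of p] q(3)
      by (simp add: qedge_def q_def h_def lin_def quad_def field_simps)
    finally have eq: "qedge c (v 0 (fst p) (snd p)) (js 0) - \<alpha> = h * ((lin p + h * quad p) / q)" .
    have n: "d / 2 \<le> lin p + h * quad p" "lin p + h * quad p \<le> L + 1"
      using elim d(2)[of "snd p"] d(1) by (auto simp: lin_def h_def)
    have le1: "d1 \<le> (lin p + h * quad p) / q" unfolding d1_def
      using n d(1) q by (intro frac_le) auto
    have le2: "(lin p + h * quad p) / q \<le> d2" unfolding d2_def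
      using n d(1) q Q by (intro frac_le) auto
    have "0 \<le> h" using h by simp
    from mult_left_mono[OF le1 this] mult_left_mono[OF le2 this] show ?case unfolding eq by (simp only: h_def mult.commute[of _ "fst p"])
  qed
  have stay: "eventually (\<lambda>p. (\<lambda>k. v 10 (fst p) (snd p) k - V 0 k * v 10 (fst p) (snd p) 0) \<in> K) F"
  proof -
    obtain \<delta> where \<delta>: "\<delta> > 0" "\<And>y w. y \<in> K \<Longrightarrow> w 0 = 0 \<Longrightarrow> w 5 = 1 \<Longrightarrow>
      (\<forall>k<6. \<bar>w k - (Y 10 0 y k - V 0 k * Y 10 0 y 0)\<bar> < \<delta>) \<Longrightarrow> w \<in> K" using K_contract by blast
    have lim: "((\<lambda>p. (Y 10 (fst p) (snd p) k - V 0 k * Y 10 (fst p) (snd p) 0)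
        - (Y 10 0 (snd p) k - V 0 k * Y 10 0 (snd p) 0)) \<longlongrightarrow> 0) F" if "k < 6" for k
    proof -
      have "((\<lambda>p. Y 10 (fst p) (snd p) i - Y 10 0 (snd p) i) \<longlongrightarrow> 0) F" if "i < 6" for i
        using smalloD_tendsto[OF Y_limits(1)[of 10 i]] that by simp
      from tendsto_diff[OF this[OF that] tendsto_mult[OF tendsto_const[of "V 0 k"] this[of 0]]]
      show ?thesis by (simp add: algebra_simps)
    qed
    have "eventually (\<lambda>p. \<bar>(Y 10 (fst p) (snd p) k - V 0 k * Y 10 (fst p) (snd p) 0)
        - (Y 10 0 (snd p) k - V 0 k * Y 10 0 (snd p) 0)\<bar> < \<delta>) F" if "k < 6" for k
      using order_tendstoD(2)[OF tendsto_rabs_zero[OF lim[OF that]] \<delta>(1)] .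
    then have "eventually (\<lambda>p. \<forall>k\<in>{..<6}. \<bar>(Y 10 (fst p) (snd p) k - V 0 k * Y 10 (fst p) (snd p) 0)
        - (Y 10 0 (snd p) k - V 0 k * Y 10 0 (snd p) 0)\<bar> < \<delta>) F"
      by (intro eventually_ball_finite) auto
    then show ?thesis using fst_F(2,3)
    proof eventually_elim
      case (elim p)
      \<comment> \<open>Since \<open>V 10\<close> is a multiple of \<open>V 0\<close>, the part of
        size 1/h cancels and only the bounded part remains.\<close>
      have eq: "(\<lambda>k. v 10 (fst p) (snd p) k - V 0 k * v 10 (fst p) (snd p) 0)
          = (\<lambda>k. Y 10 (fst p) (snd p) k - V 0 k * Y 10 (fst p) (snd p) 0)"
        unfolding v_def V_10 by (auto simp: V_0)
      show ?case unfolding eq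
      proof (rule \<delta>(2))
        show "snd p \<in> K" by (rule elim(3))
        show "Y 10 (fst p) (snd p) 0 - V 0 0 * Y 10 (fst p) (snd p) 0 = 0" by (simp add: V_0)
        show "Y 10 (fst p) (snd p) 5 - V 0 5 * Y 10 (fst p) (snd p) 0 = 1"
          using K_norm(2)[OF elim(3)] by (simp add: V_0 Y_5)
      qed (use elim(1) in blast)
    qed
  qed
  show ?thesis
  proof (rule that[of \<eta>0 d1 d2 C]; (intro allI impI)?)
    show "\<eta>0 > 0" "d1 > 0" "d2 > 0" "C \<ge> 0"
      using \<eta>0 d(1) Q L(1) C(1) by (auto simp: d1_def d2_def)
    fix \<eta> :: real assume \<eta>: "0 < \<eta>" "\<eta> \<le> \<eta>0"
    have late': "eventually (\<lambda>p. \<alpha> + \<eta> \<le> qedge c (v t (fst p) (snd p)) (js t)) F"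
      if "0 < t" "t < 10" for t
      using late[OF that] by (rule eventually_mono) (use \<eta> in simp)
    have selects: "eventually (\<lambda>p. selects c (v t (fst p) (snd p)) (js t)) F" if "t < 10" for t
    proof -
      have "eventually (\<lambda>p. \<forall>k\<in>{..<5}. 0 < v t (fst p) (snd p) k) F"
        "eventually (\<lambda>p. \<forall>k\<in>{..<5} - {js t}. v t (fst p) (snd p) (js t) * lf c (v t (fst p) (snd p)) (js t)
           < v t (fst p) (snd p) k * lf c (v t (fst p) (snd p)) k) F"
        using that by (auto intro!: eventually_ball_finite pos sel)
      with qpos[OF that] lpos[OF that] show ?thesis
        unfolding selects_def by eventually_elim blast
    qed
    have imp: "eventually (\<lambda>p. A \<longrightarrow> P p) F" if "A \<Longrightarrow> eventually P F" for A P
      using that by (cases A) auto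
    have "eventually (\<lambda>p. \<forall>t\<in>{..<10}. upd c (js t) (v t (fst p) (snd p)) = v (Suc t) (fst p) (snd p) \<and>
        selects c (v t (fst p) (snd p)) (js t) \<and>
        (0 < t \<longrightarrow> \<alpha> + \<eta> \<le> qedge c (v t (fst p) (snd p)) (js t))) F"
      by (intro eventually_ball_finite eventually_conj ballI finite_lessThan imp)
         (simp_all add: upd selects late')
    then show "eventually (\<lambda>p. good \<eta> C d1 d2 (fst p) (snd p)) F"
      using excess small[OF \<eta>(1)] C(2) stay
      unfolding good_def Ball_def lessThan_iff by eventually_elim blast
  qed
qed

section \<open>Infinite runs and the growth of the scale\<close>

primrec run :: "(nat \<Rightarrow> real) \<Rightarrow> nat \<Rightarrow> nat \<Rightarrow> real" where
  "run v0 0 = v0"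
| "run v0 (Suc k) = upd c (js (k mod 10)) (run v0 k)"

text \<open>With \<open>s n\<close> the coordinate 0 at the start of cycle \<open>n\<close> and
  \<open>h = 1 / s n\<close>, the scale obeys \<open>s (Suc n) = \<kappa> * s n\<close> up to an
  error of at most \<open>C\<close>. So it grows exactly in the order of
  \<open>\<kappa> ^ n\<close>, and the excess decays as its inverse.\<close>

theorem run_bursts:
  obtains \<eta>0 where "\<eta>0 > 0"
    "\<forall>\<eta> y. 0 < \<eta> \<longrightarrow> \<eta> \<le> \<eta>0 \<longrightarrow> y \<in> K \<longrightarrow> (\<exists>S0. \<forall>S\<ge>S0. \<forall>v0. v0 = (\<lambda>k. S * V 0 k + y k) \<longrightarrow>
       (\<forall>k. selects c (run v0 k) (js (k mod 10))) \<and>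
       bursts \<alpha> \<eta> \<kappa> (\<lambda>k. qedge c (run v0 k) (js (k mod 10))))"
proof -
  obtain \<eta>0 C d1 d2 where pos: "\<eta>0 > 0" "d1 > 0" "d2 > 0" "C \<ge> 0"
    and ev: "\<forall>\<eta>. 0 < \<eta> \<longrightarrow> \<eta> \<le> \<eta>0 \<longrightarrow> eventually (\<lambda>p. good \<eta> C d1 d2 (fst p) (snd p)) F"
    by (rule eventually_good)
  show ?thesis
  proof (rule that[OF pos(1)], intro allI impI)
    fix \<eta> :: real and y assume \<eta>: "0 < \<eta>" "\<eta> \<le> \<eta>0" and y: "y \<in> K"
    obtain h0 where h0: "h0 > 0" "\<And>h y. 0 < h \<Longrightarrow> h < h0 \<Longrightarrow> y \<in> K \<Longrightarrow> good \<eta> C d1 d2 h y"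
      using ev[rule_format, OF \<eta>] unfolding eventually_at_right_prod_principal by auto
    \<comment> \<open>The fixed point of the map sending \<open>x\<close> to
      \<open>\<kappa> * x - C\<close>; shifting the scale by \<open>m\<close> turns the inexact
      recursion into two geometric bounds.\<close>
    define m where "m = C / (\<kappa> - 1)"
    have m: "m \<ge> 0" "\<kappa> * m = C + m" using pos(4) \<kappa> by (auto simp: m_def field_simps)
    \<comment> \<open>The first term gives \<open>1 / s n < h0\<close>; the second keeps the scale
      from decreasing and makes \<open>S - m\<close> positive.\<close>
    define S0 where "S0 = max (1 / h0 + 1) (m + 1)"
    show "\<exists>S0. \<forall>S\<ge>S0. \<forall>v0. v0 = (\<lambda>k. S * V 0 k + y k) \<longrightarrow>
       (\<forall>k. selects c (run v0 k) (js (k mod 10))) \<and>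
       bursts \<alpha> \<eta> \<kappa> (\<lambda>k. qedge c (run v0 k) (js (k mod 10)))"
    proof (intro exI[of _ S0] allI impI)
      fix S v0 assume S: "S \<ge> S0" and v0: "v0 = (\<lambda>k. S * V 0 k + y k)"
      define s where "s n = run v0 (10 * n) 0" for n
      define z where "z n = (\<lambda>k. run v0 (10 * n) k - V 0 k * s n)" for n
      have start: "s 0 = S" "z 0 = y"
        using K_norm(1)[OF y] by (auto simp: s_def z_def v0 V_0)
      have steps: "run v0 (10 * n + t) = v t (1 / s n) (z n)"
        if "good \<eta> C d1 d2 (1 / s n) (z n)" "t \<le> 10" for n t
        using that(2)
      proof (induction t)
        case 0
        then show ?case by (auto simp: v_def z_def)
      next
        case (Suc t)
        then have t: "t < 10" by simp
        have "upd c (js t) (v t (1 / s n) (z n)) = v (Suc t) (1 / s n) (z n)"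
          by (rule that(1)[unfolded good_def, THEN conjunct1, rule_format, OF t, THEN conjunct1])
        moreover have "(10 * n + t) mod 10 = t" using t by simp
        ultimately show ?case using Suc by (simp only: add_Suc_right run.simps)
      qed
      have large: "x > 0" "1 / x < h0" if "1 / h0 < x" "1 / h0 > 0" for x
      proof -
        show "x > 0" using that by (rule less_trans[rotated])
        then show "1 / x < h0" using that(1) h0(1) by (simp add: pos_divide_less_eq mult.commute)
      qed
      have inv: "z n \<in> K \<and> s n \<ge> S0 \<and> s n - m \<ge> \<kappa> ^ n * (S - m) \<and> s n + m \<le> \<kappa> ^ n * (S + m)" for n
      proof (induction n)
        case 0
        then show ?case using start y S by simp
      next
        case (Suc n)
        have "1 / h0 < s n" using Suc.IH by (simp add: S0_def)
        moreover have "1 / h0 > 0" using h0(1) by simp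
        ultimately have sn: "s n > 0" "1 / s n < h0" by (rule large)+
        then have good: "good \<eta> C d1 d2 (1 / s n) (z n)"
          using Suc.IH by (intro h0(2)) auto
        have r: "run v0 (10 * Suc n) = v 10 (1 / s n) (z n)"
          using steps[OF good, of 10] by (simp add: add.commute)
        have s': "s (Suc n) = \<kappa> * s n + Y 10 (1 / s n) (z n) 0"
          unfolding s_def[of "Suc n"] r by (simp add: v_def V_10 V_0)
        have "z (Suc n) = (\<lambda>k. v 10 (1 / s n) (z n) k - V 0 k * v 10 (1 / s n) (z n) 0)"
          unfolding z_def[of "Suc n"] s_def[of "Suc n"] r by simp
        then have "z (Suc n) \<in> K" using good by (simp add: good_def)
        have Yb: "\<bar>Y 10 (1 / s n) (z n) 0\<bar> \<le> C" using good by (simp add: good_def)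
        have "s n \<ge> m + 1" "s n \<ge> S0" using Suc.IH by (auto simp: S0_def)
        have "(\<kappa> - 1) * m = C" using m(2) by (simp add: algebra_simps)
        then have "(\<kappa> - 1) * s n \<ge> C"
          using mult_left_mono[of m "s n" "\<kappa> - 1"] \<open>s n \<ge> m + 1\<close> \<kappa> by simp
        then have "\<kappa> * s n \<ge> s n + C" by (simp add: left_diff_distrib)
        then have "s (Suc n) \<ge> s n" using s' Yb by linarith
        have "\<kappa> * (\<kappa> ^ n * (S - m)) \<le> \<kappa> * (s n - m)" "\<kappa> * (s n + m) \<le> \<kappa> * (\<kappa> ^ n * (S + m))"
          using Suc.IH \<kappa> by (intro mult_left_mono; simp)+
        then have "\<kappa> ^ Suc n * (S - m) \<le> \<kappa> * s n - \<kappa> * m" "\<kappa> * s n + \<kappa> * m \<le> \<kappa> ^ Suc n * (S + m)"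
          by (simp_all only: power_Suc mult.assoc distrib_left right_diff_distrib)
        then have "\<kappa> ^ Suc n * (S - m) \<le> s (Suc n) - m" "s (Suc n) + m \<le> \<kappa> ^ Suc n * (S + m)"
          using s' Yb m(2) by linarith+
        with \<open>s (Suc n) \<ge> s n\<close> \<open>z (Suc n) \<in> K\<close> \<open>s n \<ge> S0\<close> show ?case by (intro conjI) auto
      qed
      have sn: "s n > 0" "1 / s n < h0" for n
      proof -
        have "1 / h0 < s n" using inv[of n] by (simp add: S0_def)
        moreover have "1 / h0 > 0" using h0(1) by simp
        ultimately show "s n > 0" "1 / s n < h0" by (rule large)+
      qed
      have good: "good \<eta> C d1 d2 (1 / s n) (z n)" for n
        using inv[of n] sn[of n] by (intro h0(2)) auto
      have run: "run v0 k = v (k mod 10) (1 / s (k div 10)) (z (k div 10))" for k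
        using steps[OF good, of "k mod 10" "k div 10"] by simp
      have k: "k mod 10 < 10" for k :: nat by simp
      have "bursts \<alpha> \<eta> \<kappa> (\<lambda>k. qedge c (run v0 k) (js (k mod 10)))"
        unfolding bursts_def
      proof (intro conjI allI impI)
        fix k :: nat assume "\<not> 10 dvd k"
        then have "k mod 10 > 0" by (simp add: mod_greater_zero_iff_not_dvd)
        then show "\<alpha> + \<eta> \<le> qedge c (run v0 k) (js (k mod 10))"
          using good[of "k div 10", unfolded good_def, THEN conjunct1, rule_format, OF k[of k]]
          unfolding run by (elim conjE) (erule mp)
      next
        define e where "e n = qedge c (v 0 (1 / s n) (z n)) (js 0)" for n
        have run0: "qedge c (run v0 (10 * n)) (js (10 * n mod 10)) = e n" for n
          by (simp add: run e_def)
        have e: "d1 * (1 / s n) \<le> e n - \<alpha>" "e n - \<alpha> \<le> d2 * (1 / s n)" "e n < \<alpha> + \<eta>" for n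
        proof -
          note g = good[of n, unfolded good_def, folded e_def]
          from g show "d1 * (1 / s n) \<le> e n - \<alpha>" by (elim conjE)
          from g show "e n - \<alpha> \<le> d2 * (1 / s n)" by (elim conjE)
          from g show "e n < \<alpha> + \<eta>" by (elim conjE)
        qed
        have e_pos: "e n - \<alpha> > 0" for n
        proof -
          have "0 < d1 * (1 / s n)" using pos(2) sn(1)[of n] by simp
          then show ?thesis using e(1)[of n] by linarith
        qed
        show "\<alpha> < qedge c (run v0 (10 * n)) (js (10 * n mod 10))"
          "qedge c (run v0 (10 * n)) (js (10 * n mod 10)) < \<alpha> + \<eta>" for n
          unfolding run0 using e_pos[of n] e(3)[of n] by auto
        \<comment> \<open>Bounds the deviation of the logarithm from linear growth, collecting the
          constants of both two-sided estimates.\<close>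
        define B where "B = \<bar>ln d1\<bar> + \<bar>ln d2\<bar> + \<bar>ln (S - m)\<bar> + \<bar>ln (S + m)\<bar>"
        have Sm: "S - m > 0" "S + m > 0" using S m(1) by (auto simp: S0_def)
        have bd: "\<bar>- ln (e n - \<alpha>) - ln \<kappa> * real n\<bar> \<le> B" for n
        proof -
          have kn: "\<kappa> ^ n > 0" using \<kappa> by simp
          have "ln (\<kappa> ^ n * (S - m)) \<le> ln (s n)"
            using inv[of n] m(1) kn Sm sn(1)[of n] by (subst ln_le_cancel_iff) auto
          moreover have "ln (s n) \<le> ln (\<kappa> ^ n * (S + m))"
            using inv[of n] m(1) kn Sm sn(1)[of n] by (subst ln_le_cancel_iff) auto
          moreover have "ln (d1 * (1 / s n)) \<le> ln (e n - \<alpha>)"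
            using e(1)[of n] e_pos[of n] pos(2) sn(1)[of n] by (subst ln_le_cancel_iff) auto
          moreover have "ln (e n - \<alpha>) \<le> ln (d2 * (1 / s n))"
            using e(2)[of n] e_pos[of n] pos(3) sn(1)[of n] by (subst ln_le_cancel_iff) auto
          moreover have "ln (\<kappa> ^ n * x) = ln \<kappa> * real n + ln x" if "x > 0" for x
            using that kn \<kappa> by (subst ln_mult) (auto simp: ln_realpow)
          moreover have "ln (x * (1 / s n)) = ln x - ln (s n)" if "x > 0" for x
            using that sn(1)[of n] by (simp add: ln_div)
          ultimately show ?thesis
            using Sm pos(2,3) by (simp only: B_def abs_le_iff) linarith
        qed
        have "(\<lambda>n. - ln (e n - \<alpha>) / real n - ln \<kappa>) \<longlonglongrightarrow> 0"
        proof (rule tendsto_rabs_zero_cancel, rule tendsto_sandwich[OF _ _ tendsto_const])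
          show "(\<lambda>n. B / real n) \<longlonglongrightarrow> 0"
            by (rule tendsto_divide_0[OF tendsto_const filterlim_at_top_imp_at_infinity])
               (rule filterlim_real_sequentially)
          show "\<forall>\<^sub>F n in sequentially. \<bar>- ln (e n - \<alpha>) / real n - ln \<kappa>\<bar> \<le> B / real n"
            using eventually_gt_at_top[of 0]
          proof eventually_elim
            case (elim n)
            have "- ln (e n - \<alpha>) / real n - ln \<kappa> = (- ln (e n - \<alpha>) - ln \<kappa> * real n) / real n"
              using elim by (simp add: field_simps)
            then show ?case using bd[of n] elim by (simp add: divide_right_mono)
          qed
        qed auto
        then show "(\<lambda>n. - ln (qedge c (run v0 (10 * n)) (js (10 * n mod 10)) - \<alpha>) / real n) \<longlonglongrightarrow> ln \<kappa>"
          unfolding run0 by (rule LIM_zero_cancel)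
      qed
      moreover have "selects c (run v0 k) (js (k mod 10))" for k
        using good[of "k div 10", unfolded good_def, THEN conjunct1, rule_format, OF k[of k]]
        unfolding run by (elim conjE)
      ultimately show "(\<forall>k. selects c (run v0 k) (js (k mod 10))) \<and>
         bursts \<alpha> \<eta> \<kappa> (\<lambda>k. qedge c (run v0 k) (js (k mod 10)))" by (intro conjI allI)
    qed
  qed
qed

end

section \<open>Realisation by sign matrices\<close>

text \<open>Repeated rows turn the uniform distribution into arbitrary integer weights on the types.
  Recording that each type occurring has positive multiplicity excludes pairs of weight 0, in
  particular pairs with equal components.\<close>

lemma rows_with_multiplicity:
  fixes N :: "'a \<Rightarrow> nat"
  assumes "finite X"
  shows "\<exists>(m :: nat) ty. (\<forall>r<m. ty r \<in> X \<and> 0 < N (ty r)) \<and>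
    (\<forall>f :: 'a \<Rightarrow> real. (\<Sum>r<m. f (ty r)) = (\<Sum>x\<in>X. real (N x) * f x))"
  using assms
proof (induction X rule: finite_induct)
  case empty
  then show ?case by (intro exI[of _ 0]) auto
next
  case (insert x X)
  then obtain m :: nat and ty where IH: "\<And>r. r < m \<Longrightarrow> ty r \<in> X \<and> 0 < N (ty r)"
    "\<And>f :: 'a \<Rightarrow> real. (\<Sum>r<m. f (ty r)) = (\<Sum>x\<in>X. real (N x) * f x)" by blast
  define ty' where "ty' r = (if r < m then ty r else x)" for r
  have ext: "(\<Sum>r<m + k. f (ty' r)) = (\<Sum>r<m. f (ty r)) + real k * f x" for f :: "'a \<Rightarrow> real" and k
    by (induction k) (auto simp: ty'_def algebra_simps)
  have "(\<Sum>r<m + N x. f (ty' r)) = (\<Sum>x\<in>insert x X. real (N x) * f x)" for f :: "'a \<Rightarrow> real"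
    using insert.hyps by (simp add: ext IH(2))
  moreover have "ty' r \<in> insert x X \<and> 0 < N (ty' r)" if "r < m + N x" for r
    using IH(1)[of r] that by (auto simp: ty'_def)
  ultimately show ?case by blast
qed

definition sgn2 :: "nat \<times> nat \<Rightarrow> nat \<Rightarrow> real" where
  "sgn2 x j = (if j = fst x \<or> j = snd x then -1 else 1)"

text \<open>At most two of the five entries are -1, so the sum is at least 3 - 2.\<close>

lemma sum_sgn2_ge: "1 \<le> (\<Sum>j<5. sgn2 x j)"
proof -
  have "(\<Sum>j<5. 1 - 2 * (if j = fst x then 1 else 0) - 2 * (if j = snd x then 1 else 0 :: real)) \<le> (\<Sum>j<5. sgn2 x j)"
    by (intro sum_mono) (auto simp: sgn2_def)
  then show ?thesis
    by (auto simp: sum_subtractf sum_distrib_left[symmetric] split: if_splits)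
qed

text \<open>The sign equals 1 minus twice the indicator of \<open>a = j\<close> minus twice that of
  \<open>b = j\<close>, except for \<open>a = b = j\<close>, where the weight is 0.\<close>

lemma weighted_sum_sgn2:
  fixes c :: "nat \<Rightarrow> nat \<Rightarrow> real"
  assumes sym: "\<And>a b. a < 6 \<Longrightarrow> b < 6 \<Longrightarrow> c a b = c b a" and diag: "c j j = 0" and j: "j < 6"
  shows "(\<Sum>x\<in>{..<6} \<times> {..<6}. c (fst x) (snd x) * v (fst x) * v (snd x) * sgn2 x j)
    = qf c v - 4 * (v j * lf c v j)"
proof -
  have "(\<Sum>x\<in>{..<6} \<times> {..<6}. c (fst x) (snd x) * v (fst x) * v (snd x) * sgn2 x j)
      = (\<Sum>a<6. \<Sum>b<6. c a b * v a * v b * sgn2 (a, b) j)"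
    by (simp add: sum.cartesian_product split_beta)
  also have "\<dots> = (\<Sum>a<6. \<Sum>b<6. c a b * v a * v b - 2 * (if a = j then c a b * v a * v b else 0)
      - 2 * (if b = j then c a b * v a * v b else 0))"
    using diag by (intro sum.cong) (auto simp: sgn2_def)
  also have "\<dots> = (\<Sum>a<6. \<Sum>b<6. c a b * v a * v b)
      - 2 * (\<Sum>a<6. \<Sum>b<6. if a = j then c a b * v a * v b else 0)
      - 2 * (\<Sum>a<6. \<Sum>b<6. if b = j then c a b * v a * v b else 0)"
    by (simp only: sum_subtractf sum_distrib_left[symmetric])
  also have "(\<Sum>a<6. \<Sum>b<6. c a b * v a * v b) = qf c v"
    by (simp add: qf_def lf_def sum_distrib_left mult_ac)
  also have "(\<Sum>a<6. \<Sum>b<6. if a = j then c a b * v a * v b else 0) = v j * lf c v j"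
  proof -
    have "(\<Sum>a<6. \<Sum>b<6. if a = j then c a b * v a * v b else 0)
        = (\<Sum>a<6. if a = j then (\<Sum>b<6. c a b * v a * v b) else 0)"
      by (intro sum.cong) auto
    then show ?thesis using j by (simp add: lf_def sum_distrib_left mult_ac)
  qed
  also have "(\<Sum>a<6. \<Sum>b<6. if b = j then c a b * v a * v b else 0) = v j * lf c v j"
    using j by (simp add: lf_def sum_distrib_left) (intro sum.cong, auto simp: sym mult_ac)
  finally show ?thesis by simp
qed

lemma qf_upd:
  assumes sym: "\<And>a b. a < 6 \<Longrightarrow> b < 6 \<Longrightarrow> c a b = c b a" and diag: "c j j = 0" and j: "j < 6"
  shows "qf c (v(j := x)) = qf c v + 2 * (x - v j) * lf c v j"
proof -
  define u where "u = (\<lambda>k. if k = j then x - v j else 0)"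
  have v: "v(j := x) = (\<lambda>k. v k + u k)" by (auto simp: u_def)
  have u: "(\<Sum>k<6. f k * u k) = f j * (x - v j)" for f :: "nat \<Rightarrow> real"
  proof -
    have "(\<Sum>k<6. f k * u k) = (\<Sum>k<6. if k = j then f j * (x - v j) else 0)"
      by (intro sum.cong) (auto simp: u_def)
    then show ?thesis using j by simp
  qed
  have "qf c u = 0"
  proof -
    have "qf c u = (\<Sum>k<6. lf c u k * u k)" by (simp add: qf_def mult.commute)
    also have "\<dots> = lf c u j * (x - v j)" by (rule u)
    also have "lf c u j = 0" unfolding lf_def u by (simp add: diag)
    finally show ?thesis by simp
  qed
  moreover have "dot6 (lf c v) u = lf c v j * (x - v j)"
    unfolding dot6_def by (rule u)
  ultimately show ?thesis
    unfolding v using qf_add[OF sym, where u = v and v = u] by (simp add: mult_ac)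
qed

context quad_cycle
begin

text \<open>The pair \<open>(a, b)\<close> is repeated \<open>c a b * v0 a * v0 b\<close> times, so
  the uniform distribution on rows is the normalised quadratic form at \<open>v0\<close>. This needs
  integral weights and an integral starting vector, hence the integer point of \<open>K\<close> and
  an integral scale.\<close>

theorem matrix_exists:
  fixes cn :: "nat \<Rightarrow> nat \<Rightarrow> nat" and yi :: "nat \<Rightarrow> int"
  assumes cn: "\<And>a b. a < 6 \<Longrightarrow> b < 6 \<Longrightarrow> c a b = real (cn a b)"
    and diag: "\<And>a. a < 6 \<Longrightarrow> c a a = 0"
    and pent: "c 0 1 > 0" "c 1 2 > 0" "c 2 3 > 0" "c 3 4 > 0" "c 4 0 > 0"
    and y: "y \<in> K" "\<And>k. k < 6 \<Longrightarrow> y k = of_int (yi k)"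
    and \<alpha>: "0 < \<alpha>"
  obtains \<eta>0 where "\<eta>0 > 0"
    "\<forall>\<eta>. 0 < \<eta> \<longrightarrow> \<eta> \<le> \<eta>0 \<longrightarrow> (\<exists>m M. regular_run m 5 M \<and>
       bursts \<alpha> \<eta> \<kappa> (\<lambda>k. top_edge m 5 M (ada_iter m 5 M k)) \<and>
       (\<forall>r<m. 1 \<le> (\<Sum>j<5. M r j)) \<and> (\<exists>D\<in>prob_simplex m. \<forall>j<5. edge m M D j = 1 / 5))"
proof -
  obtain \<eta>0 where \<eta>0: "\<eta>0 > 0"
    "\<forall>\<eta> y. 0 < \<eta> \<longrightarrow> \<eta> \<le> \<eta>0 \<longrightarrow> y \<in> K \<longrightarrow> (\<exists>S0. \<forall>S\<ge>S0. \<forall>v0. v0 = (\<lambda>k. S * V 0 k + y k) \<longrightarrow>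
       (\<forall>k. selects c (run v0 k) (js (k mod 10))) \<and>
       bursts \<alpha> \<eta> \<kappa> (\<lambda>k. qedge c (run v0 k) (js (k mod 10))))"
    by (rule run_bursts)
  show ?thesis
  proof (rule that[OF \<eta>0(1)], intro allI impI)
    fix \<eta> :: real assume \<eta>: "0 < \<eta>" "\<eta> \<le> \<eta>0"
    obtain S0 where S0: "\<And>S v0. S \<ge> S0 \<Longrightarrow> v0 = (\<lambda>k. S * V 0 k + y k) \<Longrightarrow>
       (\<forall>k. selects c (run v0 k) (js (k mod 10))) \<and>
       bursts \<alpha> \<eta> \<kappa> (\<lambda>k. qedge c (run v0 k) (js (k mod 10)))"
      using \<eta>0(2)[rule_format, OF \<eta> y(1)] by blast
    define S where "S = nat \<lceil>S0\<rceil>"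
    define v0 where "v0 = (\<lambda>k. real S * V 0 k + y k)"
    define J where "J k = js (k mod 10)" for k
    define R where "R = run v0"
    have "real S \<ge> S0" unfolding S_def by linarith
    from S0[OF this v0_def] have sel: "\<And>k. selects c (R k) (J k)"
      and bursts: "bursts \<alpha> \<eta> \<kappa> (\<lambda>k. qedge c (R k) (J k))" by (auto simp: J_def R_def)
    have J: "J k < 5" for k unfolding J_def by (rule js) simp
    have J6: "J k < 6" for k using J[of k] by simp
    have R_Suc: "R (Suc k) = upd c (J k) (R k)" for k by (simp add: R_def J_def)
    have R_5: "R k 5 = 1" for k
    proof (induction k)
      case 0
      then show ?case using K_norm(2)[OF y(1)] by (simp add: R_def v0_def V_0)
    next
      case (Suc k)
      then show ?case using J[of k] by (simp add: R_Suc upd_def)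
    qed
    have R_pos: "R k i > 0" if "i < 6" for k i
    proof (cases "i = 5")
      case False
      then have "i < 5" using that by simp
      then show ?thesis using sel[of k] by (simp add: selects_def)
    qed (simp add: R_5)
    have v0_pos: "v0 i > 0" if "i < 6" for i
      using R_pos[OF that, of 0] by (simp add: R_def)
    define w where "w k = nat (int S * (if k < 5 then 1 else 0) + yi k)" for k :: nat
    have w: "v0 k = real (w k)" if "k < 6" for k
    proof -
      define i where "i = int S * (if k < 5 then 1 else 0) + yi k"
      have eq: "v0 k = of_int i"
        using y(2)[OF that] by (simp add: v0_def V_0 i_def)
      then have "i > 0" using v0_pos[OF that] by simp
      then show ?thesis unfolding eq w_def i_def[symmetric] by simp
    qed
    define N where "N x = cn (fst x) (snd x) * w (fst x) * w (snd x)" for x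
    define T where "T = {..<6::nat} \<times> {..<6::nat}"
    have N: "real (N x) = c (fst x) (snd x) * v0 (fst x) * v0 (snd x)" if "x \<in> T" for x
      using that by (auto simp: N_def T_def cn w)
    obtain m :: nat and ty where ty: "\<And>r. r < m \<Longrightarrow> ty r \<in> T \<and> 0 < N (ty r)"
      and rows: "\<And>f :: _ \<Rightarrow> real. (\<Sum>r<m. f (ty r)) = (\<Sum>x\<in>T. real (N x) * f x)"
      using rows_with_multiplicity[of T N] by (auto simp: T_def)
    define M where "M r = sgn2 (ty r)" for r
    \<comment> \<open>Weight of a single row of type \<open>x\<close>: the normalised weight of the
      pair at \<open>v\<close>, divided by its multiplicity. At \<open>v = v0\<close> it is
      \<open>1 / m\<close>.\<close>
    define W where "W v x = (v (fst x) / v0 (fst x)) * (v (snd x) / v0 (snd x)) / qf c v" for v x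
    have total: "(\<Sum>x\<in>T. c (fst x) (snd x) * v (fst x) * v (snd x)) = qf c v" for v
      by (simp add: T_def qf_def lf_def sum.cartesian_product[symmetric] split_beta sum_distrib_left mult_ac
          sum.cartesian_product)
    have W_sum: "(\<Sum>r<m. W v (ty r) * g (ty r)) = (\<Sum>x\<in>T. c (fst x) (snd x) * v (fst x) * v (snd x) * g x) / qf c v" for v g
    proof -
      have "(\<Sum>r<m. W v (ty r) * g (ty r)) = (\<Sum>x\<in>T. real (N x) * (W v x * g x))"
        by (rule rows)
      also have "\<dots> = (\<Sum>x\<in>T. c (fst x) (snd x) * v (fst x) * v (snd x) * g x / qf c v)"
      proof (rule sum.cong[OF refl])
        fix x assume x: "x \<in> T"
        then have "v0 (fst x) > 0" "v0 (snd x) > 0" using v0_pos by (auto simp: T_def)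
        then show "real (N x) * (W v x * g x) = c (fst x) (snd x) * v (fst x) * v (snd x) * g x / qf c v"
          unfolding N[OF x] W_def by simp
      qed
      finally show ?thesis by (simp add: sum_divide_distrib)
    qed
    have edge: "edge m M (\<lambda>r. W (R k) (ty r)) j = qedge c (R k) j" if "j < 6" for k j
    proof -
      have "qf c (R k) > 0" using sel[of k] by (simp add: selects_def)
      then show ?thesis
        using W_sum[of "R k" "\<lambda>x. sgn2 x j"] weighted_sum_sgn2[of c j "R k", OF sym diag[OF that] that]
        by (simp add: edge_def M_def T_def qedge_def diff_divide_distrib)
    qed
    have lt: "qedge c (R k) j < qedge c (R k) (J k)" if "j < 5" "j \<noteq> J k" for k j
      using sel[of k] that by (auto simp: selects_def qedge_def divide_strict_right_mono)
    have sel_col: "sel_col m 5 M (\<lambda>r. W (R k) (ty r)) = J k" for k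
    proof (rule sel_col_eqI)
      show "J k < 5" by (rule J)
      show "edge m M (\<lambda>r. W (R k) (ty r)) i \<le> edge m M (\<lambda>r. W (R k) (ty r)) (J k)" if "i < 5" for i
        using lt[OF that] that J6[of k] by (cases "i = J k") (auto simp: edge less_imp_le)
      show "edge m M (\<lambda>r. W (R k) (ty r)) i < edge m M (\<lambda>r. W (R k) (ty r)) (J k)" if "i < J k" for i
        using lt[of i k] that J[of k] by (auto simp: edge)
    qed
    have step: "W (R k) (ty r) / (1 + qedge c (R k) (J k) * M r (J k)) = W (R (Suc k)) (ty r)" if "r < m" for k r
    proof -
      define v q l j where "v = R k" and "q = qf c v" and "l = lf c v (J k)" and "j = J k"
      define q' where "q' = qf c (R (Suc k))"
      have pos: "q > 0" "q' > 0" "l > 0" "v j > 0"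
        using sel[of k] sel[of "Suc k"] R_pos[OF J6[of k], of k]
        by (auto simp: selects_def q_def q'_def l_def v_def j_def)
      have upd: "R (Suc k) = v(j := q / (2 * l) - v j)"
        by (simp add: R_Suc upd_def v_def q_def l_def j_def)
      \<comment> \<open>Consequently the AdaBoost divisor is \<open>q' / q\<close> for rows with
        entry 1 and \<open>4 * (v j * l) / q\<close> for rows with entry -1, and the new entry is
        \<open>q' / (4 * l)\<close>. These three values match the weights before and after the
        step.\<close>
      have q': "q' = 2 * (q - 2 * (v j * l))"
      proof -
        have "q' = q + 2 * ((q / (2 * l) - v j) - v j) * l"
          unfolding q'_def upd q_def l_def j_def
          by (rule qf_upd[of c "J k", OF sym diag[OF J6[of k]] J6[of k]])
        also have "\<dots> = 2 * (q - 2 * (v j * l))" using pos by (simp add: field_simps)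
        finally show ?thesis .
      qed
      have e: "qedge c (R k) (J k) = 1 - 4 * (v j * l) / q"
        by (simp add: qedge_def v_def q_def l_def j_def)
      obtain a b where ab: "ty r = (a, b)" by force
      have abT: "a < 6" "b < 6" "a \<noteq> b"
        using ty[OF that] cn[of a a] diag[of a] by (auto simp: ab T_def N_def)
      have old: "W (R k) (ty r) = (v a / v0 a) * (v b / v0 b) / q"
        by (simp add: W_def ab v_def q_def)
      have Mj: "M r (J k) = (if j = a \<or> j = b then - 1 else 1)"
        by (simp add: M_def sgn2_def ab j_def)
      have new: "W (R (Suc k)) (ty r) = (R (Suc k) a / v0 a) * (R (Suc k) b / v0 b) / q'"
        by (simp add: W_def ab q'_def)
      show ?thesis
      proof (cases "j = a \<or> j = b")
        case False
        have "W (R (Suc k)) (ty r) = (v a / v0 a) * (v b / v0 b) / q'"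
          using False unfolding new by (simp add: upd mult_ac)
        moreover have "1 + qedge c (R k) (J k) * M r (J k) = q' / q"
          using False pos unfolding e Mj q' by (simp add: field_simps)
        ultimately show ?thesis unfolding old using pos by simp
      next
        case True
        have v': "(q / (2 * l) - v j) / q' = v j / (4 * (v j * l))"
        proof -
          have "q / (2 * l) - v j = q' / (4 * l)" unfolding q' using pos by (simp add: field_simps)
          then show ?thesis using pos by simp
        qed
        have "W (R (Suc k)) (ty r) = (v a / v0 a) * (v b / v0 b) / (4 * (v j * l))"
        proof (cases "j = a")
          case True
          then have "W (R (Suc k)) (ty r) = (v b / v0 b / v0 a) * ((q / (2 * l) - v j) / q')"
            using abT(3) unfolding new by (simp add: upd mult_ac)
          then show ?thesis unfolding v' using True by simp
        next
          case False
          then have "W (R (Suc k)) (ty r) = (v a / v0 a / v0 b) * ((q / (2 * l) - v j) / q')"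
            using \<open>j = a \<or> j = b\<close> abT(3) unfolding new by (simp add: upd mult_ac)
          then show ?thesis unfolding v' using False \<open>j = a \<or> j = b\<close> by simp
        qed
        moreover have "1 + qedge c (R k) (J k) * M r (J k) = 4 * (v j * l) / q"
          using True pos unfolding e Mj by (simp add: field_simps)
        ultimately show ?thesis unfolding old using pos by simp
      qed
    qed
    have iter: "ada_iter m 5 M k r = W (R k) (ty r)" if "r < m" for k r
      using that
    proof (induction k arbitrary: r)
      case 0
      have "real m = (\<Sum>x\<in>T. real (N x))" using rows[of "\<lambda>_. 1"] by simp
      also have "\<dots> = qf c v0" unfolding total[symmetric] by (intro sum.cong) (auto simp: N)
      finally have "real m = qf c v0" .
      moreover have "v0 (fst (ty r)) > 0" "v0 (snd (ty r)) > 0"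
        using ty[OF 0] v0_pos by (auto simp: T_def)
      ultimately show ?case by (simp add: W_def R_def)
    next
      case (Suc k)
      have edge_cong: "edge m M (ada_iter m 5 M k) = edge m M (\<lambda>r. W (R k) (ty r))"
        using Suc.IH by (auto simp: edge_def fun_eq_iff)
      have sc: "sel_col m 5 M (ada_iter m 5 M k) = J k"
        using sel_col[of k] unfolding sel_col_def edge_cong .
      then have "top_edge m 5 M (ada_iter m 5 M k) = qedge c (R k) (J k)"
        by (simp add: top_edge_def edge_cong edge J6)
      then show ?case using step[OF Suc.prems, of k] Suc by (simp add: ada_step_apply sc)
    qed
    have top: "top_edge m 5 M (ada_iter m 5 M k) = qedge c (R k) (J k)" for k
    proof -
      have edge_cong: "edge m M (ada_iter m 5 M k) = edge m M (\<lambda>r. W (R k) (ty r))"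
        using iter by (auto simp: edge_def fun_eq_iff)
      have "sel_col m 5 M (ada_iter m 5 M k) = J k"
        using sel_col[of k] unfolding sel_col_def edge_cong .
      then show ?thesis by (simp add: top_edge_def edge_cong edge J6)
    qed
    have "m > 0"
    proof (rule ccontr)
      assume "\<not> m > 0"
      then have "(\<Sum>x\<in>T. real (N x)) = 0" using rows[of "\<lambda>_. 1"] by simp
      then have "real (N (0, 1)) = 0"
        by (subst (asm) sum_nonneg_eq_0_iff) (auto simp: T_def)
      moreover have "real (N (0, 1)) = c 0 1 * v0 0 * v0 1" by (subst N) (auto simp: T_def)
      ultimately show False using pent(1) v0_pos[of 0] v0_pos[of 1] by simp
    qed
    have "\<bar>qedge c (R k) (J k)\<bar> < 1" for k
    proof -
      have "qedge c (R k) (J k) > \<alpha>" using bursts_gt[OF bursts \<eta>(1)] by simp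
      moreover have "qedge c (R k) (J k) < 1"
        using sel[of k] R_pos[OF J6[of k], of k] by (simp add: selects_def qedge_def)
      ultimately show ?thesis using \<alpha> by simp
    qed
    then have reg: "regular_run m 5 M"
      using \<open>m > 0\<close> by (auto simp: regular_run_def top pm1_matrix_def M_def sgn2_def)
    \<comment> \<open>A pentagon: every column lies in exactly two of the five pairs, so its edge
      under equal weights is (3 - 2) / 5.\<close>
    define P :: "(nat \<times> nat) set" where "P = {(0, 1), (1, 2), (2, 3), (3, 4), (4, 0)}"
    have P: "P \<subseteq> T" "finite P" by (auto simp: P_def T_def)
    have NP: "real (N x) > 0" if "x \<in> P" for x
      using that P pent v0_pos unfolding P_def by (subst N) (auto simp: P_def)
    define D where "D r = (if ty r \<in> P then 1 / (5 * real (N (ty r))) else 0)" for r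
    have D: "(\<Sum>r<m. D r * g (ty r)) = (\<Sum>x\<in>P. g x) / 5" for g
    proof -
      have "(\<Sum>r<m. D r * g (ty r)) = (\<Sum>x\<in>T. real (N x) * ((if x \<in> P then 1 / (5 * real (N x)) else 0) * g x))"
        unfolding D_def by (rule rows)
      also have "\<dots> = (\<Sum>x\<in>P. real (N x) * ((if x \<in> P then 1 / (5 * real (N x)) else 0) * g x))"
        using P by (intro sum.mono_neutral_right) (auto simp: T_def)
      also have "\<dots> = (\<Sum>x\<in>P. g x / 5)"
        using NP by (intro sum.cong) auto
      finally show ?thesis by (simp add: sum_divide_distrib)
    qed
    have "D \<in> prob_simplex m"
      using D[of "\<lambda>_. 1"] by (simp add: prob_simplex_def P_def) (auto simp: D_def)
    moreover have "edge m M D j = 1 / 5" if "j < 5" for j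
    proof -
      have "j = 0 \<or> j = 1 \<or> j = 2 \<or> j = 3 \<or> j = 4" using that by linarith
      then show ?thesis
        using D[of "\<lambda>x. sgn2 x j"] by (auto simp: edge_def M_def P_def sgn2_def)
    qed
    ultimately have "\<exists>D\<in>prob_simplex m. \<forall>j<5. edge m M D j = 1 / 5" by blast
    moreover have "\<forall>r<m. 1 \<le> (\<Sum>j<5. M r j)" by (simp add: M_def sum_sgn2_ge)
    ultimately show "\<exists>m M. regular_run m 5 M \<and>
       bursts \<alpha> \<eta> \<kappa> (\<lambda>k. top_edge m 5 M (ada_iter m 5 M k)) \<and>
       (\<forall>r<m. 1 \<le> (\<Sum>j<5. M r j)) \<and> (\<exists>D\<in>prob_simplex m. \<forall>j<5. edge m M D j = 1 / 5)"
      using reg bursts by (intro exI[of _ m] exI[of _ M]) (simp add: top)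
  qed
qed

end

section \<open>Two explicit factors\<close>

lemma sum6:
  fixes f :: "nat \<Rightarrow> real"
  shows "(\<Sum>k<6. f k) = f 0 + f 1 + f 2 + f 3 + f 4 + f 5"
  by (simp add: eval_nat_numeral)

lemma lf6: "lf c v j = c j 0 * v 0 + c j 1 * v 1 + c j 2 * v 2 + c j 3 * v 3 + c j 4 * v 4 + c j 5 * v 5"
  by (simp add: lf_def sum6)

lemma qf6: "qf c v = v 0 * lf c v 0 + v 1 * lf c v 1 + v 2 * lf c v 2 + v 3 * lf c v 3
    + v 4 * lf c v 4 + v 5 * lf c v 5"
  by (simp add: qf_def sum6)

lemma dot66: "dot6 u v = u 0 * v 0 + u 1 * v 1 + u 2 * v 2 + u 3 * v 3 + u 4 * v 4 + u 5 * v 5"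
  by (simp add: dot6_def sum6)

lemma less5E:
  assumes "(k :: nat) < 5"
  obtains "k = 0" | "k = 1" | "k = 2" | "k = 3" | "k = 4"
proof -
  have "k = 0 \<or> k = 1 \<or> k = 2 \<or> k = 3 \<or> k = 4" using assms by linarith
  then show ?thesis using that by blast
qed

lemma less6E:
  assumes "(k :: nat) < 6"
  obtains "k = 0" | "k = 1" | "k = 2" | "k = 3" | "k = 4" | "k = 5"
proof -
  have "k = 0 \<or> k = 1 \<or> k = 2 \<or> k = 3 \<or> k = 4 \<or> k = 5" using assms by linarith
  then show ?thesis using that by blast
qed

lemma less10E:
  assumes "(k :: nat) < 10"
  obtains "k = 0" | "k = 1" | "k = 2" | "k = 3" | "k = 4" | "k = 5" | "k = 6" | "k = 7" | "k = 8" | "k = 9"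
proof -
  have "k = 0 \<or> k = 1 \<or> k = 2 \<or> k = 3 \<or> k = 4 \<or> k = 5 \<or> k = 6 \<or> k = 7 \<or> k = 8 \<or> k = 9" using assms by presburger
  then show ?thesis using that by blast
qed

lemma nth_Cons_one [simp]: "(x # xs) ! 1 = xs ! 0"
  by simp

text \<open>Keeping the index 1 in numeral form lets the simplifier evaluate indexed data uniformly.\<close>

declare One_nat_def [simp del]

text \<open>Matrix of the limiting step; the entry at \<open>k = j\<close> is 0 because the old
  value of the updated coordinate cancels.\<close>

definition coef :: "(nat \<Rightarrow> nat \<Rightarrow> real) \<Rightarrow> (nat \<Rightarrow> real) \<Rightarrow> real \<Rightarrow> nat \<Rightarrow> nat \<Rightarrow> real" where
  "coef c V W j k = (if k = j then 0 else (lf c V k - (V j + W) * c j k) / lf c V j)"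

lemma ystep_0_eq:
  assumes "c j j = 0" "j < 6"
  shows "ystep c V W j 0 z = (\<Sum>k<6. coef c V W j k * z k)"
proof -
  have "(\<Sum>k<6. coef c V W j k * z k)
      = (\<Sum>k<6. (lf c V k * z k - (V j + W) * (c j k * z k) - (if k = j then lf c V j * z j else 0)) / lf c V j)"
    using assms by (intro sum.cong) (auto simp: coef_def diff_divide_distrib left_diff_distrib)
  also have "\<dots> = (dot6 (lf c V) z - (V j + W) * lf c z j - lf c V j * z j) / lf c V j"
    using assms(2) by (simp add: sum_divide_distrib[symmetric] sum_subtractf dot6_def lf_def[of c z]
        sum_distrib_left)
  finally show ?thesis by (simp add: ystep_def algebra_simps)
qed

text \<open>Rounding each of the six coefficients by at most \<epsilon> costs at most
  \<open>\<epsilon> * Z\<close> per coordinate.\<close>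

lemma ystep_approx:
  assumes "\<And>k. k < 6 \<Longrightarrow> \<bar>coef c V W j k - q k\<bar> \<le> \<epsilon>" "\<And>k. k < 6 \<Longrightarrow> \<bar>z k\<bar> \<le> Z"
    "c j j = 0" "j < 6"
  shows "\<bar>ystep c V W j 0 z - (\<Sum>k<6. q k * z k)\<bar> \<le> 6 * (\<epsilon> * Z)"
proof -
  have "ystep c V W j 0 z - (\<Sum>k<6. q k * z k) = (\<Sum>k<6. (coef c V W j k - q k) * z k)"
    by (simp add: ystep_0_eq[of c j V W z, OF assms(3,4)] sum_subtractf left_diff_distrib)
  also have "\<bar>\<dots>\<bar> \<le> (\<Sum>k<6::nat. \<epsilon> * Z)"
  proof (rule order_trans[OF sum_abs], rule sum_mono)
    fix k :: nat assume "k \<in> {..<6}"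
    then show "\<bar>(coef c V W j k - q k) * z k\<bar> \<le> \<epsilon> * Z"
      using assms(1)[of k] assms(2)[of k] unfolding abs_mult by (intro mult_mono) auto
  qed
  finally show ?thesis by simp
qed

text \<open>The ratios of successive entries of \<open>VA\<close> and \<open>VB\<close> are rational solutions of
  \<open>(\<Prod>t<10. 2 * R t / (1 + R t)) = \<kappa> ^ 2\<close>, the condition for a cycle of growth \<open>\<kappa>\<close>; the smallest ratio \<open>21 / 11\<close>
  gives the edge \<open>5 / 16\<close> in both. The weights then span the kernel of the ten linear balance equations.
  The boxes \<open>KA\<close> and \<open>KB\<close> are spanned by approximate eigenvectors of the return map around its
  approximate fixed point. Composing the ten affine steps exactly produces huge fractions, so they are
  composed with rounded coefficients and explicit error bounds.\<close>

definition cnA :: "nat \<Rightarrow> nat \<Rightarrow> nat" where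
  "cnA a b = [[0, 2763591864, 8223372828, 46526640900, 103540295592, 16000000000000],
    [2763591864, 0, 49721568061, 106288516619, 9117109104, 0],
    [8223372828, 49721568061, 0, 20736529632, 119625109800, 0],
    [46526640900, 106288516619, 20736529632, 0, 1977705408, 0],
    [103540295592, 9117109104, 119625109800, 1977705408, 0, 0],
    [16000000000000, 0, 0, 0, 0, 0]] ! a ! b"

definition cA :: "nat \<Rightarrow> nat \<Rightarrow> real" where
  "cA a b = real (cnA a b)"

definition jsA :: "nat \<Rightarrow> nat" where
  "jsA t = [0, 1, 2, 0, 3, 2, 4, 3, 1, 4] ! t"

definition VA :: "nat \<Rightarrow> nat \<Rightarrow> real" where
  "VA t k = (if k < 5 then [[1, 1, 1, 1, 1],
    [21/11, 1, 1, 1, 1],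
    [21/11, 60/23, 1, 1, 1],
    [21/11, 60/23, 19/9, 1, 1],
    [5, 60/23, 19/9, 1, 1],
    [5, 60/23, 19/9, 15/7, 1],
    [5, 60/23, 5, 15/7, 1],
    [5, 60/23, 5, 15/7, 160/83],
    [5, 60/23, 5, 5, 160/83],
    [5, 5, 5, 5, 160/83],
    [5, 5, 5, 5, 5]] ! t ! k else 0)"

text \<open>The direction (1,1,1,1) of \<open>s3\<close> lies in the kernel of the normalised linear
  part: the first step overwrites coordinate 0, so it acts like the direction \<open>V 0\<close>,
  which the cycle multiplies by \<kappa> and the normalisation removes. The centre is integral and
  serves as starting point.\<close>

definition KA :: "(nat \<Rightarrow> real) set" where
  "KA = {y. y 0 = 0 \<and> y 5 = 1 \<and> (\<exists>s1 s2 s3 s4. - 1 \<le> s1 \<and> s1 \<le> 1 \<and> - 1 \<le> s2 \<and> s2 \<le> 1 \<and> - 1 \<le> s3 \<and> s3 \<le> 1 \<and> - 1 \<le> s4 \<and> s4 \<le> 1 \<and>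
    y 1 = 24 * s1 + 21 * s2 + 10 * s3 - 3 * s4 + 593 \<and>
    y 2 = 68 * s1 - 13 * s2 + 10 * s3 + 5 * s4 + 1427 \<and>
    y 3 = 88 * s1 + 4 * s2 + 10 * s3 + 1858 \<and>
    y 4 = 68 * s1 + 19 * s2 + 10 * s3 + 1558)}"

lemmas numA = lf6 qf6 cA_def cnA_def jsA_def VA_def

text \<open>Here 10000 is a crude bound for all intermediate coordinates, and six errors of 10^-9
  times 10^4 add up to 3/50000.\<close>

lemma approxA0:
  assumes "\<And>k. k < 6 \<Longrightarrow> \<bar>z k\<bar> \<le> 10000"
  shows "\<bar>ystep cA (VA 0) (VA 1 0) 0 0 z - ((99253259/100000000) * z 1 + (1082768191/1000000000) * z 2 + (124738253/500000000) * z 3 - (415686377/1000000000) * z 4 - (189659823953/1000000000) * z 5)\<bar> \<le> 3 / 50000"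
proof -
  have "\<bar>coef cA (VA 0) (VA 1 0) 0 k - [0, 99253259/100000000, 1082768191/1000000000, 124738253/500000000, - 415686377/1000000000, - 189659823953/1000000000] ! k\<bar> \<le> 1 / 10 ^ 9" if "k < 6" for k
    using that by (rule less6E) (simp_all add: coef_def numA)
  then have "\<bar>ystep cA (VA 0) (VA 1 0) 0 0 z - (\<Sum>k<6. [0, 99253259/100000000, 1082768191/1000000000, 124738253/500000000, - 415686377/1000000000, - 189659823953/1000000000] ! k * z k)\<bar> \<le> 6 * (1 / 10 ^ 9 * 10000)"
    using assms by (rule ystep_approx) (simp_all add: numA)
  then show ?thesis by (simp add: sum6)
qed

lemma approxA1:
  assumes "\<And>k. k < 6 \<Longrightarrow> \<bar>z k\<bar> \<le> 10000"
  shows "\<bar>ystep cA (VA 1) (VA 2 1) 1 0 z - ((886608883/1000000000) * z 0 + (19330899/125000000) * z 2 - (486307257/500000000) * z 3 + (27094469/15625000) * z 4 + (89627028607/500000000) * z 5)\<bar> \<le> 3 / 50000"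
proof -
  have "\<bar>coef cA (VA 1) (VA 2 1) 1 k - [886608883/1000000000, 0, 19330899/125000000, - 486307257/500000000, 27094469/15625000, 89627028607/500000000] ! k\<bar> \<le> 1 / 10 ^ 9" if "k < 6" for k
    using that by (rule less6E) (simp_all add: coef_def numA)
  then have "\<bar>ystep cA (VA 1) (VA 2 1) 1 0 z - (\<Sum>k<6. [886608883/1000000000, 0, 19330899/125000000, - 486307257/500000000, 27094469/15625000, 89627028607/500000000] ! k * z k)\<bar> \<le> 6 * (1 / 10 ^ 9 * 10000)"
    using assms by (rule ystep_approx) (simp_all add: numA)
  then show ?thesis by (simp add: sum6)
qed

lemma approxA2:
  assumes "\<And>k. k < 6 \<Longrightarrow> \<bar>z k\<bar> \<le> 10000"
  shows "\<bar>ystep cA (VA 2) (VA 3 2) 2 0 z - ((244805653/500000000) * z 0 + (54987789/1000000000) * z 1 + (1134826691/1000000000) * z 3 - (1273431/12500000) * z 4 + (106888530413/1000000000) * z 5)\<bar> \<le> 3 / 50000"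
proof -
  have "\<bar>coef cA (VA 2) (VA 3 2) 2 k - [244805653/500000000, 54987789/1000000000, 0, 1134826691/1000000000, - 1273431/12500000, 106888530413/1000000000] ! k\<bar> \<le> 1 / 10 ^ 9" if "k < 6" for k
    using that by (rule less6E) (simp_all add: coef_def numA)
  then have "\<bar>ystep cA (VA 2) (VA 3 2) 2 0 z - (\<Sum>k<6. [244805653/500000000, 54987789/1000000000, 0, 1134826691/1000000000, - 1273431/12500000, 106888530413/1000000000] ! k * z k)\<bar> \<le> 6 * (1 / 10 ^ 9 * 10000)"
    using assms by (rule ystep_approx) (simp_all add: numA)
  then show ?thesis by (simp add: sum6)
qed

lemma approxA3:
  assumes "\<And>k. k < 6 \<Longrightarrow> \<bar>z k\<bar> \<le> 10000"
  shows "\<bar>ystep cA (VA 3) (VA 4 0) 0 0 z - ((1182771719/1000000000) * z 1 + (262205063/200000000) * z 2 + (517623037/1000000000) * z 3 - (1370834587/1000000000) * z 4 - (458093701769/1000000000) * z 5)\<bar> \<le> 3 / 50000"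
proof -
  have "\<bar>coef cA (VA 3) (VA 4 0) 0 k - [0, 1182771719/1000000000, 262205063/200000000, 517623037/1000000000, - 1370834587/1000000000, - 458093701769/1000000000] ! k\<bar> \<le> 1 / 10 ^ 9" if "k < 6" for k
    using that by (rule less6E) (simp_all add: coef_def numA)
  then have "\<bar>ystep cA (VA 3) (VA 4 0) 0 0 z - (\<Sum>k<6. [0, 1182771719/1000000000, 262205063/200000000, 517623037/1000000000, - 1370834587/1000000000, - 458093701769/1000000000] ! k * z k)\<bar> \<le> 6 * (1 / 10 ^ 9 * 10000)"
    using assms by (rule ystep_approx) (simp_all add: numA)
  then show ?thesis by (simp add: sum6)
qed

lemma approxA4:
  assumes "\<And>k. k < 6 \<Longrightarrow> \<bar>z k\<bar> \<le> 10000"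
  shows "\<bar>ystep cA (VA 4) (VA 5 3) 3 0 z - ((319553/6250000) * z 0 - (179710343/1000000000) * z 1 + (221370911/500000000) * z 2 + (355336789/250000000) * z 4 + (14397230627/100000000) * z 5)\<bar> \<le> 3 / 50000"
proof -
  have "\<bar>coef cA (VA 4) (VA 5 3) 3 k - [319553/6250000, - 179710343/1000000000, 221370911/500000000, 0, 355336789/250000000, 14397230627/100000000] ! k\<bar> \<le> 1 / 10 ^ 9" if "k < 6" for k
    using that by (rule less6E) (simp_all add: coef_def numA)
  then have "\<bar>ystep cA (VA 4) (VA 5 3) 3 0 z - (\<Sum>k<6. [319553/6250000, - 179710343/1000000000, 221370911/500000000, 0, 355336789/250000000, 14397230627/100000000] ! k * z k)\<bar> \<le> 6 * (1 / 10 ^ 9 * 10000)"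
    using assms by (rule ystep_approx) (simp_all add: numA)
  then show ?thesis by (simp add: sum6)
qed

lemma approxA5:
  assumes "\<And>k. k < 6 \<Longrightarrow> \<bar>z k\<bar> \<le> 10000"
  shows "\<bar>ystep cA (VA 5) (VA 6 2) 2 0 z - ((252821603/500000000) * z 0 + (6235961/1000000000) * z 1 + (121893079/100000000) * z 3 - (78239153/500000000) * z 4 + (14930461391/62500000) * z 5)\<bar> \<le> 3 / 50000"
proof -
  have "\<bar>coef cA (VA 5) (VA 6 2) 2 k - [252821603/500000000, 6235961/1000000000, 0, 121893079/100000000, - 78239153/500000000, 14930461391/62500000] ! k\<bar> \<le> 1 / 10 ^ 9" if "k < 6" for k
    using that by (rule less6E) (simp_all add: coef_def numA)
  then have "\<bar>ystep cA (VA 5) (VA 6 2) 2 0 z - (\<Sum>k<6. [252821603/500000000, 6235961/1000000000, 0, 121893079/100000000, - 78239153/500000000, 14930461391/62500000] ! k * z k)\<bar> \<le> 6 * (1 / 10 ^ 9 * 10000)"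
    using assms by (rule ystep_approx) (simp_all add: numA)
  then show ?thesis by (simp add: sum6)
qed

lemma approxA6:
  assumes "\<And>k. k < 6 \<Longrightarrow> \<bar>z k\<bar> \<le> 10000"
  shows "\<bar>ystep cA (VA 6) (VA 7 4) 4 0 z - (- (22542129/500000000) * z 0 + (413176799/1000000000) * z 1 - (3353131/250000000) * z 2 + (533093043/1000000000) * z 3 + (34969658969/500000000) * z 5)\<bar> \<le> 3 / 50000"
proof -
  have "\<bar>coef cA (VA 6) (VA 7 4) 4 k - [- 22542129/500000000, 413176799/1000000000, - 3353131/250000000, 533093043/1000000000, 0, 34969658969/500000000] ! k\<bar> \<le> 1 / 10 ^ 9" if "k < 6" for k
    using that by (rule less6E) (simp_all add: coef_def numA)
  then have "\<bar>ystep cA (VA 6) (VA 7 4) 4 0 z - (\<Sum>k<6. [- 22542129/500000000, 413176799/1000000000, - 3353131/250000000, 533093043/1000000000, 0, 34969658969/500000000] ! k * z k)\<bar> \<le> 6 * (1 / 10 ^ 9 * 10000)"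
    using assms by (rule ystep_approx) (simp_all add: numA)
  then show ?thesis by (simp add: sum6)
qed

lemma approxA7:
  assumes "\<And>k. k < 6 \<Longrightarrow> \<bar>z k\<bar> \<le> 10000"
  shows "\<bar>ystep cA (VA 7) (VA 8 3) 3 0 z - ((24763061/1000000000) * z 0 - (101814277/250000000) * z 1 + (482254583/1000000000) * z 2 + (114362381/62500000) * z 4 + (129575075643/1000000000) * z 5)\<bar> \<le> 3 / 50000"
proof -
  have "\<bar>coef cA (VA 7) (VA 8 3) 3 k - [24763061/1000000000, - 101814277/250000000, 482254583/1000000000, 0, 114362381/62500000, 129575075643/1000000000] ! k\<bar> \<le> 1 / 10 ^ 9" if "k < 6" for k
    using that by (rule less6E) (simp_all add: coef_def numA)
  then have "\<bar>ystep cA (VA 7) (VA 8 3) 3 0 z - (\<Sum>k<6. [24763061/1000000000, - 101814277/250000000, 482254583/1000000000, 0, 114362381/62500000, 129575075643/1000000000] ! k * z k)\<bar> \<le> 6 * (1 / 10 ^ 9 * 10000)"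
    using assms by (rule ystep_approx) (simp_all add: numA)
  then show ?thesis by (simp add: sum6)
qed

lemma approxA8:
  assumes "\<And>k. k < 6 \<Longrightarrow> \<bar>z k\<bar> \<le> 10000"
  shows "\<bar>ystep cA (VA 8) (VA 9 1) 1 0 z - ((35394319/62500000) * z 0 + (39064423/250000000) * z 2 - (235770301/1000000000) * z 3 + (665560797/500000000) * z 4 + (24647432867/250000000) * z 5)\<bar> \<le> 3 / 50000"
proof -
  have "\<bar>coef cA (VA 8) (VA 9 1) 1 k - [35394319/62500000, 0, 39064423/250000000, - 235770301/1000000000, 665560797/500000000, 24647432867/250000000] ! k\<bar> \<le> 1 / 10 ^ 9" if "k < 6" for k
    using that by (rule less6E) (simp_all add: coef_def numA)
  then have "\<bar>ystep cA (VA 8) (VA 9 1) 1 0 z - (\<Sum>k<6. [35394319/62500000, 0, 39064423/250000000, - 235770301/1000000000, 665560797/500000000, 24647432867/250000000] ! k * z k)\<bar> \<le> 6 * (1 / 10 ^ 9 * 10000)"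
    using assms by (rule ystep_approx) (simp_all add: numA)
  then show ?thesis by (simp add: sum6)
qed

lemma approxA9:
  assumes "\<And>k. k < 6 \<Longrightarrow> \<bar>z k\<bar> \<le> 10000"
  shows "\<bar>ystep cA (VA 9) (VA 10 4) 4 0 z - (- (49119191/250000000) * z 0 + (12776951/20000000) * z 1 - (34955691/200000000) * z 2 + (73240767/100000000) * z 3 + (68300115173/1000000000) * z 5)\<bar> \<le> 3 / 50000"
proof -
  have "\<bar>coef cA (VA 9) (VA 10 4) 4 k - [- 49119191/250000000, 12776951/20000000, - 34955691/200000000, 73240767/100000000, 0, 68300115173/1000000000] ! k\<bar> \<le> 1 / 10 ^ 9" if "k < 6" for k
    using that by (rule less6E) (simp_all add: coef_def numA)
  then have "\<bar>ystep cA (VA 9) (VA 10 4) 4 0 z - (\<Sum>k<6. [- 49119191/250000000, 12776951/20000000, - 34955691/200000000, 73240767/100000000, 0, 68300115173/1000000000] ! k * z k)\<bar> \<le> 6 * (1 / 10 ^ 9 * 10000)"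
    using assms by (rule ystep_approx) (simp_all add: numA)
  then show ?thesis by (simp add: sum6)
qed

text \<open>The ten limiting steps are followed as affine functions of the box parameters
  \<open>s1\<close> to \<open>s4\<close>, with interval error. After normalisation the image stays
  in the box even with a further error of 1/100.\<close>

lemma contractA:
  assumes y: "y \<in> KA" and w: "w 0 = 0" "w 5 = 1"
    "\<And>k. k < 6 \<Longrightarrow> \<bar>w k - (yt cA jsA VA 10 0 y k - VA 0 k * yt cA jsA VA 10 0 y 0)\<bar> < 1 / 100"
  shows "w \<in> KA"
proof -
  obtain s1 s2 s3 s4 where y0: "y 0 = 0" "y 5 = 1"
    and s: "- 1 \<le> s1" "s1 \<le> 1" "- 1 \<le> s2" "s2 \<le> 1" "- 1 \<le> s3" "s3 \<le> 1" "- 1 \<le> s4" "s4 \<le> 1"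
    and ys: "y 1 = 24 * s1 + 21 * s2 + 10 * s3 - 3 * s4 + 593"
      "y 2 = 68 * s1 - 13 * s2 + 10 * s3 + 5 * s4 + 1427"
      "y 3 = 88 * s1 + 4 * s2 + 10 * s3 + 1858"
      "y 4 = 68 * s1 + 19 * s2 + 10 * s3 + 1558"
    using y unfolding KA_def by blast
  define z where "z t = yt cA jsA VA t 0 y" for t
  have z_Suc: "z (Suc t) = (z t)(jsA t := ystep cA (VA t) (VA (Suc t) (jsA t)) (jsA t) 0 (z t))" for t
    by (simp add: z_def)
  have v0: "z 0 0 = 0" "z 0 1 = y 1" "z 0 2 = y 2" "z 0 3 = y 3" "z 0 4 = y 4" "z 0 5 = 1"
    using y0 by (simp_all add: z_def)
  have yb: "- 10000 \<le> y 1" "y 1 \<le> 10000"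
    "- 10000 \<le> y 2" "y 2 \<le> 10000"
    "- 10000 \<le> y 3" "y 3 \<le> 10000"
    "- 10000 \<le> y 4" "y 4 \<le> 10000"
    using ys s by linarith+
  have b0: "\<bar>z 0 k\<bar> \<le> 10000" if "k < 6" for k
    using that by (rule less6E) (use yb in \<open>simp_all add: v0 abs_le_iff\<close>)
  define u0 where "u0 = ystep cA (VA 0) (VA 1 0) 0 0 (z 0)"
  have "\<bar>u0 - ((99253259/100000000) * y 1 + (1082768191/1000000000) * y 2 + (124738253/500000000) * y 3 - (415686377/1000000000) * y 4 - 189659823953/1000000000)\<bar> \<le> 3 / 50000"
    using approxA0[of "z 0", OF b0] by (simp add: u0_def v0)
  \<comment> \<open>The coefficients of \<open>s1\<close> to \<open>s4\<close> are rounded to four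
    decimals; as each parameter is at most 1 in absolute value, this rounding goes into the
    constants.\<close>
  then have e0: "u0 \<le> (911363/10000) * s1 - (1329/10000) * s2 + (190909/10000) * s3 + (12181/5000) * s4 + 1759910389/1000000"
    "(911363/10000) * s1 - (1329/10000) * s2 + (190909/10000) * s3 + (12181/5000) * s4 + 1759910011/1000000 \<le> u0"
    using ys s unfolding abs_le_iff by linarith+
  have ub0: "- 10000 \<le> u0" "u0 \<le> 10000"
    using e0 s by linarith+
  have z1: "z 1 = (z 0)(0 := u0)"
    using z_Suc[of 0] by (simp add: jsA_def u0_def One_nat_def)
  have v1: "z 1 0 = u0" "z 1 1 = y 1" "z 1 2 = y 2" "z 1 3 = y 3" "z 1 4 = y 4" "z 1 5 = 1"
    by (simp_all add: z1 v0)
  have b1: "\<bar>z 1 k\<bar> \<le> 10000" if "k < 6" for k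
    using that by (rule less6E) (use yb ub0 in \<open>simp_all add: v1 abs_le_iff\<close>)
  define u1 where "u1 = ystep cA (VA 1) (VA 2 1) 1 0 (z 1)"
  have "\<bar>u1 - ((886608883/1000000000) * u0 + (19330899/125000000) * y 2 - (486307257/500000000) * y 3 + (27094469/15625000) * y 4 + 89627028607/500000000)\<bar> \<le> 3 / 50000"
    using approxA1[of "z 1", OF b1] by (simp add: u1_def v1)
  then have e1: "u1 \<le> (1236433/10000) * s1 + (134641/5000) * s2 + (260869/10000) * s3 + (7333/2500) * s4 + 713703467/250000"
    "(1236433/10000) * s1 + (134641/5000) * s2 + (260869/10000) * s3 + (7333/2500) * s4 + 713703283/250000 \<le> u1"
    using ys e0 s unfolding abs_le_iff by linarith+
  have ub1: "- 10000 \<le> u1" "u1 \<le> 10000"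
    using e1 s by linarith+
  have z2: "z 2 = (z 1)(1 := u1)"
    using z_Suc[of 1] by (simp add: jsA_def u1_def)
  have v2: "z 2 0 = u0" "z 2 1 = u1" "z 2 2 = y 2" "z 2 3 = y 3" "z 2 4 = y 4" "z 2 5 = 1"
    by (simp_all add: z2 v1)
  have b2: "\<bar>z 2 k\<bar> \<le> 10000" if "k < 6" for k
    using that by (rule less6E) (use yb ub0 ub1 in \<open>simp_all add: v2 abs_le_iff\<close>)
  define u2 where "u2 = ystep cA (VA 2) (VA 3 2) 2 0 (z 2)"
  have "\<bar>u2 - ((244805653/500000000) * u0 + (54987789/1000000000) * u1 + (1134826691/1000000000) * y 3 - (1273431/12500000) * y 4 + 106888530413/1000000000)\<bar> \<le> 3 / 50000"
    using approxA2[of "z 2", OF b2] by (simp add: u2_def v2)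
  then have e2: "u2 \<le> (57743/400) * s1 + (40193/10000) * s2 + (211111/10000) * s3 + (13541/10000) * s4 + 1537664081/500000"
    "(57743/400) * s1 + (40193/10000) * s2 + (211111/10000) * s3 + (13541/10000) * s4 + 1537663819/500000 \<le> u2"
    using ys e0 e1 s unfolding abs_le_iff by linarith+
  have ub2: "- 10000 \<le> u2" "u2 \<le> 10000"
    using e2 s by linarith+
  have z3: "z 3 = (z 2)(2 := u2)"
    using z_Suc[of 2] by (simp add: jsA_def u2_def)
  have v3: "z 3 0 = u0" "z 3 1 = u1" "z 3 2 = u2" "z 3 3 = y 3" "z 3 4 = y 4" "z 3 5 = 1"
    by (simp_all add: z3 v2)
  have b3: "\<bar>z 3 k\<bar> \<le> 10000" if "k < 6" for k
    using that by (rule less6E) (use yb ub0 ub1 ub2 in \<open>simp_all add: v3 abs_le_iff\<close>)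
  define u3 where "u3 = ystep cA (VA 3) (VA 4 0) 0 0 (z 3)"
  have "\<bar>u3 - ((1182771719/1000000000) * u1 + (262205063/200000000) * u2 + (517623037/1000000000) * y 3 - (1370834587/1000000000) * y 4 - 458093701769/1000000000)\<bar> \<le> 3 / 50000"
    using approxA3[of "z 3", OF b3] by (simp add: u3_def v3)
  then have e3: "u3 \<le> (1439161/5000) * s1 + (1643/125) * s2 + (499999/10000) * s3 + (26223/5000) * s4 + 1155263193/200000"
    "(1439161/5000) * s1 + (1643/125) * s2 + (499999/10000) * s3 + (26223/5000) * s4 + 1155262807/200000 \<le> u3"
    using ys e1 e2 s unfolding abs_le_iff by linarith+
  have ub3: "- 10000 \<le> u3" "u3 \<le> 10000"
    using e3 s by linarith+
  have z4: "z 4 = (z 3)(0 := u3)"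
    using z_Suc[of 3] by (simp add: jsA_def u3_def)
  have v4: "z 4 0 = u3" "z 4 1 = u1" "z 4 2 = u2" "z 4 3 = y 3" "z 4 4 = y 4" "z 4 5 = 1"
    by (simp_all add: z4 v3)
  have b4: "\<bar>z 4 k\<bar> \<le> 10000" if "k < 6" for k
    using that by (rule less6E) (use yb ub3 ub1 ub2 in \<open>simp_all add: v4 abs_le_iff\<close>)
  define u4 where "u4 = ystep cA (VA 4) (VA 5 3) 3 0 (z 4)"
  have "\<bar>u4 - ((319553/6250000) * u3 - (179710343/1000000000) * u1 + (221370911/500000000) * u2 + (355336789/250000000) * y 4 + 14397230627/100000000)\<bar> \<le> 3 / 50000"
    using approxA4[of "z 4", OF b4] by (simp add: u4_def v4)
  then have e4: "u4 \<le> (382653/2500) * s1 + (246179/10000) * s2 + (107143/5000) * s3 + (681/2000) * s4 + 875575647/250000"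
    "(382653/2500) * s1 + (246179/10000) * s2 + (107143/5000) * s3 + (681/2000) * s4 + 875575403/250000 \<le> u4"
    using ys e3 e1 e2 s unfolding abs_le_iff by linarith+
  have ub4: "- 10000 \<le> u4" "u4 \<le> 10000"
    using e4 s by linarith+
  have z5: "z 5 = (z 4)(3 := u4)"
    using z_Suc[of 4] by (simp add: jsA_def u4_def)
  have v5: "z 5 0 = u3" "z 5 1 = u1" "z 5 2 = u2" "z 5 3 = u4" "z 5 4 = y 4" "z 5 5 = 1"
    by (simp_all add: z5 v4)
  have b5: "\<bar>z 5 k\<bar> \<le> 10000" if "k < 6" for k
    using that by (rule less6E) (use yb ub3 ub1 ub2 ub4 in \<open>simp_all add: v5 abs_le_iff\<close>)
  define u5 where "u5 = ystep cA (VA 5) (VA 6 2) 2 0 (z 5)"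
  have "\<bar>u5 - ((252821603/500000000) * u3 + (6235961/1000000000) * u1 + (121893079/100000000) * u4 - (78239153/500000000) * y 4 + 14930461391/62500000)\<bar> \<le> 3 / 50000"
    using approxA5[of "z 5", OF b5] by (simp add: u5_def v5)
  then have e5: "u5 \<le> (3222419/10000) * s1 + (67697/2000) * s2 + 50 * s3 + (7713/2500) * s4 + 7202716249/1000000"
    "(3222419/10000) * s1 + (67697/2000) * s2 + 50 * s3 + (7713/2500) * s4 + 7202713751/1000000 \<le> u5"
    using ys e3 e1 e4 s unfolding abs_le_iff by linarith+
  have ub5: "- 10000 \<le> u5" "u5 \<le> 10000"
    using e5 s by linarith+
  have z6: "z 6 = (z 5)(2 := u5)"
    using z_Suc[of 5] by (simp add: jsA_def u5_def)
  have v6: "z 6 0 = u3" "z 6 1 = u1" "z 6 2 = u5" "z 6 3 = u4" "z 6 4 = y 4" "z 6 5 = 1"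
    by (simp_all add: z6 v5)
  have b6: "\<bar>z 6 k\<bar> \<le> 10000" if "k < 6" for k
    using that by (rule less6E) (use yb ub3 ub1 ub5 ub4 in \<open>simp_all add: v6 abs_le_iff\<close>)
  define u6 where "u6 = ystep cA (VA 6) (VA 7 4) 4 0 (z 6)"
  have "\<bar>u6 - (- (22542129/500000000) * u3 + (413176799/1000000000) * u1 - (3353131/250000000) * u5 + (533093043/1000000000) * u4 + 34969658969/500000000)\<bar> \<le> 3 / 50000"
    using approxA6[of "z 6", OF b6] by (simp add: u6_def v6)
  then have e6: "u6 \<le> (288459/2500) * s1 + (14502/625) * s2 + (192771/10000) * s3 + (2789/2500) * s4 + 2759508067/1000000"
    "(288459/2500) * s1 + (14502/625) * s2 + (192771/10000) * s3 + (2789/2500) * s4 + 2759506733/1000000 \<le> u6"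
    using e3 e1 e5 e4 s unfolding abs_le_iff by linarith+
  have ub6: "- 10000 \<le> u6" "u6 \<le> 10000"
    using e6 s by linarith+
  have z7: "z 7 = (z 6)(4 := u6)"
    using z_Suc[of 6] by (simp add: jsA_def u6_def)
  have v7: "z 7 0 = u3" "z 7 1 = u1" "z 7 2 = u5" "z 7 3 = u4" "z 7 4 = u6" "z 7 5 = 1"
    by (simp_all add: z7 v6)
  have b7: "\<bar>z 7 k\<bar> \<le> 10000" if "k < 6" for k
    using that by (rule less6E) (use yb ub3 ub1 ub5 ub4 ub6 in \<open>simp_all add: v7 abs_le_iff\<close>)
  define u7 where "u7 = ystep cA (VA 7) (VA 8 3) 3 0 (z 7)"
  have "\<bar>u7 - ((24763061/1000000000) * u3 - (101814277/250000000) * u1 + (482254583/1000000000) * u5 + (114362381/62500000) * u6 + 129575075643/1000000000)\<bar> \<le> 3 / 50000"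
    using approxA7[of "z 7", OF b7] by (simp add: u7_def v7)
  then have e7: "u7 \<le> (3233043/10000) * s1 + (120349/2500) * s2 + 50 * s3 + (4929/2000) * s4 + 7632857081/1000000"
    "(3233043/10000) * s1 + (120349/2500) * s2 + 50 * s3 + (4929/2000) * s4 + 7632852719/1000000 \<le> u7"
    using e3 e1 e5 e6 s unfolding abs_le_iff by linarith+
  have ub7: "- 10000 \<le> u7" "u7 \<le> 10000"
    using e7 s by linarith+
  have z8: "z 8 = (z 7)(3 := u7)"
    using z_Suc[of 7] by (simp add: jsA_def u7_def)
  have v8: "z 8 0 = u3" "z 8 1 = u1" "z 8 2 = u5" "z 8 3 = u7" "z 8 4 = u6" "z 8 5 = 1"
    by (simp_all add: z8 v7)
  have b8: "\<bar>z 8 k\<bar> \<le> 10000" if "k < 6" for k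
    using that by (rule less6E) (use yb ub3 ub1 ub5 ub7 ub6 in \<open>simp_all add: v8 abs_le_iff\<close>)
  define u8 where "u8 = ystep cA (VA 8) (VA 9 1) 1 0 (z 8)"
  have "\<bar>u8 - ((35394319/62500000) * u3 + (39064423/250000000) * u5 - (235770301/1000000000) * u7 + (665560797/500000000) * u6 + 24647432867/250000000)\<bar> \<le> 3 / 50000"
    using approxA8[of "z 8", OF b8] by (simp add: u8_def v8)
  then have e8: "u8 \<le> (726797/2500) * s1 + (32269/1000) * s2 + (499999/10000) * s3 + (43561/10000) * s4 + 1592222707/250000"
    "(726797/2500) * s1 + (32269/1000) * s2 + (499999/10000) * s3 + (43561/10000) * s4 + 1592221543/250000 \<le> u8"
    using e3 e5 e7 e6 s unfolding abs_le_iff by linarith+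
  have ub8: "- 10000 \<le> u8" "u8 \<le> 10000"
    using e8 s by linarith+
  have z9: "z 9 = (z 8)(1 := u8)"
    using z_Suc[of 8] by (simp add: jsA_def u8_def)
  have v9: "z 9 0 = u3" "z 9 1 = u8" "z 9 2 = u5" "z 9 3 = u7" "z 9 4 = u6" "z 9 5 = 1"
    by (simp_all add: z9 v8)
  have b9: "\<bar>z 9 k\<bar> \<le> 10000" if "k < 6" for k
    using that by (rule less6E) (use yb ub3 ub8 ub5 ub7 ub6 in \<open>simp_all add: v9 abs_le_iff\<close>)
  define u9 where "u9 = ystep cA (VA 9) (VA 10 4) 4 0 (z 9)"
  have "\<bar>u9 - (- (49119191/250000000) * u3 + (12776951/20000000) * u8 - (34955691/200000000) * u5 + (73240767/100000000) * u7 + 68300115173/1000000000)\<bar> \<le> 3 / 50000"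
    using approxA9[of "z 9", OF b9] by (simp add: u9_def v9)
  then have e9: "u9 \<le> (3096423/10000) * s1 + (473743/10000) * s2 + 50 * s3 + (15091/5000) * s4 + 3666811499/500000"
    "(3096423/10000) * s1 + (473743/10000) * s2 + 50 * s3 + (15091/5000) * s4 + 3666807801/500000 \<le> u9"
    using e3 e8 e5 e7 s unfolding abs_le_iff by linarith+
  have ub9: "- 10000 \<le> u9" "u9 \<le> 10000"
    using e9 s by linarith+
  have z10: "z 10 = (z 9)(4 := u9)"
    using z_Suc[of 9] by (simp add: jsA_def u9_def)
  have v10: "z 10 0 = u3" "z 10 1 = u8" "z 10 2 = u5" "z 10 3 = u7" "z 10 4 = u9" "z 10 5 = 1"
    by (simp_all add: z10 v9)
  have "\<bar>w 1 - (u8 - u3)\<bar> < 1 / 100" "\<bar>w 2 - (u5 - u3)\<bar> < 1 / 100" "\<bar>w 3 - (u7 - u3)\<bar> < 1 / 100" "\<bar>w 4 - (u9 - u3)\<bar> < 1 / 100"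
    using w(3)[of 1] w(3)[of 2] w(3)[of 3] w(3)[of 4] unfolding z_def[symmetric] v10
    by (simp_all add: VA_def)
  then have wk: "w 1 \<le> u8 - u3 + 1 / 100" "u8 - u3 - 1 / 100 \<le> w 1"
    "w 2 \<le> u5 - u3 + 1 / 100" "u5 - u3 - 1 / 100 \<le> w 2"
    "w 3 \<le> u7 - u3 + 1 / 100" "u7 - u3 - 1 / 100 \<le> w 3"
    "w 4 \<le> u9 - u3 + 1 / 100" "u9 - u3 - 1 / 100 \<le> w 4"
    unfolding abs_less_iff by linarith+
  \<comment> \<open>Box coordinates of \<open>w\<close>, obtained by inverting the 4 by 4 system
    that defines \<open>KA\<close>.\<close>
  define r1 where "r1 = - (15/1004) * w 1 - (9/1004) * w 2 + (43/2510) * w 3 + (17/2510) * w 4 - 10407/502"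
  define r2 where "r2 = - (5/251) * w 1 - (3/251) * w 2 - (11/251) * w 3 + (19/251) * w 4 - 1918/251"
  define r3 where "r3 = (35/251) * w 1 + (21/251) * w 2 - (417/12550) * w 3 - (564/6275) * w 4 - 389/1255"
  define r4 where "r4 = - (32/251) * w 1 + (31/251) * w 2 - (352/1255) * w 3 + (357/1255) * w 4 - 5699/251"
  have "- 1 \<le> r1" "r1 \<le> 1" "- 1 \<le> r2" "r2 \<le> 1" "- 1 \<le> r3" "r3 \<le> 1" "- 1 \<le> r4" "r4 \<le> 1"
    using wk e3 e8 e5 e7 e9 s unfolding r1_def r2_def r3_def r4_def by linarith+
  moreover have "w 1 = 24 * r1 + 21 * r2 + 10 * r3 - 3 * r4 + 593"
    "w 2 = 68 * r1 - 13 * r2 + 10 * r3 + 5 * r4 + 1427"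
    "w 3 = 88 * r1 + 4 * r2 + 10 * r3 + 1858"
    "w 4 = 68 * r1 + 19 * r2 + 10 * r3 + 1558"
    unfolding r1_def r2_def r3_def r4_def by (simp_all add: field_simps)
  ultimately show ?thesis unfolding KA_def using w(1,2) by blast
qed

text \<open>The form is affine on the box, its constant coming from the row with a single entry -1;
  it is positive there by a wide margin and 1 is just a convenient lower bound.\<close>

lemma driftA:
  assumes "y \<in> KA"
  shows "1 \<le> 2 * (1 - 5 / 16) * dot6 (lf cA (VA 0)) y
    - 4 * (y (jsA 0) * lf cA (VA 0) (jsA 0) + VA 0 (jsA 0) * lf cA y (jsA 0))" (is "_ \<le> ?d")
proof -
  obtain s1 s2 s3 s4 where y0: "y 0 = 0" "y 5 = 1"
    and s: "- 1 \<le> s1" "s1 \<le> 1" "- 1 \<le> s2" "s2 \<le> 1" "- 1 \<le> s3" "s3 \<le> 1" "- 1 \<le> s4" "s4 \<le> 1"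
    and ys: "y 1 = 24 * s1 + 21 * s2 + 10 * s3 - 3 * s4 + 593"
      "y 2 = 68 * s1 - 13 * s2 + 10 * s3 + 5 * s4 + 1427"
      "y 3 = 88 * s1 + 4 * s2 + 10 * s3 + 1858"
      "y 4 = 68 * s1 + 19 * s2 + 10 * s3 + 1558"
    using assms unfolding KA_def by blast
  have "?d = 219795462810 * y 1 + (1918224453035/8) * y 2 + (441970809349/8) * y 3 - 92053380000 * y 4 - 42000000000000"
    by (simp add: numA dot66 y0 field_simps)
  then show ?thesis using ys s by linarith
qed

interpretation A: quad_cycle cA jsA VA "5" "5 / 16" KA
proof
  show "cA j k = cA k j" if "j < 6" "k < 6" for j k
    using that by (elim less6E) (simp_all add: numA)
  show "jsA t < 5" if "t < 10" for t
    using that by (elim less10E) (simp_all add: numA)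
  show "VA 0 k = (if k < 5 then 1 else 0)" for k
    by (cases "k < 5") (auto elim!: less5E simp: numA)
  show "VA 10 k = 5 * VA 0 k" for k
    by (cases "k < 5") (auto elim!: less5E simp: numA)
  show "VA (Suc t) = (VA t)(jsA t := VA (Suc t) (jsA t))" if "t < 10" for t
  proof
    fix k show "VA (Suc t) k = ((VA t)(jsA t := VA (Suc t) (jsA t))) k"
    proof (cases "k < 5")
      case True
      then show ?thesis using that by (elim less5E less10E) (simp_all add: numA)
    next
      case False
      then show ?thesis using that by (elim less10E) (simp_all add: numA)
    qed
  qed
  show "0 < VA t k" if "t \<le> 10" "k < 5" for t k
  proof -
    have "t < 10 \<or> t = 10" using that by linarith
    then show ?thesis using that(2) by (elim disjE less5E less10E) (simp_all add: numA)
  qed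
  show "qf cA (VA t) = 2 * (VA t (jsA t) + VA (Suc t) (jsA t)) * lf cA (VA t) (jsA t)" if "t < 10" for t
    using that by (elim less10E) (simp_all add: numA)
  show "0 < lf cA (VA t) (jsA t)" if "t < 10" for t
    using that by (elim less10E) (simp_all add: numA)
  show "VA t (jsA t) * lf cA (VA t) (jsA t) < VA t k * lf cA (VA t) k"
    if "t < 10" "k < 5" "k \<noteq> jsA t" for t k
    using that by (elim less10E less5E) (simp_all add: numA)
  show "VA (Suc 0) (jsA 0) - VA 0 (jsA 0) = 5 / 16 * (VA (Suc 0) (jsA 0) + VA 0 (jsA 0))"
    by (simp add: numA)
  show "VA (Suc t) (jsA t) - VA t (jsA t) > 5 / 16 * (VA (Suc t) (jsA t) + VA t (jsA t))"
    if "0 < t" "t < 10" for t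
    using that by (elim less10E) (simp_all add: numA)
  show "(1 :: real) < 5" by simp
  show "y 0 = 0" "y 5 = 1" if "y \<in> KA" for y
    using that unfolding KA_def by blast+
  show "\<exists>b. \<forall>y\<in>KA. \<forall>k<6. \<bar>y k\<bar> \<le> b"
  proof (intro exI[of _ 10000] ballI allI impI)
    fix y and k :: nat assume "y \<in> KA" "k < 6"
    then obtain s1 s2 s3 s4 where y0: "y 0 = 0" "y 5 = 1"
      and s: "- 1 \<le> s1" "s1 \<le> 1" "- 1 \<le> s2" "s2 \<le> 1" "- 1 \<le> s3" "s3 \<le> 1" "- 1 \<le> s4" "s4 \<le> 1"
      and ys: "y 1 = 24 * s1 + 21 * s2 + 10 * s3 - 3 * s4 + 593"
        "y 2 = 68 * s1 - 13 * s2 + 10 * s3 + 5 * s4 + 1427"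
        "y 3 = 88 * s1 + 4 * s2 + 10 * s3 + 1858"
        "y 4 = 68 * s1 + 19 * s2 + 10 * s3 + 1558"
      unfolding KA_def by blast
    have "- 10000 \<le> y 1" "y 1 \<le> 10000" "- 10000 \<le> y 2" "y 2 \<le> 10000" "- 10000 \<le> y 3" "y 3 \<le> 10000" "- 10000 \<le> y 4" "y 4 \<le> 10000"
      using ys s by linarith+
    then show "\<bar>y k\<bar> \<le> 10000" using \<open>k < 6\<close> by (elim less6E) (simp_all add: y0 abs_le_iff)
  qed
  show "\<exists>\<delta>>0. \<forall>y\<in>KA. \<forall>w. w 0 = 0 \<longrightarrow> w 5 = 1 \<longrightarrow>
      (\<forall>k<6. \<bar>w k - (yt cA jsA VA 10 0 y k - VA 0 k * yt cA jsA VA 10 0 y 0)\<bar> < \<delta>) \<longrightarrow> w \<in> KA"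
    by (intro exI[of _ "1 / 100"] conjI ballI allI impI) (simp, rule contractA, auto)
  show "\<exists>d>0. \<forall>y\<in>KA. d \<le> 2 * (1 - 5 / 16) * dot6 (lf cA (VA 0)) y
      - 4 * (y (jsA 0) * lf cA (VA 0) (jsA 0) + VA 0 (jsA 0) * lf cA y (jsA 0))"
    using driftA by (intro exI[of _ 1]) auto
qed

definition yiA :: "nat \<Rightarrow> int" where
  "yiA k = [0, 593, 1427, 1858, 1558, 1] ! k"

lemma matrixA:
  obtains \<eta>0 where "\<eta>0 > 0"
    "\<forall>\<eta>. 0 < \<eta> \<longrightarrow> \<eta> \<le> \<eta>0 \<longrightarrow> (\<exists>m M. regular_run m 5 M \<and>
       bursts (5 / 16) \<eta> (5) (\<lambda>k. top_edge m 5 M (ada_iter m 5 M k)) \<and>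
       (\<forall>r<m. 1 \<le> (\<Sum>j<5. M r j)) \<and> (\<exists>D\<in>prob_simplex m. \<forall>j<5. edge m M D j = 1 / 5))"
proof (rule A.matrix_exists)
  show "cA a b = real (cnA a b)" for a b by (simp add: cA_def)
  show "cA a a = 0" if "a < 6" for a using that by (elim less6E) (simp_all add: numA)
  show "0 < cA 0 1" "0 < cA 1 2" "0 < cA 2 3" "0 < cA 3 4" "0 < cA 4 0" by (simp_all add: numA)
  show "(\<lambda>k. real_of_int (yiA k)) \<in> KA"
    unfolding KA_def mem_Collect_eq by (intro conjI exI[of _ "0 :: real"]) (simp_all add: yiA_def)
  show "real_of_int (yiA k) = real_of_int (yiA k)" for k ..
qed simp_all

section \<open>The second factor, with growth factor 56/11\<close>

definition cnB :: "nat \<Rightarrow> nat \<Rightarrow> nat" where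
  "cnB a b = [[0, 1057811147822, 6415527252684, 735536885421, 15685065942923, 2400000000000000],
    [1057811147822, 0, 4989965937066, 9136491638625, 11223508367877, 0],
    [6415527252684, 4989965937066, 0, 12419490743982, 2052113019600, 0],
    [735536885421, 9136491638625, 12419490743982, 0, 5794136275200, 0],
    [15685065942923, 11223508367877, 2052113019600, 5794136275200, 0, 0],
    [2400000000000000, 0, 0, 0, 0, 0]] ! a ! b"

definition cB :: "nat \<Rightarrow> nat \<Rightarrow> real" where
  "cB a b = real (cnB a b)"

definition jsB :: "nat \<Rightarrow> nat" where
  "jsB t = [0, 1, 2, 3, 0, 1, 4, 3, 2, 4] ! t"

definition VB :: "nat \<Rightarrow> nat \<Rightarrow> real" where
  "VB t k = (if k < 5 then [[1, 1, 1, 1, 1],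
    [21/11, 1, 1, 1, 1],
    [21/11, 7/3, 1, 1, 1],
    [21/11, 7/3, 1768/759, 1, 1],
    [21/11, 7/3, 1768/759, 19/9, 1],
    [56/11, 7/3, 1768/759, 19/9, 1],
    [56/11, 56/11, 1768/759, 19/9, 1],
    [56/11, 56/11, 1768/759, 19/9, 589/275],
    [56/11, 56/11, 1768/759, 56/11, 589/275],
    [56/11, 56/11, 56/11, 56/11, 589/275],
    [56/11, 56/11, 56/11, 56/11, 56/11]] ! t ! k else 0)"

definition KB :: "(nat \<Rightarrow> real) set" where
  "KB = {y. y 0 = 0 \<and> y 5 = 1 \<and> (\<exists>s1 s2 s3 s4. - 1 \<le> s1 \<and> s1 \<le> 1 \<and> - 1 \<le> s2 \<and> s2 \<le> 1 \<and> - 1 \<le> s3 \<and> s3 \<le> 1 \<and> - 1 \<le> s4 \<and> s4 \<le> 1 \<and>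
    y 1 = 20 * s1 + 40 * s2 + 20 * s3 + 6 * s4 + 1192 \<and>
    y 2 = 13 * s1 + 44 * s2 + 20 * s3 - 7 * s4 + 1448 \<and>
    y 3 = 4 * s1 + 25 * s2 + 20 * s3 + 26 * s4 + 920 \<and>
    y 4 = 12 * s1 + 44 * s2 + 20 * s3 + 9 * s4 + 1549)}"

lemmas numB = lf6 qf6 cB_def cnB_def jsB_def VB_def

lemma approxB0:
  assumes "\<And>k. k < 6 \<Longrightarrow> \<bar>z k\<bar> \<le> 10000"
  shows "\<bar>ystep cB (VB 0) (VB 1 0) 0 0 z - ((976419423/1000000000) * z 1 + (301906867/1000000000) * z 2 + (1085878283/1000000000) * z 3 - (7111151/15625000) * z 4 - (191756484957/1000000000) * z 5)\<bar> \<le> 3 / 50000"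
proof -
  have "\<bar>coef cB (VB 0) (VB 1 0) 0 k - [0, 976419423/1000000000, 301906867/1000000000, 1085878283/1000000000, - 7111151/15625000, - 191756484957/1000000000] ! k\<bar> \<le> 1 / 10 ^ 9" if "k < 6" for k
    using that by (rule less6E) (simp_all add: coef_def numB)
  then have "\<bar>ystep cB (VB 0) (VB 1 0) 0 0 z - (\<Sum>k<6. [0, 976419423/1000000000, 301906867/1000000000, 1085878283/1000000000, - 7111151/15625000, - 191756484957/1000000000] ! k * z k)\<bar> \<le> 6 * (1 / 10 ^ 9 * 10000)"
    using assms by (rule ystep_approx) (simp_all add: numB)
  then show ?thesis by (simp add: sum6)
qed

lemma approxB1:
  assumes "\<And>k. k < 6 \<Longrightarrow> \<bar>z k\<bar> \<le> 10000"
  shows "\<bar>ystep cB (VB 1) (VB 2 1) 1 0 z - ((744184619/1000000000) * z 0 + (11016801/20000000) * z 2 - (31068369/500000000) * z 3 + (42391393/100000000) * z 4 + (167406455121/1000000000) * z 5)\<bar> \<le> 3 / 50000"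
proof -
  have "\<bar>coef cB (VB 1) (VB 2 1) 1 k - [744184619/1000000000, 0, 11016801/20000000, - 31068369/500000000, 42391393/100000000, 167406455121/1000000000] ! k\<bar> \<le> 1 / 10 ^ 9" if "k < 6" for k
    using that by (rule less6E) (simp_all add: coef_def numB)
  then have "\<bar>ystep cB (VB 1) (VB 2 1) 1 0 z - (\<Sum>k<6. [744184619/1000000000, 0, 11016801/20000000, - 31068369/500000000, 42391393/100000000, 167406455121/1000000000] ! k * z k)\<bar> \<le> 6 * (1 / 10 ^ 9 * 10000)"
    using assms by (rule ystep_approx) (simp_all add: numB)
  then show ?thesis by (simp add: sum6)
qed

lemma approxB2:
  assumes "\<And>k. k < 6 \<Longrightarrow> \<bar>z k\<bar> \<le> 10000"
  shows "\<bar>ystep cB (VB 2) (VB 3 2) 2 0 z - ((20564897/200000000) * z 0 + (280374737/1000000000) * z 1 - (2152609/200000000) * z 3 + (3724087/2500000) * z 4 + (59717124801/500000000) * z 5)\<bar> \<le> 3 / 50000"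
proof -
  have "\<bar>coef cB (VB 2) (VB 3 2) 2 k - [20564897/200000000, 280374737/1000000000, 0, - 2152609/200000000, 3724087/2500000, 59717124801/500000000] ! k\<bar> \<le> 1 / 10 ^ 9" if "k < 6" for k
    using that by (rule less6E) (simp_all add: coef_def numB)
  then have "\<bar>ystep cB (VB 2) (VB 3 2) 2 0 z - (\<Sum>k<6. [20564897/200000000, 280374737/1000000000, 0, - 2152609/200000000, 3724087/2500000, 59717124801/500000000] ! k * z k)\<bar> \<le> 6 * (1 / 10 ^ 9 * 10000)"
    using assms by (rule ystep_approx) (simp_all add: numB)
  then show ?thesis by (simp add: sum6)
qed

lemma approxB3:
  assumes "\<And>k. k < 6 \<Longrightarrow> \<bar>z k\<bar> \<le> 10000"
  shows "\<bar>ystep cB (VB 3) (VB 4 3) 3 0 z - ((549113909/1000000000) * z 0 + (48552507/500000000) * z 1 - (4799823/1000000000) * z 2 + (847404991/1000000000) * z 4 + (15951587937/200000000) * z 5)\<bar> \<le> 3 / 50000"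
proof -
  have "\<bar>coef cB (VB 3) (VB 4 3) 3 k - [549113909/1000000000, 48552507/500000000, - 4799823/1000000000, 0, 847404991/1000000000, 15951587937/200000000] ! k\<bar> \<le> 1 / 10 ^ 9" if "k < 6" for k
    using that by (rule less6E) (simp_all add: coef_def numB)
  then have "\<bar>ystep cB (VB 3) (VB 4 3) 3 0 z - (\<Sum>k<6. [549113909/1000000000, 48552507/500000000, - 4799823/1000000000, 0, 847404991/1000000000, 15951587937/200000000] ! k * z k)\<bar> \<le> 6 * (1 / 10 ^ 9 * 10000)"
    using assms by (rule ystep_approx) (simp_all add: numB)
  then show ?thesis by (simp add: sum6)
qed

lemma approxB4:
  assumes "\<And>k. k < 6 \<Longrightarrow> \<bar>z k\<bar> \<le> 10000"
  shows "\<bar>ystep cB (VB 4) (VB 5 0) 0 0 z - ((1060596011/1000000000) * z 1 + (104666139/500000000) * z 2 + (94331419/62500000) * z 3 - (42309409/40000000) * z 4 - (22038378071/62500000) * z 5)\<bar> \<le> 3 / 50000"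
proof -
  have "\<bar>coef cB (VB 4) (VB 5 0) 0 k - [0, 1060596011/1000000000, 104666139/500000000, 94331419/62500000, - 42309409/40000000, - 22038378071/62500000] ! k\<bar> \<le> 1 / 10 ^ 9" if "k < 6" for k
    using that by (rule less6E) (simp_all add: coef_def numB)
  then have "\<bar>ystep cB (VB 4) (VB 5 0) 0 0 z - (\<Sum>k<6. [0, 1060596011/1000000000, 104666139/500000000, 94331419/62500000, - 42309409/40000000, - 22038378071/62500000] ! k * z k)\<bar> \<le> 6 * (1 / 10 ^ 9 * 10000)"
    using assms by (rule ystep_approx) (simp_all add: numB)
  then show ?thesis by (simp add: sum6)
qed

lemma approxB5:
  assumes "\<And>k. k < 6 \<Longrightarrow> \<bar>z k\<bar> \<le> 10000"
  shows "\<bar>ystep cB (VB 5) (VB 6 1) 1 0 z - ((563901959/1000000000) * z 0 + (1460246/1953125) * z 2 - (169288061/1000000000) * z 3 + (83596929/100000000) * z 4 + (64278602707/250000000) * z 5)\<bar> \<le> 3 / 50000"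
proof -
  have "\<bar>coef cB (VB 5) (VB 6 1) 1 k - [563901959/1000000000, 0, 1460246/1953125, - 169288061/1000000000, 83596929/100000000, 64278602707/250000000] ! k\<bar> \<le> 1 / 10 ^ 9" if "k < 6" for k
    using that by (rule less6E) (simp_all add: coef_def numB)
  then have "\<bar>ystep cB (VB 5) (VB 6 1) 1 0 z - (\<Sum>k<6. [563901959/1000000000, 0, 1460246/1953125, - 169288061/1000000000, 83596929/100000000, 64278602707/250000000] ! k * z k)\<bar> \<le> 6 * (1 / 10 ^ 9 * 10000)"
    using assms by (rule ystep_approx) (simp_all add: numB)
  then show ?thesis by (simp add: sum6)
qed

lemma approxB6:
  assumes "\<And>k. k < 6 \<Longrightarrow> \<bar>z k\<bar> \<le> 10000"
  shows "\<bar>ystep cB (VB 6) (VB 7 4) 4 0 z - (- (38026729/500000000) * z 0 + (3183917/40000000) * z 1 + (259374397/500000000) * z 2 + (433615339/1000000000) * z 3 + (2479317533/31250000) * z 5)\<bar> \<le> 3 / 50000"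
proof -
  have "\<bar>coef cB (VB 6) (VB 7 4) 4 k - [- 38026729/500000000, 3183917/40000000, 259374397/500000000, 433615339/1000000000, 0, 2479317533/31250000] ! k\<bar> \<le> 1 / 10 ^ 9" if "k < 6" for k
    using that by (rule less6E) (simp_all add: coef_def numB)
  then have "\<bar>ystep cB (VB 6) (VB 7 4) 4 0 z - (\<Sum>k<6. [- 38026729/500000000, 3183917/40000000, 259374397/500000000, 433615339/1000000000, 0, 2479317533/31250000] ! k * z k)\<bar> \<le> 6 * (1 / 10 ^ 9 * 10000)"
    using assms by (rule ystep_approx) (simp_all add: numB)
  then show ?thesis by (simp add: sum6)
qed

lemma approxB7:
  assumes "\<And>k. k < 6 \<Longrightarrow> \<bar>z k\<bar> \<le> 10000"
  shows "\<bar>ystep cB (VB 7) (VB 8 3) 3 0 z - ((54782651/100000000) * z 0 - (5966969/100000000) * z 1 - (1046587/125000000) * z 2 + (612855543/500000000) * z 4 + (133390183061/1000000000) * z 5)\<bar> \<le> 3 / 50000"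
proof -
  have "\<bar>coef cB (VB 7) (VB 8 3) 3 k - [54782651/100000000, - 5966969/100000000, - 1046587/125000000, 0, 612855543/500000000, 133390183061/1000000000] ! k\<bar> \<le> 1 / 10 ^ 9" if "k < 6" for k
    using that by (rule less6E) (simp_all add: coef_def numB)
  then have "\<bar>ystep cB (VB 7) (VB 8 3) 3 0 z - (\<Sum>k<6. [54782651/100000000, - 5966969/100000000, - 1046587/125000000, 0, 612855543/500000000, 133390183061/1000000000] ! k * z k)\<bar> \<le> 6 * (1 / 10 ^ 9 * 10000)"
    using assms by (rule ystep_approx) (simp_all add: numB)
  then show ?thesis by (simp add: sum6)
qed

lemma approxB8:
  assumes "\<And>k. k < 6 \<Longrightarrow> \<bar>z k\<bar> \<le> 10000"
  shows "\<bar>ystep cB (VB 8) (VB 9 2) 2 0 z - ((2502133/31250000) * z 0 + (402061389/1000000000) * z 1 - (444689/100000000) * z 3 + (1241501091/1000000000) * z 4 + (19442378649/200000000) * z 5)\<bar> \<le> 3 / 50000"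
proof -
  have "\<bar>coef cB (VB 8) (VB 9 2) 2 k - [2502133/31250000, 402061389/1000000000, 0, - 444689/100000000, 1241501091/1000000000, 19442378649/200000000] ! k\<bar> \<le> 1 / 10 ^ 9" if "k < 6" for k
    using that by (rule less6E) (simp_all add: coef_def numB)
  then have "\<bar>ystep cB (VB 8) (VB 9 2) 2 0 z - (\<Sum>k<6. [2502133/31250000, 402061389/1000000000, 0, - 444689/100000000, 1241501091/1000000000, 19442378649/200000000] ! k * z k)\<bar> \<le> 6 * (1 / 10 ^ 9 * 10000)"
    using assms by (rule ystep_approx) (simp_all add: numB)
  then show ?thesis by (simp add: sum6)
qed

lemma approxB9:
  assumes "\<And>k. k < 6 \<Longrightarrow> \<bar>z k\<bar> \<le> 10000"
  shows "\<bar>ystep cB (VB 9) (VB 10 4) 4 0 z - (- (107556159/500000000) * z 0 + (7122681/62500000) * z 1 + (626470477/1000000000) * z 2 + (94935789/200000000) * z 3 + (34527581369/500000000) * z 5)\<bar> \<le> 3 / 50000"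
proof -
  have "\<bar>coef cB (VB 9) (VB 10 4) 4 k - [- 107556159/500000000, 7122681/62500000, 626470477/1000000000, 94935789/200000000, 0, 34527581369/500000000] ! k\<bar> \<le> 1 / 10 ^ 9" if "k < 6" for k
    using that by (rule less6E) (simp_all add: coef_def numB)
  then have "\<bar>ystep cB (VB 9) (VB 10 4) 4 0 z - (\<Sum>k<6. [- 107556159/500000000, 7122681/62500000, 626470477/1000000000, 94935789/200000000, 0, 34527581369/500000000] ! k * z k)\<bar> \<le> 6 * (1 / 10 ^ 9 * 10000)"
    using assms by (rule ystep_approx) (simp_all add: numB)
  then show ?thesis by (simp add: sum6)
qed

lemma contractB:
  assumes y: "y \<in> KB" and w: "w 0 = 0" "w 5 = 1"
    "\<And>k. k < 6 \<Longrightarrow> \<bar>w k - (yt cB jsB VB 10 0 y k - VB 0 k * yt cB jsB VB 10 0 y 0)\<bar> < 1 / 100"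
  shows "w \<in> KB"
proof -
  obtain s1 s2 s3 s4 where y0: "y 0 = 0" "y 5 = 1"
    and s: "- 1 \<le> s1" "s1 \<le> 1" "- 1 \<le> s2" "s2 \<le> 1" "- 1 \<le> s3" "s3 \<le> 1" "- 1 \<le> s4" "s4 \<le> 1"
    and ys: "y 1 = 20 * s1 + 40 * s2 + 20 * s3 + 6 * s4 + 1192"
      "y 2 = 13 * s1 + 44 * s2 + 20 * s3 - 7 * s4 + 1448"
      "y 3 = 4 * s1 + 25 * s2 + 20 * s3 + 26 * s4 + 920"
      "y 4 = 12 * s1 + 44 * s2 + 20 * s3 + 9 * s4 + 1549"
    using y unfolding KB_def by blast
  define z where "z t = yt cB jsB VB t 0 y" for t
  have z_Suc: "z (Suc t) = (z t)(jsB t := ystep cB (VB t) (VB (Suc t) (jsB t)) (jsB t) 0 (z t))" for t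
    by (simp add: z_def)
  have v0: "z 0 0 = 0" "z 0 1 = y 1" "z 0 2 = y 2" "z 0 3 = y 3" "z 0 4 = y 4" "z 0 5 = 1"
    using y0 by (simp_all add: z_def)
  have yb: "- 10000 \<le> y 1" "y 1 \<le> 10000"
    "- 10000 \<le> y 2" "y 2 \<le> 10000"
    "- 10000 \<le> y 3" "y 3 \<le> 10000"
    "- 10000 \<le> y 4" "y 4 \<le> 10000"
    using ys s by linarith+
  have b0: "\<bar>z 0 k\<bar> \<le> 10000" if "k < 6" for k
    using that by (rule less6E) (use yb in \<open>simp_all add: v0 abs_le_iff\<close>)
  define u0 where "u0 = ystep cB (VB 0) (VB 1 0) 0 0 (z 0)"
  have "\<bar>u0 - ((976419423/1000000000) * y 1 + (301906867/1000000000) * y 2 + (1085878283/1000000000) * y 3 - (7111151/15625000) * y 4 - 191756484957/1000000000)\<bar> \<le> 3 / 50000"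
    using approxB0[of "z 0", OF b0] by (simp add: u0_def v0)
  then have e0: "u0 \<le> (223353/10000) * s1 + (297313/5000) * s2 + (190909/5000) * s3 + (13941/500) * s4 + 851666897/500000"
    "(223353/10000) * s1 + (297313/5000) * s2 + (190909/5000) * s3 + (13941/500) * s4 + 851666703/500000 \<le> u0"
    using ys s unfolding abs_le_iff by linarith+
  have ub0: "- 10000 \<le> u0" "u0 \<le> 10000"
    using e0 s by linarith+
  have z1: "z 1 = (z 0)(0 := u0)"
    using z_Suc[of 0] by (simp add: jsB_def u0_def One_nat_def)
  have v1: "z 1 0 = u0" "z 1 1 = y 1" "z 1 2 = y 2" "z 1 3 = y 3" "z 1 4 = y 4" "z 1 5 = 1"
    by (simp_all add: z1 v0)
  have b1: "\<bar>z 1 k\<bar> \<le> 10000" if "k < 6" for k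
    using that by (rule less6E) (use yb ub0 in \<open>simp_all add: v1 abs_le_iff\<close>)
  define u1 where "u1 = ystep cB (VB 1) (VB 2 1) 1 0 (z 1)"
  have "\<bar>u1 - ((744184619/1000000000) * u0 + (11016801/20000000) * y 2 - (31068369/500000000) * y 3 + (42391393/100000000) * y 4 + 167406455121/1000000000)\<bar> \<le> 3 / 50000"
    using approxB1[of "z 1", OF b1] by (simp add: u1_def v1)
  then have e1: "u1 \<le> (286209/10000) * s1 + (855869/10000) * s2 + (466667/10000) * s3 + (190931/10000) * s4 + 2832094741/1000000"
    "(286209/10000) * s1 + (855869/10000) * s2 + (466667/10000) * s3 + (190931/10000) * s4 + 2832094059/1000000 \<le> u1"
    using ys e0 s unfolding abs_le_iff by linarith+
  have ub1: "- 10000 \<le> u1" "u1 \<le> 10000"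
    using e1 s by linarith+
  have z2: "z 2 = (z 1)(1 := u1)"
    using z_Suc[of 1] by (simp add: jsB_def u1_def)
  have v2: "z 2 0 = u0" "z 2 1 = u1" "z 2 2 = y 2" "z 2 3 = y 3" "z 2 4 = y 4" "z 2 5 = 1"
    by (simp_all add: z2 v1)
  have b2: "\<bar>z 2 k\<bar> \<le> 10000" if "k < 6" for k
    using that by (rule less6E) (use yb ub0 ub1 in \<open>simp_all add: v2 abs_le_iff\<close>)
  define u2 where "u2 = ystep cB (VB 2) (VB 3 2) 2 0 (z 2)"
  have "\<bar>u2 - ((20564897/200000000) * u0 + (280374737/1000000000) * u1 - (2152609/200000000) * y 3 + (3724087/2500000) * y 4 + 59717124801/500000000)\<bar> \<le> 3 / 50000"
    using approxB2[of "z 2", OF b2] by (simp add: u2_def v2)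
  then have e2: "u2 \<le> (140769/5000) * s1 + (190771/2000) * s2 + (116469/2500) * s3 + (21347/1000) * s4 + 3386169043/1000000"
    "(140769/5000) * s1 + (190771/2000) * s2 + (116469/2500) * s3 + (21347/1000) * s4 + 3386168357/1000000 \<le> u2"
    using ys e0 e1 s unfolding abs_le_iff by linarith+
  have ub2: "- 10000 \<le> u2" "u2 \<le> 10000"
    using e2 s by linarith+
  have z3: "z 3 = (z 2)(2 := u2)"
    using z_Suc[of 2] by (simp add: jsB_def u2_def)
  have v3: "z 3 0 = u0" "z 3 1 = u1" "z 3 2 = u2" "z 3 3 = y 3" "z 3 4 = y 4" "z 3 5 = 1"
    by (simp_all add: z3 v2)
  have b3: "\<bar>z 3 k\<bar> \<le> 10000" if "k < 6" for k
    using that by (rule less6E) (use yb ub0 ub1 ub2 in \<open>simp_all add: v3 abs_le_iff\<close>)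
  define u3 where "u3 = ystep cB (VB 3) (VB 4 3) 3 0 (z 3)"
  have "\<bar>u3 - ((549113909/1000000000) * u0 + (48552507/500000000) * u1 - (4799823/1000000000) * u2 + (847404991/1000000000) * y 4 + 15951587937/200000000)\<bar> \<le> 3 / 50000"
    using approxB3[of "z 3", OF b3] by (simp add: u3_def v3)
  then have e3: "u3 \<le> (31347/1250) * s1 + (388953/5000) * s2 + (211111/5000) * s3 + (123443/5000) * s4 + 2586470293/1000000"
    "(31347/1250) * s1 + (388953/5000) * s2 + (211111/5000) * s3 + (123443/5000) * s4 + 2586469707/1000000 \<le> u3"
    using ys e0 e1 e2 s unfolding abs_le_iff by linarith+
  have ub3: "- 10000 \<le> u3" "u3 \<le> 10000"
    using e3 s by linarith+
  have z4: "z 4 = (z 3)(3 := u3)"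
    using z_Suc[of 3] by (simp add: jsB_def u3_def)
  have v4: "z 4 0 = u0" "z 4 1 = u1" "z 4 2 = u2" "z 4 3 = u3" "z 4 4 = y 4" "z 4 5 = 1"
    by (simp_all add: z4 v3)
  have b4: "\<bar>z 4 k\<bar> \<le> 10000" if "k < 6" for k
    using that by (rule less6E) (use yb ub0 ub1 ub2 ub3 in \<open>simp_all add: v4 abs_le_iff\<close>)
  define u4 where "u4 = ystep cB (VB 4) (VB 5 0) 0 0 (z 4)"
  have "\<bar>u4 - ((1060596011/1000000000) * u1 + (104666139/500000000) * u2 + (94331419/62500000) * u3 - (42309409/40000000) * y 4 - 22038378071/62500000)\<bar> \<le> 3 / 50000"
    using approxB4[of "z 4", OF b4] by (simp add: u4_def v4)
  then have e4: "u4 \<le> (76757/1250) * s1 + (113506/625) * s2 + (509091/5000) * s3 + (65577/1250) * s4 + 1406315933/250000"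
    "(76757/1250) * s1 + (113506/625) * s2 + (509091/5000) * s3 + (65577/1250) * s4 + 1406315417/250000 \<le> u4"
    using ys e1 e2 e3 s unfolding abs_le_iff by linarith+
  have ub4: "- 10000 \<le> u4" "u4 \<le> 10000"
    using e4 s by linarith+
  have z5: "z 5 = (z 4)(0 := u4)"
    using z_Suc[of 4] by (simp add: jsB_def u4_def)
  have v5: "z 5 0 = u4" "z 5 1 = u1" "z 5 2 = u2" "z 5 3 = u3" "z 5 4 = y 4" "z 5 5 = 1"
    by (simp_all add: z5 v4)
  have b5: "\<bar>z 5 k\<bar> \<le> 10000" if "k < 6" for k
    using that by (rule less6E) (use yb ub4 ub1 ub2 ub3 in \<open>simp_all add: v5 abs_le_iff\<close>)
  define u5 where "u5 = ystep cB (VB 5) (VB 6 1) 1 0 (z 5)"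
  have "\<bar>u5 - ((563901959/1000000000) * u4 + (1460246/1953125) * u2 - (169288061/1000000000) * u3 + (83596929/100000000) * y 4 + 64278602707/250000000)\<bar> \<le> 3 / 50000"
    using approxB5[of "z 5", OF b5] by (simp add: u5_def v5)
  then have e5: "u5 \<le> (614621/10000) * s1 + (986691/5000) * s2 + (509091/5000) * s3 + (244437/5000) * s4 + 3408962677/500000"
    "(614621/10000) * s1 + (986691/5000) * s2 + (509091/5000) * s3 + (244437/5000) * s4 + 3408961623/500000 \<le> u5"
    using ys e4 e2 e3 s unfolding abs_le_iff by linarith+
  have ub5: "- 10000 \<le> u5" "u5 \<le> 10000"
    using e5 s by linarith+
  have z6: "z 6 = (z 5)(1 := u5)"
    using z_Suc[of 5] by (simp add: jsB_def u5_def)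
  have v6: "z 6 0 = u4" "z 6 1 = u5" "z 6 2 = u2" "z 6 3 = u3" "z 6 4 = y 4" "z 6 5 = 1"
    by (simp_all add: z6 v5)
  have b6: "\<bar>z 6 k\<bar> \<le> 10000" if "k < 6" for k
    using that by (rule less6E) (use yb ub4 ub5 ub2 ub3 in \<open>simp_all add: v6 abs_le_iff\<close>)
  define u6 where "u6 = ystep cB (VB 6) (VB 7 4) 4 0 (z 6)"
  have "\<bar>u6 - (- (38026729/500000000) * u4 + (3183917/40000000) * u5 + (259374397/500000000) * u2 + (433615339/1000000000) * u3 + 2479317533/31250000)\<bar> \<le> 3 / 50000"
    using approxB6[of "z 6", OF b6] by (simp add: u6_def v6)
  then have e6: "u6 \<le> (257009/10000) * s1 + (21277/250) * s2 + (428363/10000) * s3 + (43361/2000) * s4 + 1536157379/500000"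
    "(257009/10000) * s1 + (21277/250) * s2 + (428363/10000) * s3 + (43361/2000) * s4 + 1536156721/500000 \<le> u6"
    using e4 e5 e2 e3 s unfolding abs_le_iff by linarith+
  have ub6: "- 10000 \<le> u6" "u6 \<le> 10000"
    using e6 s by linarith+
  have z7: "z 7 = (z 6)(4 := u6)"
    using z_Suc[of 6] by (simp add: jsB_def u6_def)
  have v7: "z 7 0 = u4" "z 7 1 = u5" "z 7 2 = u2" "z 7 3 = u3" "z 7 4 = u6" "z 7 5 = 1"
    by (simp_all add: z7 v6)
  have b7: "\<bar>z 7 k\<bar> \<le> 10000" if "k < 6" for k
    using that by (rule less6E) (use yb ub4 ub5 ub2 ub3 ub6 in \<open>simp_all add: v7 abs_le_iff\<close>)
  define u7 where "u7 = ystep cB (VB 7) (VB 8 3) 3 0 (z 7)"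
  have "\<bar>u7 - ((54782651/100000000) * u4 - (5966969/100000000) * u5 - (1046587/125000000) * u2 + (612855543/500000000) * u6 + 133390183061/1000000000)\<bar> \<le> 3 / 50000"
    using approxB7[of "z 7", OF b7] by (simp add: u7_def v7)
  then have e7: "u7 \<le> (612383/10000) * s1 + (956173/5000) * s2 + (1018181/10000) * s3 + (522181/10000) * s4 + 818206819/125000"
    "(612383/10000) * s1 + (956173/5000) * s2 + (1018181/10000) * s3 + (522181/10000) * s4 + 409103203/62500 \<le> u7"
    using e4 e5 e2 e6 s unfolding abs_le_iff by linarith+
  have ub7: "- 10000 \<le> u7" "u7 \<le> 10000"
    using e7 s by linarith+
  have z8: "z 8 = (z 7)(3 := u7)"
    using z_Suc[of 7] by (simp add: jsB_def u7_def)
  have v8: "z 8 0 = u4" "z 8 1 = u5" "z 8 2 = u2" "z 8 3 = u7" "z 8 4 = u6" "z 8 5 = 1"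
    by (simp_all add: z8 v7)
  have b8: "\<bar>z 8 k\<bar> \<le> 10000" if "k < 6" for k
    using that by (rule less6E) (use yb ub4 ub5 ub2 ub7 ub6 in \<open>simp_all add: v8 abs_le_iff\<close>)
  define u8 where "u8 = ystep cB (VB 8) (VB 9 2) 2 0 (z 8)"
  have "\<bar>u8 - ((2502133/31250000) * u4 + (402061389/1000000000) * u5 - (444689/100000000) * u7 + (1241501091/1000000000) * u6 + 19442378649/200000000)\<bar> \<le> 3 / 50000"
    using approxB8[of "z 8", OF b8] by (simp add: u8_def v8)
  then have e8: "u8 \<le> (153159/2500) * s1 + (397389/2000) * s2 + (1018181/10000) * s3 + (126351/2500) * s4 + 7074015973/1000000"
    "(153159/2500) * s1 + (397389/2000) * s2 + (1018181/10000) * s3 + (126351/2500) * s4 + 7074013027/1000000 \<le> u8"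
    using e4 e5 e7 e6 s unfolding abs_le_iff by linarith+
  have ub8: "- 10000 \<le> u8" "u8 \<le> 10000"
    using e8 s by linarith+
  have z9: "z 9 = (z 8)(2 := u8)"
    using z_Suc[of 8] by (simp add: jsB_def u8_def)
  have v9: "z 9 0 = u4" "z 9 1 = u5" "z 9 2 = u8" "z 9 3 = u7" "z 9 4 = u6" "z 9 5 = 1"
    by (simp_all add: z9 v8)
  have b9: "\<bar>z 9 k\<bar> \<le> 10000" if "k < 6" for k
    using that by (rule less6E) (use yb ub4 ub5 ub8 ub7 ub6 in \<open>simp_all add: v9 abs_le_iff\<close>)
  define u9 where "u9 = ystep cB (VB 9) (VB 10 4) 4 0 (z 9)"
  have "\<bar>u9 - (- (107556159/500000000) * u4 + (7122681/62500000) * u5 + (626470477/1000000000) * u8 + (94935789/200000000) * u7 + 34527581369/500000000)\<bar> \<le> 3 / 50000"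
    using approxB9[of "z 9", OF b9] by (simp add: u9_def v9)
  then have e9: "u9 \<le> (612437/10000) * s1 + (99337/500) * s2 + (1018181/10000) * s3 + (507351/10000) * s4 + 448420583/62500"
    "(612437/10000) * s1 + (99337/500) * s2 + (1018181/10000) * s3 + (507351/10000) * s4 + 896840609/125000 \<le> u9"
    using e4 e5 e8 e7 s unfolding abs_le_iff by linarith+
  have ub9: "- 10000 \<le> u9" "u9 \<le> 10000"
    using e9 s by linarith+
  have z10: "z 10 = (z 9)(4 := u9)"
    using z_Suc[of 9] by (simp add: jsB_def u9_def)
  have v10: "z 10 0 = u4" "z 10 1 = u5" "z 10 2 = u8" "z 10 3 = u7" "z 10 4 = u9" "z 10 5 = 1"
    by (simp_all add: z10 v9)
  have "\<bar>w 1 - (u5 - u4)\<bar> < 1 / 100" "\<bar>w 2 - (u8 - u4)\<bar> < 1 / 100" "\<bar>w 3 - (u7 - u4)\<bar> < 1 / 100" "\<bar>w 4 - (u9 - u4)\<bar> < 1 / 100"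
    using w(3)[of 1] w(3)[of 2] w(3)[of 3] w(3)[of 4] unfolding z_def[symmetric] v10
    by (simp_all add: VB_def)
  then have wk: "w 1 \<le> u5 - u4 + 1 / 100" "u5 - u4 - 1 / 100 \<le> w 1"
    "w 2 \<le> u8 - u4 + 1 / 100" "u8 - u4 - 1 / 100 \<le> w 2"
    "w 3 \<le> u7 - u4 + 1 / 100" "u7 - u4 - 1 / 100 \<le> w 3"
    "w 4 \<le> u9 - u4 + 1 / 100" "u9 - u4 - 1 / 100 \<le> w 4"
    unfolding abs_less_iff by linarith+
  \<comment> \<open>Box coordinates of \<open>w\<close>, from the inverse of the system that defines
    \<open>KB\<close>.\<close>
  define r1 where "r1 = (304/2819) * w 1 - (125/2819) * w 2 - (64/2819) * w 3 - (115/2819) * w 4 + 55647/2819"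
  define r2 where "r2 = - (111/2819) * w 1 - (112/2819) * w 2 - (125/2819) * w 3 + (348/2819) * w 4 - 129564/2819"
  define r3 where "r3 = (213/11276) * w 1 + (2021/14095) * w 2 + (1576/14095) * w 3 - (6317/28190) * w 4 + 397637/28190"
  define r4 where "r4 = (19/2819) * w 1 - (184/2819) * w 2 - (4/2819) * w 3 + (169/2819) * w 4 - 14317/2819"
  have "- 1 \<le> r1" "r1 \<le> 1" "- 1 \<le> r2" "r2 \<le> 1" "- 1 \<le> r3" "r3 \<le> 1" "- 1 \<le> r4" "r4 \<le> 1"
    using wk e4 e5 e8 e7 e9 s unfolding r1_def r2_def r3_def r4_def by linarith+
  moreover have "w 1 = 20 * r1 + 40 * r2 + 20 * r3 + 6 * r4 + 1192"
    "w 2 = 13 * r1 + 44 * r2 + 20 * r3 - 7 * r4 + 1448"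
    "w 3 = 4 * r1 + 25 * r2 + 20 * r3 + 26 * r4 + 920"
    "w 4 = 12 * r1 + 44 * r2 + 20 * r3 + 9 * r4 + 1549"
    unfolding r1_def r2_def r3_def r4_def by (simp_all add: field_simps)
  ultimately show ?thesis unfolding KB_def using w(1,2) by blast
qed

lemma driftB:
  assumes "y \<in> KB"
  shows "1 \<le> 2 * (1 - 5 / 16) * dot6 (lf cB (VB 0)) y
    - 4 * (y (jsB 0) * lf cB (VB 0) (jsB 0) + VB 0 (jsB 0) * lf cB y (jsB 0))" (is "_ \<le> ?d")
proof -
  obtain s1 s2 s3 s4 where y0: "y 0 = 0" "y 5 = 1"
    and s: "- 1 \<le> s1" "s1 \<le> 1" "- 1 \<le> s2" "s2 \<le> 1" "- 1 \<le> s3" "s3 \<le> 1" "- 1 \<le> s4" "s4 \<le> 1"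
    and ys: "y 1 = 20 * s1 + 40 * s2 + 20 * s3 + 6 * s4 + 1192"
      "y 2 = 13 * s1 + 44 * s2 + 20 * s3 - 7 * s4 + 1448"
      "y 3 = 4 * s1 + 25 * s2 + 20 * s3 + 26 * s4 + 920"
      "y 4 = 12 * s1 + 44 * s2 + 20 * s3 + 9 * s4 + 1549"
    using assms unfolding KB_def by blast
  have "?d = (128317795637493/4) * y 1 + (19837798600191/2) * y 2 + (71351257660509/2) * y 3 - 14952381313992 * y 4 - 6300000000000000"
    by (simp add: numB dot66 y0 field_simps)
  then show ?thesis using ys s by linarith
qed

interpretation B: quad_cycle cB jsB VB "56/11" "5 / 16" KB
proof
  show "cB j k = cB k j" if "j < 6" "k < 6" for j k
    using that by (elim less6E) (simp_all add: numB)
  show "jsB t < 5" if "t < 10" for t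
    using that by (elim less10E) (simp_all add: numB)
  show "VB 0 k = (if k < 5 then 1 else 0)" for k
    by (cases "k < 5") (auto elim!: less5E simp: numB)
  show "VB 10 k = 56/11 * VB 0 k" for k
    by (cases "k < 5") (auto elim!: less5E simp: numB)
  show "VB (Suc t) = (VB t)(jsB t := VB (Suc t) (jsB t))" if "t < 10" for t
  proof
    fix k show "VB (Suc t) k = ((VB t)(jsB t := VB (Suc t) (jsB t))) k"
    proof (cases "k < 5")
      case True
      then show ?thesis using that by (elim less5E less10E) (simp_all add: numB)
    next
      case False
      then show ?thesis using that by (elim less10E) (simp_all add: numB)
    qed
  qed
  show "0 < VB t k" if "t \<le> 10" "k < 5" for t k
  proof -
    have "t < 10 \<or> t = 10" using that by linarith
    then show ?thesis using that(2) by (elim disjE less5E less10E) (simp_all add: numB)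
  qed
  show "qf cB (VB t) = 2 * (VB t (jsB t) + VB (Suc t) (jsB t)) * lf cB (VB t) (jsB t)" if "t < 10" for t
    using that by (elim less10E) (simp_all add: numB)
  show "0 < lf cB (VB t) (jsB t)" if "t < 10" for t
    using that by (elim less10E) (simp_all add: numB)
  show "VB t (jsB t) * lf cB (VB t) (jsB t) < VB t k * lf cB (VB t) k"
    if "t < 10" "k < 5" "k \<noteq> jsB t" for t k
    using that by (elim less10E less5E) (simp_all add: numB)
  show "VB (Suc 0) (jsB 0) - VB 0 (jsB 0) = 5 / 16 * (VB (Suc 0) (jsB 0) + VB 0 (jsB 0))"
    by (simp add: numB)
  show "VB (Suc t) (jsB t) - VB t (jsB t) > 5 / 16 * (VB (Suc t) (jsB t) + VB t (jsB t))"
    if "0 < t" "t < 10" for t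
    using that by (elim less10E) (simp_all add: numB)
  show "(1 :: real) < 56/11" by simp
  show "y 0 = 0" "y 5 = 1" if "y \<in> KB" for y
    using that unfolding KB_def by blast+
  show "\<exists>b. \<forall>y\<in>KB. \<forall>k<6. \<bar>y k\<bar> \<le> b"
  proof (intro exI[of _ 10000] ballI allI impI)
    fix y and k :: nat assume "y \<in> KB" "k < 6"
    then obtain s1 s2 s3 s4 where y0: "y 0 = 0" "y 5 = 1"
      and s: "- 1 \<le> s1" "s1 \<le> 1" "- 1 \<le> s2" "s2 \<le> 1" "- 1 \<le> s3" "s3 \<le> 1" "- 1 \<le> s4" "s4 \<le> 1"
      and ys: "y 1 = 20 * s1 + 40 * s2 + 20 * s3 + 6 * s4 + 1192"
        "y 2 = 13 * s1 + 44 * s2 + 20 * s3 - 7 * s4 + 1448"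
        "y 3 = 4 * s1 + 25 * s2 + 20 * s3 + 26 * s4 + 920"
        "y 4 = 12 * s1 + 44 * s2 + 20 * s3 + 9 * s4 + 1549"
      unfolding KB_def by blast
    have "- 10000 \<le> y 1" "y 1 \<le> 10000" "- 10000 \<le> y 2" "y 2 \<le> 10000" "- 10000 \<le> y 3" "y 3 \<le> 10000" "- 10000 \<le> y 4" "y 4 \<le> 10000"
      using ys s by linarith+
    then show "\<bar>y k\<bar> \<le> 10000" using \<open>k < 6\<close> by (elim less6E) (simp_all add: y0 abs_le_iff)
  qed
  show "\<exists>\<delta>>0. \<forall>y\<in>KB. \<forall>w. w 0 = 0 \<longrightarrow> w 5 = 1 \<longrightarrow>
      (\<forall>k<6. \<bar>w k - (yt cB jsB VB 10 0 y k - VB 0 k * yt cB jsB VB 10 0 y 0)\<bar> < \<delta>) \<longrightarrow> w \<in> KB"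
    by (intro exI[of _ "1 / 100"] conjI ballI allI impI) (simp, rule contractB, auto)
  show "\<exists>d>0. \<forall>y\<in>KB. d \<le> 2 * (1 - 5 / 16) * dot6 (lf cB (VB 0)) y
      - 4 * (y (jsB 0) * lf cB (VB 0) (jsB 0) + VB 0 (jsB 0) * lf cB y (jsB 0))"
    using driftB by (intro exI[of _ 1]) auto
qed

definition yiB :: "nat \<Rightarrow> int" where
  "yiB k = [0, 1192, 1448, 920, 1549, 1] ! k"

lemma matrixB:
  obtains \<eta>0 where "\<eta>0 > 0"
    "\<forall>\<eta>. 0 < \<eta> \<longrightarrow> \<eta> \<le> \<eta>0 \<longrightarrow> (\<exists>m M. regular_run m 5 M \<and>
       bursts (5 / 16) \<eta> (56/11) (\<lambda>k. top_edge m 5 M (ada_iter m 5 M k)) \<and>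
       (\<forall>r<m. 1 \<le> (\<Sum>j<5. M r j)) \<and> (\<exists>D\<in>prob_simplex m. \<forall>j<5. edge m M D j = 1 / 5))"
proof (rule B.matrix_exists)
  show "cB a b = real (cnB a b)" for a b by (simp add: cB_def)
  show "cB a a = 0" if "a < 6" for a using that by (elim less6E) (simp_all add: numB)
  show "0 < cB 0 1" "0 < cB 1 2" "0 < cB 2 3" "0 < cB 3 4" "0 < cB 4 0" by (simp_all add: numB)
  show "(\<lambda>k. real_of_int (yiB k)) \<in> KB"
    unfolding KB_def mem_Collect_eq by (intro conjI exI[of _ "0 :: real"]) (simp_all add: yiB_def)
  show "real_of_int (yiB k) = real_of_int (yiB k)" for k ..
qed simp_all

declare One_nat_def [simp]

section \<open>The counterexample\<close>

text \<open>Under any distribution the first five edges sum to the mean of the row sums over these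
  columns, which is at least 1, so their maximum is at least 1/5; \<open>D\<close> attains
  it.\<close>

lemma margin_eq_fifth:
  assumes m: "0 < m" and N: "5 \<le> N"
    and rows: "\<And>i. i < m \<Longrightarrow> 1 \<le> (\<Sum>j<5. M i j)"
    and D: "D \<in> prob_simplex m" "\<And>j. j < N \<Longrightarrow> edge m M D j = 1 / 5"
  shows "margin m N M = 1 / 5"
  unfolding margin_def
proof (rule cInf_eq_minimum)
  have "edge m M D ` {..<N} = {1 / 5}" using D(2) N by (force simp: image_iff)
  then have "Max (edge m M D ` {..<N}) = 1 / 5" by simp
  then show "1 / 5 \<in> (\<lambda>D. Max (edge m M D ` {..<N})) ` prob_simplex m"
    using D(1) by (intro image_eqI[of _ _ D]) auto
next
  fix x assume "x \<in> (\<lambda>D. Max (edge m M D ` {..<N})) ` prob_simplex m"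
  then obtain E where E: "E \<in> prob_simplex m" and x: "x = Max (edge m M E ` {..<N})" by blast
  have "edge m M E j \<le> x" if "j < 5" for j
    unfolding x using that N by (intro Max_ge) auto
  then have "(\<Sum>j<5. edge m M E j) \<le> (\<Sum>j<5::nat. x)" by (intro sum_mono) auto
  also have "(\<Sum>j<5. edge m M E j) = (\<Sum>i<m. E i * (\<Sum>j<5. M i j))"
    unfolding edge_def by (subst sum.swap) (simp add: sum_distrib_left)
  moreover have "(\<Sum>i<m. E i * 1) \<le> (\<Sum>i<m. E i * (\<Sum>j<5. M i j))"
    using E rows by (intro sum_mono mult_left_mono) (auto simp: prob_simplex_def)
  ultimately show "1 / 5 \<le> x" using E by (simp add: prob_simplex_def)
qed

text \<open>Clearing denominators, the prime 5 divides one side but not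
  \<open>56 ^ q\<close>.\<close>

lemma five_fiftysix_independent:
  assumes "0 < p" "0 < q"
  shows "(5 :: real) ^ p \<noteq> (56 / 11) ^ q"
proof
  assume "(5 :: real) ^ p = (56 / 11) ^ q"
  then have "real (5 ^ p * 11 ^ q) = real (56 ^ q)" by (simp add: power_divide)
  then have "5 ^ p * 11 ^ q = (56 :: nat) ^ q" by (simp only: of_nat_eq_iff)
  moreover have "(5 :: nat) dvd 5 ^ p * 11 ^ q" using assms(1) by (simp add: dvd_power)
  ultimately have "(5 :: nat) dvd 56 ^ q" by simp
  moreover have "prime (5 :: nat)" by simp
  ultimately have "(5 :: nat) dvd 56" using prime_dvd_power by blast
  then show False by simp
qed

theorem theorem1:
  shows "\<exists>(m::nat) (N::nat) (M::nat \<Rightarrow> nat \<Rightarrow> real).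
           0 < m \<and> 0 < N \<and> pm1_matrix m N M \<and> margin m N M = 1/5 \<and>
           \<not> conv_finite_cycle m (adaD m N M)"
proof -
  obtain \<eta>1 where \<eta>1: "\<eta>1 > 0"
    "\<forall>\<eta>. 0 < \<eta> \<longrightarrow> \<eta> \<le> \<eta>1 \<longrightarrow> (\<exists>m M. regular_run m 5 M \<and>
       bursts (5 / 16) \<eta> 5 (\<lambda>k. top_edge m 5 M (ada_iter m 5 M k)) \<and>
       (\<forall>r<m. 1 \<le> (\<Sum>j<5. M r j)) \<and> (\<exists>D\<in>prob_simplex m. \<forall>j<5. edge m M D j = 1 / 5))"
    by (rule matrixA)
  obtain \<eta>2 where \<eta>2: "\<eta>2 > 0"
    "\<forall>\<eta>. 0 < \<eta> \<longrightarrow> \<eta> \<le> \<eta>2 \<longrightarrow> (\<exists>m M. regular_run m 5 M \<and>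
       bursts (5 / 16) \<eta> (56 / 11) (\<lambda>k. top_edge m 5 M (ada_iter m 5 M k)) \<and>
       (\<forall>r<m. 1 \<le> (\<Sum>j<5. M r j)) \<and> (\<exists>D\<in>prob_simplex m. \<forall>j<5. edge m M D j = 1 / 5))"
    by (rule matrixB)
  \<comment> \<open>The starting scale, and with it each matrix, depends on \<eta>, so the common
    threshold is fixed before the matrices are chosen.\<close>
  define \<eta> where "\<eta> = min \<eta>1 \<eta>2"
  have \<eta>: "0 < \<eta>" "\<eta> \<le> \<eta>1" "\<eta> \<le> \<eta>2" using \<eta>1(1) \<eta>2(1) by (auto simp: \<eta>_def)
  obtain m1 M1 D1 where A: "regular_run m1 5 M1"
    "bursts (5 / 16) \<eta> 5 (\<lambda>k. top_edge m1 5 M1 (ada_iter m1 5 M1 k))"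
    "\<And>r. r < m1 \<Longrightarrow> 1 \<le> (\<Sum>j<5. M1 r j)"
    "D1 \<in> prob_simplex m1" "\<And>j. j < 5 \<Longrightarrow> edge m1 M1 D1 j = 1 / 5"
    using \<eta>1(2)[rule_format, OF \<eta>(1,2)] by blast
  obtain m2 M2 D2 where B: "regular_run m2 5 M2"
    "bursts (5 / 16) \<eta> (56 / 11) (\<lambda>k. top_edge m2 5 M2 (ada_iter m2 5 M2 k))"
    "D2 \<in> prob_simplex m2" "\<And>j. j < 5 \<Longrightarrow> edge m2 M2 D2 j = 1 / 5"
    using \<eta>2(2)[rule_format, OF \<eta>(1,3)] by blast
  define m where "m = m1 * m2"
  define M where "M = prod_mat m1 5 M1 M2"
  have pos: "0 < m1" "0 < m2" using A(1) B(1) by (auto simp: regular_run_def)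
  have idx: "i mod m1 < m1" "i div m1 < m2" if "i < m" for i
    using that pos by (auto simp: m_def less_mult_imp_div_less mult.commute)
  have "pm1_matrix m (5 + 5) M"
    using A(1) B(1) idx by (auto simp: regular_run_def pm1_matrix_def M_def prod_mat_def)
  moreover have "margin m (5 + 5) M = 1 / 5"
  proof (rule margin_eq_fifth)
    \<comment> \<open>The product of two pentagon distributions: each column sees its own factor,
      and the other contributes its total weight 1.\<close>
    define D where "D i = D1 (i mod m1) * D2 (i div m1)" for i
    have sums: "(\<Sum>i<m1. D1 i) = 1" "(\<Sum>i<m2. D2 i) = 1"
      using A(4) B(3) by (auto simp: prob_simplex_def)
    show "D \<in> prob_simplex m"
      using sum_mod_div[of D1 m1 D2 m2] sums A(4) B(3) idx
      by (auto simp: prob_simplex_def D_def m_def)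
    show "edge m M D j = 1 / 5" if "j < 5 + 5" for j
    proof (cases "j < 5")
      case True
      then show ?thesis
        using edge_prod_mat(1)[of m1 m2 D D1 D2 j 5 M1 M2] A(5) sums by (simp add: D_def m_def M_def)
    next
      case False
      then have "5 + (j - 5) = j" "j - 5 < 5" using that by auto
      then show ?thesis
        using edge_prod_mat(2)[of m1 m2 D D1 D2 5 M1 M2 "j - 5"] B(4) sums by (simp add: D_def m_def M_def)
    qed
    show "1 \<le> (\<Sum>j<5. M i j)" if "i < m" for i
      using A(3)[OF idx(1)[OF that]] by (simp add: M_def prod_mat_def)
  qed (use pos in \<open>auto simp: m_def\<close>)
  moreover have "\<not> conv_finite_cycle m (adaD m (5 + 5) M)"
    unfolding m_def M_def
    by (rule prod_mat_not_conv_finite_cycle[OF A(1) B(1) A(2) B(2)])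
       (use \<eta>(1) in \<open>auto simp: five_fiftysix_independent\<close>)
  ultimately show ?thesis
    using pos by (intro exI[of _ m] exI[of _ "5 + 5"] exI[of _ M]) (auto simp: m_def)
qed

end
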